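(* Let $a\in\mathbb{Z}$ and let $Q$ be a formal variable. For partitions $\mu,\nu$ put $$C^2_{\mu\nu}(a) = q^{\frac{(a+1)\kappa_\mu}{2}}\sum_{\eta}s_{\mu^t/\eta}(q^\rho)\,s_{\nu/\eta}(q^\rho),\qquad C^1_\mu = s_\mu(q^\rho),\qquad Z_0 = \sum_{\mu}s_\mu(q^\rho)\,Q^{|\mu|}\,s_{\mu^t}(q^\rho),$$ where the sums are over all partitions. Define the normalized generating function of open Gromov-Witten invariants of the resolved conifold with one brane of framing $a$ by $$Z^a(\mathbf{x}) = \sum_{\mu}\Big(\sum_{\nu}C^2_{\mu\nu}(a)\,Q^{|\nu|}\,C^1_{\nu^t}/Z_0\Big)s_\mu(\mathbf{x}),$$ and the corresponding fermionic state by $$V = \sum_{\mu}\Big(\sum_{\nu}C^2_{\mu\nu}(a)\,Q^{|\nu|}\,C^1_{\nu^t}/Z_0\Big)|\mu\rangle .$$ Then $V$ is a Bogoliubov transform of the fermionic vacuum: there exist coefficients $R_{mn}$ ($m,n\geq 0$), which are formal power series in $Q$, such that $$V = \exp\Big(\sum_{m,n\geq 0}R_{mn}\,\psi_{m+\frac12}\,\psi^*_{-n-\frac12}\Big)|0\rangle .$$ In particular, $Z^a(\mathbf{x})$ is a tau function of the KP hierarchy in the Miwa variables $t_n = \frac{p_n(\mathbf{x})}{n}$, $n\ge 1$.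
   Context: **Partitions.** For a partition $\mu=(\mu_1\ge\dots\ge\mu_l>0)$, $|\mu|=\sum_i\mu_i$, $\mu^t$ is the conjugate partition, and $\kappa_\mu=\sum_{i=1}^l\mu_i(\mu_i-2i+1)$ (an even integer). The empty partition is included in all sums. **Symmetric functions.** $\Lambda$ is the ring of symmetric functions in $\mathbf{x}=(x_1,x_2,\dots)$, $p_n$ are the power sums, $s_\mu$ the Schur functions and $s_{\mu/\eta}$ the skew Schur functions. $f(q^\rho)$ denotes the specialization of $f\in\Lambda$ at $(q^{-1/2},q^{-3/2},\dots)$, i.e. the ring homomorphism with $p_n(q^\rho)=\frac{1}{q^{n/2}-q^{-n/2}}$. Here $q^{1/2}$ is a parameter (one may take coefficients in the field of rational functions in $q^{1/2}$). $Z_0$ is a formal power series in $Q$ with constant term $1$. $Z^a(\mathbf{x})$ and $V$ are regarded as formal power series in $Q$, where infinite formal linear combinations of the $s_\mu$, respectively of the $|\mu\rangle$, are allowed. **Fermionic Fock space.** A set $A=\{a_1>a_2>\cdots\}\subset\mathbb{Z}+\frac12$ is admissible if both $A\setminus\{r<0\}$ and $\{r\in\mathbb{Z}+\frac12: r<0\}\setminus A$ are finite. $\mathcal{F}$ is the vector space with basis the symbols $\underline{A}=\underline{a_1}\wedge\underline{a_2}\wedge\cdots$, for $A$ admissible. For a partition $\mu$, $|\mu\rangle=\underline{A_\mu}$ with $A_\mu=\{\mu_i-i+\frac12: i\ge1\}$ (where $\mu_i=0$ for $i>l$), and $|0\rangle=\underline{-\tfrac12}\wedge\underline{-\tfrac32}\wedge\cdots$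 is the vacuum. For $r\in\mathbb{Z}+\frac12$: $\psi_r\underline{A}=(-1)^k\,\underline{a_1}\wedge\cdots\wedge\underline{a_k}\wedge\underline{r}\wedge\underline{a_{k+1}}\wedge\cdots$ if $a_k>r>a_{k+1}$ for some $k\geq 0$ (with $a_0=+\infty$), and $\psi_r\underline{A}=0$ if $r\in A$; $\psi_r^*\underline{A}=(-1)^{k+1}\,\underline{a_1}\wedge\cdots\wedge\widehat{\underline{a_k}}\wedge\cdots$ if $a_k=r$ for some $k$, and $\psi^*_r\underline{A}=0$ otherwise. These satisfy $\psi_r\psi_s^*+\psi_s^*\psi_r=\delta_{rs}$, all other anticommutators being zero. The boson-fermion correspondence identifies $|\mu\rangle$ with $s_\mu$. The operators $\psi_{m+\frac12}\psi^*_{-n-\frac12}$ ($m,n\ge0$) commute with each other, and the exponential applied to $|0\rangle$ is an infinite formal linear combination of the $|\mu\rangle$, in which each coefficient is a finite polynomial expression in the $R_{mn}$. **KP tau function.** $\tau$, viewed as a formal power series in $t=(t_1,t_2,\dots)$, is a tau function of the KP hierarchy if it satisfies the Hirota bilinear identity: the coefficient of $z^{-1}$ in $\exp\big(\sum_{n\ge1}(t_n-t_n')z^n\big)\,\tau(t-[z^{-1}])\,\tau(t'+[z^{-1}])$ vanishes identically in $t,t'$, where $[z^{-1}]=(z^{-1},\frac{z^{-2}}{2},\frac{z^{-3}}{3},\dots)$. Equivalently, the corresponding fermionic state $|v\rangle$ (under $s_\mu\leftrightarrow|\mu\rangle$) satisfies $\sum_{r\in\mathbb{Z}+\frac12}\psi_r|v\rangle\otimes\psi_r^*|v\rangle=0$.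 *)

theory Defs
  imports
    "HOL-Library.Multiset"
    "HOL-Library.FuncSet"
    "HOL-Library.Groups_Big_Fun"
    "HOL-Computational_Algebra.Formal_Power_Series"
begin

text \<open>
  Sums over infinite index types are written with \<^const>\<open>Sum_any\<close>, the sum of the nonzero terms
  (\<open>0\<close> if there are infinitely many of them).  In every use below only finitely many terms are
  nonzero, for the reason stated at that place.
\<close>

section \<open>Partitions\<close>

text \<open>
  A partition is a weakly decreasing, eventually zero sequence.  Indices are shifted:
  \<open>part \<mu> i\<close> is the part usually written \<open>\<mu>\<^sub>i\<^sub>+\<^sub>1\<close>.
\<close>

typedef partition = "{\<mu> :: nat \<Rightarrow> nat. antimono \<mu> \<and> finite {i. \<mu> i \<noteq> 0}}"
  morphisms part Abs_partition
  by (rule exI[of _ "\<lambda>_. 0"]) (simp add: monotone_def)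

setup_lifting type_definition_partition

lift_definition empty_partition :: partition is "\<lambda>_. 0"
  by (simp add: monotone_def)

lift_definition conj_partition :: "partition \<Rightarrow> partition" is "\<lambda>\<mu> j. card {i. j < \<mu> i}"
proof -
  fix \<mu> :: "nat \<Rightarrow> nat"
  assume \<mu>: "antimono \<mu> \<and> finite {i. \<mu> i \<noteq> 0}"
  have fin: "finite {i. j < \<mu> i}" for j
    by (rule finite_subset[of _ "{i. \<mu> i \<noteq> 0}"]) (use \<mu> in auto)
  have "antimono (\<lambda>j. card {i. j < \<mu> i})"
    by (intro antimonoI card_mono fin) auto
  moreover have "{j. card {i. j < \<mu> i} \<noteq> 0} \<subseteq> {..<\<mu> 0}"
  proof
    fix j assume "j \<in> {j. card {i. j < \<mu> i} \<noteq> 0}"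
    then obtain i where "j < \<mu> i" by (metis (mono_tags) card.empty empty_Collect_eq mem_Collect_eq)
    also have "\<mu> i \<le> \<mu> 0" using \<mu> by (auto dest: antimonoD)
    finally show "j \<in> {..<\<mu> 0}" by simp
  qed
  ultimately show "antimono (\<lambda>j. card {i. j < \<mu> i}) \<and> finite {j. card {i. j < \<mu> i} \<noteq> 0}"
    using finite_subset by blast
qed

definition psize :: "partition \<Rightarrow> nat" where
  "psize \<mu> = (\<Sum>i | part \<mu> i \<noteq> 0. part \<mu> i)"

text \<open>\<open>\<mu>\<^sub>i(\<mu>\<^sub>i - 2i + 1)\<close> becomes \<open>\<mu>\<^sub>i(\<mu>\<^sub>i - 2i - 1)\<close> because of the index shift.\<close>

definition kappa :: "partition \<Rightarrow> int" where
  "kappa \<mu> = (\<Sum>i | part \<mu> i \<noteq> 0. int (part \<mu> i) * (int (part \<mu> i) - 2 * int i - 1))"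


section \<open>Formal power series in infinitely many variables\<close>

text \<open>
  Variables are indexed by \<^typ>\<open>nat\<close>; the multiset \<open>M\<close> stands for the monomial which is the product
  of the variables with index in \<open>M\<close> (with multiplicity), and \<open>mps_nth f M\<close> is its coefficient.
\<close>

typedef 'a mps = "UNIV :: (nat multiset \<Rightarrow> 'a) set"
  morphisms mps_nth Abs_mps ..

lemma mps_nth_Abs [simp]: "mps_nth (Abs_mps f) = f"
  by (simp add: Abs_mps_inverse)

lemma mps_eqI: "(\<And>M. mps_nth f M = mps_nth g M) \<Longrightarrow> f = g"
  by (metis ext mps_nth_inject)

definition mset_splits :: "nat multiset \<Rightarrow> (nat multiset \<times> nat multiset) set" where
  "mset_splits M = {(A, B). A + B = M}"

lemma finite_subset_msets: "finite {A. A \<subseteq># (M :: 'b multiset)}"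
proof (induction M)
  case empty
  then show ?case by simp
next
  case (add x M)
  have "{A. A \<subseteq># add_mset x M} \<subseteq> {A. A \<subseteq># M} \<union> add_mset x ` {A. A \<subseteq># M}"
  proof
    fix A assume "A \<in> {A. A \<subseteq># add_mset x M}"
    then have A: "A \<subseteq># add_mset x M" by simp
    show "A \<in> {A. A \<subseteq># M} \<union> add_mset x ` {A. A \<subseteq># M}"
    proof (cases "x \<in># A")
      case True
      then obtain B where "A = add_mset x B" by (metis mset_add)
      with A show ?thesis by auto
    next
      case False
      have "count A y \<le> count M y" for y
        using mset_subset_eq_count[OF A, of y] False
        by (cases "y = x") (auto simp: not_in_iff)
      then show ?thesis by (simp add: subseteq_mset_def)
    qed
  qed
  with add show ?case by (meson finite_Un finite_imageI finite_subset)
qed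

lemma finite_mset_splits [simp]: "finite (mset_splits M)"
proof (rule finite_subset)
  show "mset_splits M \<subseteq> {A. A \<subseteq># M} \<times> {A. A \<subseteq># M}"
    by (auto simp: mset_splits_def)
qed (simp add: finite_subset_msets)

instantiation mps :: (comm_ring_1) comm_ring_1
begin

definition zero_mps_def: "0 = Abs_mps (\<lambda>_. 0)"
definition one_mps_def: "1 = Abs_mps (\<lambda>M. if M = {#} then 1 else 0)"
definition plus_mps_def: "f + g = Abs_mps (\<lambda>M. mps_nth f M + mps_nth g M)"
definition minus_mps_def: "f - g = Abs_mps (\<lambda>M. mps_nth f M - mps_nth g M)"
definition uminus_mps_def: "- f = Abs_mps (\<lambda>M. - mps_nth f M)"
definition times_mps_def:
  "f * g = Abs_mps (\<lambda>M. \<Sum>(A, B) \<in> mset_splits M. mps_nth f A * mps_nth g B)"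

instance
proof
  fix f g h :: "'a mps"
  show "f + g + h = f + (g + h)" by (simp add: plus_mps_def add.assoc)
  show "f + g = g + f" by (simp add: plus_mps_def add.commute)
  show "0 + f = f" by (simp add: plus_mps_def zero_mps_def mps_nth_inverse)
  show "- f + f = 0" by (simp add: plus_mps_def zero_mps_def uminus_mps_def)
  show "f - g = f + - g" by (simp add: plus_mps_def minus_mps_def uminus_mps_def)
  show "(0 :: 'a mps) \<noteq> 1"
  proof
    assume "(0 :: 'a mps) = 1"
    then have "mps_nth (0 :: 'a mps) {#} = mps_nth 1 {#}" by simp
    then show False by (simp add: zero_mps_def one_mps_def)
  qed
  show "(f + g) * h = f * h + g * h"
    by (simp add: plus_mps_def times_mps_def algebra_simps sum.distrib case_prod_unfold)
  show "f * g = g * f"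
  proof (rule mps_eqI)
    fix M
    show "mps_nth (f * g) M = mps_nth (g * f) M" unfolding times_mps_def mps_nth_Abs
      by (rule sum.reindex_bij_witness[of _ prod.swap prod.swap])
         (auto simp: mset_splits_def mult.commute add.commute)
  qed
  show "1 * f = f"
  proof (rule mps_eqI)
    fix M
    have "mps_nth (1 * f) M = (\<Sum>p \<in> mset_splits M. if p = ({#}, M) then mps_nth f M else 0)"
      unfolding times_mps_def one_mps_def mps_nth_Abs
      by (rule sum.cong) (auto simp: mset_splits_def split: if_splits)
    also have "\<dots> = mps_nth f M"
    proof -
      have "({#}, M) \<in> mset_splits M" by (simp add: mset_splits_def)
      then show ?thesis by simp
    qed
    finally show "mps_nth (1 * f) M = mps_nth f M" .
  qed
  show "f * g * h = f * (g * h)"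
  proof (rule mps_eqI)
    fix M
    have "mps_nth (f * g * h) M =
        (\<Sum>(p, q) \<in> Sigma (mset_splits M) (\<lambda>p. mset_splits (fst p)).
          mps_nth f (fst q) * mps_nth g (snd q) * mps_nth h (snd p))"
      by (simp add: times_mps_def case_prod_unfold sum_distrib_right sum.Sigma)
    also have "\<dots> = (\<Sum>(p, q) \<in> Sigma (mset_splits M) (\<lambda>p. mset_splits (snd p)).
          mps_nth f (fst p) * (mps_nth g (fst q) * mps_nth h (snd q)))"
      by (rule sum.reindex_bij_witness[of _
            "\<lambda>(p, q). ((fst p + fst q, snd q), (fst p, fst q))"
            "\<lambda>(p, q). ((fst q, snd q + snd p), (snd q, snd p))"])
         (auto simp: mset_splits_def mult.assoc add.assoc)
    also have "\<dots> = mps_nth (f * (g * h)) M"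
      by (simp add: times_mps_def case_prod_unfold sum_distrib_left sum.Sigma)
    finally show "mps_nth (f * g * h) M = mps_nth (f * (g * h)) M" .
  qed
qed

end

definition mps_const :: "'a::comm_ring_1 \<Rightarrow> 'a mps" where
  "mps_const c = Abs_mps (\<lambda>M. if M = {#} then c else 0)"


section \<open>Symmetric functions\<close>

definition sym_functions :: "'a::comm_ring_1 mps set" where
  "sym_functions = {f.
     (\<forall>\<pi>. bij \<pi> \<longrightarrow> (\<forall>M. mps_nth f (image_mset \<pi> M) = mps_nth f M)) \<and>
     (\<exists>d. \<forall>M. d < size M \<longrightarrow> mps_nth f M = 0)}"

text \<open>The power sum \<open>p\<^sub>n\<close>, used for \<open>n \<ge> 1\<close> only.\<close>

definition power_sum :: "nat \<Rightarrow> 'a::comm_ring_1 mps" where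
  "power_sum n = Abs_mps (\<lambda>M. if \<exists>i. M = replicate_mset n i then 1 else 0)"

definition skew_cells :: "partition \<Rightarrow> partition \<Rightarrow> (nat \<times> nat) set" where
  "skew_cells \<mu> \<eta> = {(i, j). part \<eta> i \<le> j \<and> j < part \<mu> i}"

text \<open>Semistandard tableaux: rows weakly, columns strictly increasing.\<close>

definition ssyt :: "partition \<Rightarrow> partition \<Rightarrow> (nat \<times> nat \<Rightarrow> nat) set" where
  "ssyt \<mu> \<eta> = {T \<in> extensional (skew_cells \<mu> \<eta>).
     (\<forall>i j j'. (i, j) \<in> skew_cells \<mu> \<eta> \<longrightarrow> (i, j') \<in> skew_cells \<mu> \<eta> \<longrightarrow> j \<le> j' \<longrightarrow> T (i, j) \<le> T (i, j')) \<and>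
     (\<forall>i i' j. (i, j) \<in> skew_cells \<mu> \<eta> \<longrightarrow> (i', j) \<in> skew_cells \<mu> \<eta> \<longrightarrow> i < i' \<longrightarrow> T (i, j) < T (i', j))}"

text \<open>
  The skew Schur function as the generating function of semistandard tableaux by content, with the
  usual convention that it vanishes unless \<open>\<eta> \<subseteq> \<mu>\<close>.
\<close>

definition skew_schur :: "partition \<Rightarrow> partition \<Rightarrow> 'a::comm_ring_1 mps" where
  "skew_schur \<mu> \<eta> =
     (if \<forall>i. part \<eta> i \<le> part \<mu> i
      then Abs_mps (\<lambda>M. of_nat (card {T \<in> ssyt \<mu> \<eta>. image_mset T (mset_set (skew_cells \<mu> \<eta>)) = M}))
      else 0)"

definition schur :: "partition \<Rightarrow> 'a::comm_ring_1 mps" where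
  "schur \<mu> = skew_schur \<mu> empty_partition"

text \<open>
  \<open>qrho_specialization u \<phi>\<close>: on the ring of symmetric functions over the coefficient field, \<open>\<phi>\<close> is
  the specialization \<open>f \<mapsto> f(q\<^sup>\<rho>)\<close>, where \<open>u = q\<^sup>1\<^sup>/\<^sup>2\<close>.  The \<open>p\<^sub>n\<close> generate that ring as a polynomial
  ring in characteristic \<open>0\<close>, so \<open>\<phi>\<close> exists and is unique on \<^const>\<open>sym_functions\<close>.
\<close>

definition qrho_specialization :: "'k::field_char_0 \<Rightarrow> ('k mps \<Rightarrow> 'k) \<Rightarrow> bool" where
  "qrho_specialization u \<phi> \<longleftrightarrow>
     (\<forall>c. \<phi> (mps_const c) = c) \<and>
     (\<forall>f \<in> sym_functions. \<forall>g \<in> sym_functions. \<phi> (f + g) = \<phi> f + \<phi> g) \<and>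
     (\<forall>f \<in> sym_functions. \<forall>g \<in> sym_functions. \<phi> (f * g) = \<phi> f * \<phi> g) \<and>
     (\<forall>n \<ge> 1. \<phi> (power_sum n) = 1 / (u ^ n - 1 / u ^ n))"


section \<open>Fermionic Fock space\<close>

text \<open>
  The half-integer \<open>r = m + 1/2\<close> is encoded by the integer \<open>m\<close>; so \<open>r < 0\<close> iff \<open>m < 0\<close>, and
  \<open>- n - 1/2\<close> is encoded by \<open>- n - 1\<close>.  An (infinite) formal linear combination of the basis symbols
  is its coefficient function on admissible sets.
\<close>

definition admissible :: "int set \<Rightarrow> bool" where
  "admissible A \<longleftrightarrow> finite {r \<in> A. r \<ge> 0} \<and> finite {r. r < 0 \<and> r \<notin> A}"

type_synonym 'a fock = "int set \<Rightarrow> 'a"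

definition ket :: "int set \<Rightarrow> 'a::comm_ring_1 fock" where
  "ket A = (\<lambda>B. if B = A then 1 else 0)"

text \<open>
  Action on a basis symbol \<open>a\<^sub>1 \<and> a\<^sub>2 \<and> \<dots>\<close>.  In \<open>psi_basis\<close> the cardinality is the number \<open>k\<close> with
  \<open>a\<^sub>k > r > a\<^sub>k\<^sub>+\<^sub>1\<close>; in \<open>psi_star_basis\<close> it is the \<open>k\<close> with \<open>a\<^sub>k = r\<close>.
\<close>

definition psi_basis :: "int \<Rightarrow> int set \<Rightarrow> 'a::comm_ring_1 fock" where
  "psi_basis r A = (\<lambda>B. if r \<in> A then 0 else (-1) ^ card {s \<in> A. s > r} * ket (insert r A) B)"

definition psi_star_basis :: "int \<Rightarrow> int set \<Rightarrow> 'a::comm_ring_1 fock" where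
  "psi_star_basis r A =
     (\<lambda>B. if r \<in> A then (-1) ^ (card {s \<in> A. s \<ge> r} + 1) * ket (A - {r}) B else 0)"

text \<open>Linear extension to formal combinations: at most one \<open>A\<close> contributes to each \<open>B\<close>.\<close>

definition psi :: "int \<Rightarrow> 'a::comm_ring_1 fock \<Rightarrow> 'a fock" where
  "psi r v = (\<lambda>B. Sum_any (\<lambda>A. if admissible A then v A * psi_basis r A B else 0))"

definition psi_star :: "int \<Rightarrow> 'a::comm_ring_1 fock \<Rightarrow> 'a fock" where
  "psi_star r v = (\<lambda>B. Sum_any (\<lambda>A. if admissible A then v A * psi_star_basis r A B else 0))"

definition maya :: "partition \<Rightarrow> int set" where
  "maya \<mu> = range (\<lambda>i. int (part \<mu> i) - int i - 1)"

definition partition_ket :: "partition \<Rightarrow> 'a::comm_ring_1 fock" where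
  "partition_ket \<mu> = ket (maya \<mu>)"

definition vacuum :: "'a::comm_ring_1 fock" where
  "vacuum = ket {r. r < 0}"

text \<open>
  The operator \<open>\<Sum>\<^sub>m\<^sub>,\<^sub>n R\<^sub>m\<^sub>n \<psi>\<^sub>m\<^sub>+\<^sub>1\<^sub>/\<^sub>2 \<psi>\<^sup>*\<^sub>-\<^sub>n\<^sub>-\<^sub>1\<^sub>/\<^sub>2\<close>: at \<open>B\<close> only pairs with \<open>m + 1/2 \<in> B\<close> and
  \<open>- n - 1/2 \<notin> B\<close> contribute, which are finitely many.
\<close>

definition pair_operator ::
    "(nat \<Rightarrow> nat \<Rightarrow> 'a::comm_ring_1) \<Rightarrow> 'a fock \<Rightarrow> 'a fock" where
  "pair_operator R v =
     (\<lambda>B. Sum_any (\<lambda>(m, n). R m n * psi (int m) (psi_star (- int n - 1) v) B))"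

text \<open>
  The exponential of \<^const>\<open>pair_operator\<close> applied to the vacuum: the \<open>k\<close>-th term lives on the sets
  with exactly \<open>k\<close> nonnegative elements, so at most one \<open>k\<close> contributes at each \<open>B\<close>.
\<close>

definition bogoliubov_vacuum :: "(nat \<Rightarrow> nat \<Rightarrow> 'k::field_char_0 fps) \<Rightarrow> 'k fps fock" where
  "bogoliubov_vacuum R =
     (\<lambda>B. Sum_any (\<lambda>k. fps_const (1 / fact k) * (pair_operator R ^^ k) vacuum B))"


section \<open>The KP hierarchy\<close>

text \<open>
  A series \<open>\<tau>(t\<^sub>1, t\<^sub>2, \<dots>)\<close> over \<open>K[[Q]]\<close> is an \<^typ>\<open>'k fps mps\<close> whose variable with index \<open>n \<ge> 1\<close> is
  \<open>t\<^sub>n\<close>.  The index \<open>0\<close> is not used: monomials containing it are ignored everywhere.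

  \<open>tau_shift c \<tau> k\<close> is the coefficient of \<open>z\<^sup>-\<^sup>k\<close> in \<open>\<tau>(t + c [z\<^sup>-\<^sup>1])\<close>, where
  \<open>[z\<^sup>-\<^sup>1] = (z\<^sup>-\<^sup>1, z\<^sup>-\<^sup>2/2, \<dots>)\<close>, given by its coefficients at the monomials \<open>M\<close>.  It collects the terms
  of the binomial expansion of the monomials \<open>M + G\<close> of \<open>\<tau>\<close> in which the factor \<open>t\<^sup>G\<close> has been
  replaced by \<open>c\<^sup>|\<^sup>G\<^sup>| (\<Prod>n\<in>G. z\<^sup>-\<^sup>n/n)\<close>.
\<close>

definition tau_shift ::
    "'k::field_char_0 \<Rightarrow> 'k fps mps \<Rightarrow> nat \<Rightarrow> nat multiset \<Rightarrow> 'k fps" where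
  "tau_shift c \<tau> k M =
     (\<Sum>G | 0 \<notin># G \<and> sum_mset G = k.
        fps_const (\<Prod>n \<in> set_mset G.
          of_nat (count (M + G) n choose count G n) * (c / of_nat n) ^ count G n)
        * mps_nth \<tau> (M + G))"

text \<open>
  Coefficient of the monomial \<open>t\<^sup>A t'\<^sup>B\<close> in \<open>exp (\<Sum>\<^sub>n (t\<^sub>n - t'\<^sub>n) z\<^sup>n) = \<Prod>\<^sub>n exp (t\<^sub>n z\<^sup>n) exp (- t'\<^sub>n z\<^sup>n)\<close>;
  it comes with the power \<open>z\<^sup>w\<close>, \<open>w = sum_mset A + sum_mset B\<close>.
\<close>

definition hirota_exp_coeff :: "nat multiset \<Rightarrow> nat multiset \<Rightarrow> 'k::field_char_0" where
  "hirota_exp_coeff A B =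
     (\<Prod>n \<in> set_mset A. 1 / fact (count A n)) *
     (\<Prod>n \<in> set_mset B. (-1) ^ count B n / fact (count B n))"

text \<open>
  The Hirota bilinear identity: for all monomials \<open>t\<^sup>M t'\<^sup>N\<close>, the coefficient of \<open>t\<^sup>M t'\<^sup>N z\<^sup>-\<^sup>1\<close> in
  \<open>exp (\<Sum>\<^sub>n (t\<^sub>n - t'\<^sub>n) z\<^sup>n) \<tau>(t - [z\<^sup>-\<^sup>1]) \<tau>(t' + [z\<^sup>-\<^sup>1])\<close> vanishes; the exponents of \<open>z\<close> coming from
  the three factors add up to \<open>w - j - k = -1\<close>.
\<close>

definition kp_tau_function :: "'k::field_char_0 fps mps \<Rightarrow> bool" where
  "kp_tau_function \<tau> \<longleftrightarrow>
     (\<forall>M N. 0 \<notin># M \<longrightarrow> 0 \<notin># N \<longrightarrow>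
       (\<Sum>(A, A') \<in> mset_splits M. \<Sum>(B, B') \<in> mset_splits N.
        \<Sum>(j, k) | j + k = sum_mset A + sum_mset B + 1.
          fps_const (hirota_exp_coeff A B) * tau_shift (-1) \<tau> j A' * tau_shift 1 \<tau> k B') = 0)"

text \<open>
  Substitution of the Miwa variables \<open>t\<^sub>n = p\<^sub>n(x)/n\<close> into \<open>\<tau>\<close>.  The image of the monomial \<open>t\<^sup>M\<close> is
  homogeneous of degree \<^term>\<open>sum_mset M\<close> in \<open>x\<close>, hence the restriction of the sum.
\<close>

definition miwa_substitution :: "'k::field_char_0 fps mps \<Rightarrow> 'k fps mps" where
  "miwa_substitution \<tau> = Abs_mps (\<lambda>N.
     \<Sum>M | 0 \<notin># M \<and> sum_mset M = size N.
       mps_nth \<tau> M *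
       mps_nth (\<Prod>n \<in># M. mps_const (fps_const (1 / of_nat n)) * power_sum n) N)"


section \<open>Open Gromov-Witten invariants of the resolved conifold\<close>

text \<open>
  Throughout, \<open>u = q\<^sup>1\<^sup>/\<^sup>2\<close>, \<open>\<phi>\<close> is the specialization \<open>f \<mapsto> f(q\<^sup>\<rho>)\<close>, and the variable of the \<open>fps\<close>
  is \<open>Q\<close>.  So \<open>q\<^bsup>(a+1)\<kappa>/2\<^esup>\<close> is \<open>u\<^bsup>(a+1)\<kappa>\<^esup>\<close>; the terms of the sum over \<open>\<eta>\<close> vanish unless \<open>\<eta> \<subseteq> \<nu>\<close>.
\<close>

definition vertex_C2 ::
    "'k::field_char_0 \<Rightarrow> ('k mps \<Rightarrow> 'k) \<Rightarrow> int \<Rightarrow> partition \<Rightarrow> partition \<Rightarrow> 'k" where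
  "vertex_C2 u \<phi> a \<mu> \<nu> = u powi ((a + 1) * kappa \<mu>) *
     Sum_any (\<lambda>\<eta>. \<phi> (skew_schur (conj_partition \<mu>) \<eta>) * \<phi> (skew_schur \<nu> \<eta>))"

definition vertex_C1 :: "('k::field_char_0 mps \<Rightarrow> 'k) \<Rightarrow> partition \<Rightarrow> 'k" where
  "vertex_C1 \<phi> \<mu> = \<phi> (schur \<mu>)"

definition closed_Z0 :: "('k::field_char_0 mps \<Rightarrow> 'k) \<Rightarrow> 'k fps" where
  "closed_Z0 \<phi> =
     Abs_fps (\<lambda>d. \<Sum>\<mu> | psize \<mu> = d. \<phi> (schur \<mu>) * \<phi> (schur (conj_partition \<mu>)))"

definition open_coeff ::
    "'k::field_char_0 \<Rightarrow> ('k mps \<Rightarrow> 'k) \<Rightarrow> int \<Rightarrow> partition \<Rightarrow> 'k fps" where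
  "open_coeff u \<phi> a \<mu> =
     Abs_fps (\<lambda>d. \<Sum>\<nu> | psize \<nu> = d. vertex_C2 u \<phi> a \<mu> \<nu> * vertex_C1 \<phi> (conj_partition \<nu>))
     / closed_Z0 \<phi>"

text \<open>\<open>s\<^sub>\<mu>(x)\<close> is homogeneous of degree \<open>|\<mu>|\<close>, so at each monomial finitely many \<open>\<mu>\<close> contribute.\<close>

definition open_Z ::
    "'k::field_char_0 \<Rightarrow> ('k mps \<Rightarrow> 'k) \<Rightarrow> int \<Rightarrow> 'k fps mps" where
  "open_Z u \<phi> a = Abs_mps (\<lambda>M. Sum_any (\<lambda>\<mu>. open_coeff u \<phi> a \<mu> * mps_nth (schur \<mu>) M))"

text \<open>Distinct partitions have distinct \<^const>\<open>maya\<close> sets, so at most one \<open>\<mu>\<close> contributes.\<close>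

definition open_V ::
    "'k::field_char_0 \<Rightarrow> ('k mps \<Rightarrow> 'k) \<Rightarrow> int \<Rightarrow> 'k fps fock" where
  "open_V u \<phi> a = (\<lambda>B. Sum_any (\<lambda>\<mu>. open_coeff u \<phi> a \<mu> * partition_ket \<mu> B))"

end

theory Submission
  imports Defs
begin

unbundle fps_syntax

text \<open>
  Partitions with at most \<open>N\<close> parts are encoded by the sets \<open>{\<mu>\<^sub>i + N - i}\<close>, that is, by Maya
  diagrams cut off at depth \<open>N\<close>. By the Jacobi--Trudi formula the skew Schur functions are then minors
  of the Toeplitz matrix \<open>h\<^bsub>r-s\<^esub>\<close>. The bilinear relation \<open>\<Sum>\<^sub>r \<psi>\<^sub>r v \<otimes> \<psi>\<^sub>r\<^sup>* v = 0\<close> consists of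
  Pluecker relations between the coefficients of \<open>v\<close>. They hold for the vacuum and are
  preserved by the action of any matrix on exterior powers, by its adjoint, by conjugation of partitions
  and by multiplication with \<open>Q^|\<mu>|\<close> or \<open>q^(b \<kappa>\<^sub>\<mu>)\<close>. The open invariants are obtained from the vacuum
  by a sequence of such operations, so they satisfy these relations; dividing by \<open>Z\<^sub>0\<close> makes the
  vacuum coefficient \<open>1\<close>.

  A Pluecker relation expresses the coefficient of \<open>V\<close> at a state by removing a fixed particle and
  filling each of the holes; summing over the particles, the part of \<open>V\<close> with \<open>k\<close> particles is
  \<open>1/k\<close> times the pair operator applied to the part with \<open>k - 1\<close> particles, where \<open>R\<^sub>m\<^sub>n\<close> is up to sign
  the coefficient of the hook \<open>(m|n)\<close>. This is the exponential formula. For the KP hierarchy, the Schur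
  functions of the times are minors as well, and Laplace expansion shows that the two vertex operators
  in the Hirota identity add and remove a particle, which turns it into the Pluecker relations.
\<close>

section \<open>Minors indexed by finite sets\<close>

text \<open>Write \<Gamma> for the matrix of skew Schur values s_{\<mu>/\<eta>}(q^\<rho>) and
  \<omega> for conjugation. Up to the factor 1/Z_0, V is q^((a+1)\<kappa>/2) \<omega> \<Gamma>
  \<Gamma>^T Q^|.| \<omega> \<Gamma> applied to the vacuum. Each factor preserves the relations for
  its own reason: \<Gamma> and \<Gamma>^T act by minors on exterior powers, \<omega> exchanges
  particles and holes, and |\<mu>| and \<kappa>_\<mu> are, up to constants, sums over the occupied
  positions. At the empty partition the product gives Z_0. The obstacle is that the Fock space is
  infinite while minors are finite. A state is therefore read in a window of L positions holding N
  particles, and a partition may be re-encoded with more particles by filling positions from below.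
  \<Gamma> is triangular for containment, so one window suffices; \<Gamma>^T involves infinitely
  many partitions, and there the powers of Q cut the sum off. The same windows make the KP identity
  finite, since each of its coefficients sees only bounded weights.\<close>

definition sg :: "nat set \<Rightarrow> nat \<Rightarrow> 'a::comm_ring_1" where
  "sg A r = (-1) ^ card {a \<in> A. r < a}"

lemma sg_empty [simp]: "sg {} r = 1"
  by (simp add: sg_def)

lemma sg_insert:
  assumes "finite A" "x \<notin> A"
  shows "sg (insert x A) r = (if r < x then - sg A r else sg A r)"
proof -
  have "{a \<in> insert x A. r < a} = (if r < x then insert x {a \<in> A. r < a} else {a \<in> A. r < a})"
    by auto
  then show ?thesis using assms by (simp add: sg_def)
qed

lemma sg_remove:
  assumes "finite A" "x \<in> A"
  shows "sg (A - {x}) r = (if r < x then - sg A r else sg A r :: 'a::comm_ring_1)"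
proof -
  have "insert x (A - {x}) = A" using assms by auto
  then show ?thesis using sg_insert[of "A - {x}" x r, where ?'a = 'a] assms by simp
qed

lemma sg_insert_self [simp]: "sg (insert x A) x = sg A x"
proof -
  have "{a \<in> insert x A. x < a} = {a \<in> A. x < a}" by auto
  then show ?thesis by (simp add: sg_def)
qed

lemma sg_remove_self [simp]: "sg (A - {x}) x = sg A x"
proof -
  have "{a \<in> A - {x}. x < a} = {a \<in> A. x < a}" by auto
  then show ?thesis by (simp add: sg_def)
qed

lemma sg_square [simp]: "sg A r * sg A r = (1 :: 'a::comm_ring_1)"
  by (simp add: sg_def flip: power_mult_distrib)

lemma sg_square_left [simp]: "sg A r * (sg A r * x) = (x :: 'a::comm_ring_1)"
  by (simp flip: mult.assoc)

lemma sg_top: "(\<And>x. x \<in> A \<Longrightarrow> x \<le> m) \<Longrightarrow> sg A m = 1"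
proof -
  assume "\<And>x. x \<in> A \<Longrightarrow> x \<le> m"
  then have "{a \<in> A. m < a} = {}" by force
  then show ?thesis by (simp only: sg_def card.empty power_0)
qed

text \<open>Exactly one of the two removals, that of the larger element, is seen by the sign of the
  other. This single change of sign is the anticommutation of fermions.\<close>

lemma sg_swap:
  assumes "finite A" "a \<in> A" "b \<in> A" "a \<noteq> b"
  shows "sg A a * sg (A - {a}) b = - (sg A b * sg (A - {b}) a)"
  using assms by (auto simp: sg_remove mult.commute)

lemma sum_offdiag_swap:
  "finite A \<Longrightarrow> (\<Sum>s\<in>A. \<Sum>t\<in>A - {s}. f s t) = (\<Sum>t\<in>A. \<Sum>s\<in>A - {t}. f s t)"
  by (simp add: sum.Sigma)
     (rule sum.reindex_bij_witness[of _ "\<lambda>(a, b). (b, a)" "\<lambda>(a, b). (b, a)"], auto)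

text \<open>The terms with t < s are paired with those with s < t. Deriving x = - x instead would
  not suffice in a ring where 2 is a zero divisor.\<close>

lemma sum_antisym_zero:
  fixes f :: "nat \<Rightarrow> nat \<Rightarrow> 'a::comm_ring_1"
  assumes "finite A" and anti: "\<And>s t. s \<in> A \<Longrightarrow> t \<in> A \<Longrightarrow> s \<noteq> t \<Longrightarrow> f s t = - f t s"
  shows "(\<Sum>s\<in>A. \<Sum>t\<in>A - {s}. f s t) = 0"
proof -
  have "(\<Sum>t\<in>A - {s}. f s t) = (\<Sum>t\<in>{t\<in>A. t < s}. f s t) + (\<Sum>t\<in>{t\<in>A. s < t}. f s t)" for s
    by (subst sum.union_disjoint[symmetric]) (use assms in \<open>auto intro!: sum.cong\<close>)
  moreover have "(\<Sum>s\<in>A. \<Sum>t\<in>{t\<in>A. t < s}. f s t) = (\<Sum>s\<in>A. \<Sum>t\<in>{t\<in>A. s < t}. f t s)"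
    using assms(1) by (simp add: sum.Sigma)
     (rule sum.reindex_bij_witness[of _ "\<lambda>(a, b). (b, a)" "\<lambda>(a, b). (b, a)"], auto)
  moreover have "(\<Sum>s\<in>A. \<Sum>t\<in>{t\<in>A. s < t}. f t s) = - (\<Sum>s\<in>A. \<Sum>t\<in>{t\<in>A. s < t}. f s t)"
    by (simp flip: sum_negf) (intro sum.cong, auto intro: anti)
  ultimately show ?thesis by (simp add: sum.distrib)
qed

text \<open>The determinant with rows A and columns B in increasing order, expanded along the last
  row; there the usual sign counts the columns to the right, which is \<open>sg\<close>. No
  permutations and no enumeration of the index sets are needed.\<close>

primrec minor_rec :: "nat \<Rightarrow> (nat \<Rightarrow> nat \<Rightarrow> 'a) \<Rightarrow> nat set \<Rightarrow> nat set \<Rightarrow> 'a::comm_ring_1" where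
  "minor_rec 0 H A B = (if B = {} then 1 else 0)"
| "minor_rec (Suc n) H A B =
     (\<Sum>s\<in>B. sg B s * H (Max A) s * minor_rec n H (A - {Max A}) (B - {s}))"

definition minor :: "(nat \<Rightarrow> nat \<Rightarrow> 'a) \<Rightarrow> nat set \<Rightarrow> nat set \<Rightarrow> 'a::comm_ring_1" where
  "minor H A B = minor_rec (card A) H A B"

lemma minor_empty [simp]: "minor H {} B = (if B = {} then 1 else 0)"
  by (simp add: minor_def)

lemma minor_insert_top:
  assumes "finite S" "\<forall>x\<in>S. x < m"
  shows "minor H (insert m S) B = (\<Sum>s\<in>B. sg B s * H m s * minor H S (B - {s}))"
proof -
  have m: "m \<notin> S" using assms(2) by blast
  have "Max (insert m S) = m" using assms by (intro Max_eqI) auto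
  then show ?thesis using assms(1) m by (simp add: minor_def)
qed

lemma minor_cong:
  assumes "finite A" "finite B" "\<And>r s. r \<in> A \<Longrightarrow> s \<in> B \<Longrightarrow> H r s = H' r s"
  shows "minor H A B = minor H' A B"
  using assms
proof (induction A arbitrary: B rule: finite_linorder_max_induct)
  case (insert m S)
  then have "minor H S (B - {s}) = minor H' S (B - {s})" for s
    by (intro insert.IH) auto
  with insert show ?case by (simp add: minor_insert_top cong: sum.cong)
qed simp

text \<open>The induction compares r with the top row m: above m it is the recursion itself, at m
  two equal rows make the double sum antisymmetric, and below m the expansions along r and m are
  interchanged.\<close>

lemma minor_row:
  fixes H :: "nat \<Rightarrow> nat \<Rightarrow> 'a::comm_ring_1"
  assumes "finite S" "finite A"
  shows "(\<Sum>s\<in>A. sg A s * H r s * minor H S (A - {s})) =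
         (if r \<in> S then 0 else sg S r * minor H (insert r S) A)"
  using assms
proof (induction S arbitrary: A r rule: finite_linorder_max_induct)
  case empty
  then show ?case using minor_insert_top[of "{}" r H A] by simp
next
  case (insert m S)
  define f where "f = (\<lambda>s t. sg A s * sg (A - {s}) t * minor H S (A - {s} - {t}))"
  have f: "f s t = - f t s" if "s \<in> A" "t \<in> A" "s \<noteq> t" for s t
  proof -
    have "A - {s} - {t} = A - {t} - {s}" by auto
    then show ?thesis using sg_swap[of A s t, where ?'a = 'a] that insert.prems by (simp add: f_def)
  qed
  have exp: "(\<Sum>s\<in>A. sg A s * H r s * minor H (insert m S) (A - {s})) =
     (\<Sum>s\<in>A. \<Sum>t\<in>A - {s}. H r s * H m t * f s t)"
    using insert.hyps by (simp add: minor_insert_top f_def sum_distrib_left mult_ac)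
  have mS: "m \<notin> S" using insert by auto
  consider "r > m" | "r = m" | "r < m" by linarith
  then show ?case
  proof cases
    case 1
    then have "sg (insert m S) r = (1 :: 'a)" using insert by (intro sg_top) force
    moreover have "r \<notin> insert m S" using 1 insert by force
    moreover have "\<forall>x\<in>insert m S. x < r" using 1 insert by force
    ultimately show ?thesis using insert by (simp add: minor_insert_top)
  next
    case 2
    have "(\<Sum>s\<in>A. \<Sum>t\<in>A - {s}. H m s * H m t * f s t) = 0"
    proof (rule sum_antisym_zero[OF insert.prems])
      fix s t assume "s \<in> A" "t \<in> A" "s \<noteq> t"
      then show "H m s * H m t * f s t = - (H m t * H m s * f t s)" by (simp add: f[of s t])
    qed
    then show ?thesis using 2 exp by simp
  next
    case 3
    have "(\<Sum>s\<in>A. \<Sum>t\<in>A - {s}. H r s * H m t * f s t)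
        = (\<Sum>t\<in>A. \<Sum>s\<in>A - {t}. H r s * H m t * f s t)"
      by (rule sum_offdiag_swap[OF insert.prems])
    also have "\<dots> = (\<Sum>t\<in>A. \<Sum>s\<in>A - {t}. - (H r s * H m t * f t s))"
      by (intro sum.cong refl) (subst f, auto)
    also have "\<dots> = - (\<Sum>t\<in>A. sg A t * H m t *
        (\<Sum>s\<in>A - {t}. sg (A - {t}) s * H r s * minor H S (A - {t} - {s})))"
      by (simp add: f_def sum_negf sum_distrib_left mult_ac)
    also have "\<dots> = - (\<Sum>t\<in>A. sg A t * H m t *
        (if r \<in> S then 0 else sg S r * minor H (insert r S) (A - {t})))"
      using insert.prems by (simp add: insert.IH)
    also have "\<dots> = (if r \<in> S then 0 else - sg S r * minor H (insert m (insert r S)) A)"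
    proof -
      have "\<forall>x\<in>insert r S. x < m" using 3 insert by auto
      then show ?thesis using insert.hyps by (simp add: minor_insert_top sum_distrib_left sum_negf mult_ac)
    qed
    also have "\<dots> = (if r \<in> insert m S then 0 else sg (insert m S) r * minor H (insert r (insert m S)) A)"
      using 3 mS insert.hyps by (auto simp: sg_insert insert_commute)
    finally show ?thesis unfolding exp .
  qed
qed

text \<open>The top row m is expanded first, and the induction hypothesis is applied to the column
  expansions inside. The symmetry of rows and columns is not yet available at this point:
  \<open>minor_transpose\<close> is derived from this lemma.\<close>

lemma minor_col:
  fixes H :: "nat \<Rightarrow> nat \<Rightarrow> 'a::comm_ring_1"
  assumes "finite A" "finite B"
  shows "(\<Sum>r\<in>A. sg A r * H r s * minor H (A - {r}) B) =
         (if s \<in> B then 0 else sg B s * minor H A (insert s B))"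
  using assms
proof (induction A arbitrary: B s rule: finite_linorder_max_induct)
  case empty
  then show ?case by simp
next
  case (insert m S)
  have mS: "m \<notin> S" using insert by auto
  have "(\<Sum>r\<in>insert m S. sg (insert m S) r * H r s * minor H (insert m S - {r}) B)
     = H m s * minor H S B + (\<Sum>r\<in>S. sg (insert m S) r * H r s * minor H (insert m (S - {r})) B)"
  proof -
    have "sg S m = (1 :: 'a)" using insert.hyps by (intro sg_top) auto
    moreover have "insert m S - {r} = insert m (S - {r})" if "r \<in> S" for r using that mS by auto
    ultimately show ?thesis using insert.hyps mS by (simp add: sum.insert)
  qed
  also have "(\<Sum>r\<in>S. sg (insert m S) r * H r s * minor H (insert m (S - {r})) B)
     = (\<Sum>r\<in>S. - sg S r * H r s * (\<Sum>b\<in>B. sg B b * H m b * minor H (S - {r}) (B - {b})))"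
    using insert.hyps mS by (intro sum.cong refl) (auto simp: sg_insert minor_insert_top)
  also have "\<dots> = - (\<Sum>b\<in>B. sg B b * H m b * (\<Sum>r\<in>S. sg S r * H r s * minor H (S - {r}) (B - {b})))"
    unfolding sum_distrib_left by (subst sum.swap) (simp add: sum_negf mult_ac)
  also have "\<dots> = - (\<Sum>b\<in>B. sg B b * H m b *
      (if s \<in> B - {b} then 0 else sg (B - {b}) s * minor H S (insert s (B - {b}))))"
    using insert.prems by (simp only: insert.IH finite_Diff)
  finally have eq: "(\<Sum>r\<in>insert m S. sg (insert m S) r * H r s * minor H (insert m S - {r}) B)
     = H m s * minor H S B - (\<Sum>b\<in>B. sg B b * H m b *
      (if s \<in> B - {b} then 0 else sg (B - {b}) s * minor H S (insert s (B - {b}))))" by simp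
  show ?case
  proof (cases "s \<in> B")
    case True
    have "(\<Sum>b\<in>B. sg B b * H m b *
      (if s \<in> B - {b} then 0 else sg (B - {b}) s * minor H S (insert s (B - {b}))))
      = (\<Sum>b\<in>B. if b = s then H m s * minor H S B else 0)"
      using True by (intro sum.cong refl) (auto simp: insert_absorb mult_ac)
    then show ?thesis using eq True insert.prems by simp
  next
    case False
    have "sg B s * minor H (insert m S) (insert s B)
      = sg B s * (\<Sum>b\<in>insert s B. sg (insert s B) b * H m b * minor H S (insert s B - {b}))"
      using insert.hyps by (simp add: minor_insert_top)
    also have "\<dots> = H m s * minor H S B + (\<Sum>b\<in>B. sg B s * sg (insert s B) b * H m b * minor H S (insert s B - {b}))"
      using False insert.prems by (simp add: algebra_simps sum_distrib_left)
    also have "(\<Sum>b\<in>B. sg B s * sg (insert s B) b * H m b * minor H S (insert s B - {b}))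
      = - (\<Sum>b\<in>B. sg B b * H m b *
      (if s \<in> B - {b} then 0 else sg (B - {b}) s * minor H S (insert s (B - {b}))))"
      unfolding sum_negf[symmetric]
    proof (intro sum.cong refl)
      fix b assume b: "b \<in> B"
      then have ne: "s \<noteq> b" using False by auto
      have "insert s B - {b} = insert s (B - {b})" using ne by auto
      moreover have "sg B s * sg (insert s B) b = - (sg B b * sg (B - {b}) s :: 'a)"
        using False b ne insert.prems by (auto simp: sg_insert sg_remove mult.commute)
      ultimately show "sg B s * sg (insert s B) b * H m b * minor H S (insert s B - {b}) =
         - (sg B b * H m b * (if s \<in> B - {b} then 0 else sg (B - {b}) s * minor H S (insert s (B - {b}))))"
        using False by (simp add: mult_ac)
    qed
    finally show ?thesis using eq False by simp
  qed
qed

lemma minor_remove_row: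
  assumes "finite A" "finite B" "r \<in> A"
  shows "minor H A B = sg A r * (\<Sum>s\<in>B. sg B s * H r s * minor H (A - {r}) (B - {s}))"
  using minor_row[of "A - {r}" B H r] assms by (simp add: insert_absorb)

lemma minor_card:
  assumes "finite A" "finite B" "card A \<noteq> card B"
  shows "minor H A B = 0"
  using assms
proof (induction A arbitrary: B rule: finite_linorder_max_induct)
  case empty
  then show ?case by auto
next
  case (insert m S)
  have "m \<notin> S" using insert by auto
  then have "card S \<noteq> card (B - {s})" if "s \<in> B" for s
    using card.remove[OF insert.prems(1) that] insert.prems(2) insert.hyps(1) by simp
  then have "minor H S (B - {s}) = 0" if "s \<in> B" for s
    using that insert.prems(1) by (intro insert.IH) auto
  then show ?case using insert.hyps by (simp add: minor_insert_top)
qed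

text \<open>By linearity in row i + 1, the extra term has row i in its place. It vanishes if row i
  is present already; otherwise it carries no sign, because no element lies between i and i +
  1.\<close>

lemma minor_row_operation:
  fixes H :: "nat \<Rightarrow> nat \<Rightarrow> 'a::comm_ring_1"
  assumes "finite A" "finite B"
  shows "minor (\<lambda>r s. if r = Suc i then H (Suc i) s + x * H i s else H r s) A B =
     minor H A B + (if Suc i \<in> A \<and> i \<notin> A then x * minor H (insert i (A - {Suc i})) B else 0)"
    (is "minor ?H A B = _")
proof (cases "Suc i \<in> A")
  case False
  then have "minor ?H A B = minor H A B" using assms by (intro minor_cong) auto
  then show ?thesis using False by simp
next
  case True
  let ?S = "A - {Suc i}"
  have eq: "minor ?H ?S (B - {s}) = minor H ?S (B - {s})" for s
    using assms by (intro minor_cong) auto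
  have "minor ?H A B = sg A (Suc i) * (\<Sum>s\<in>B. sg B s * H (Suc i) s * minor H ?S (B - {s}))
    + sg A (Suc i) * x * (\<Sum>s\<in>B. sg B s * H i s * minor H ?S (B - {s}))"
    using assms True by (simp add: minor_remove_row[of A B "Suc i"] eq algebra_simps sum.distrib sum_distrib_left)
  also have "sg A (Suc i) * (\<Sum>s\<in>B. sg B s * H (Suc i) s * minor H ?S (B - {s})) = minor H A B"
    using assms True by (simp add: minor_remove_row[of A B "Suc i"])
  also have "(\<Sum>s\<in>B. sg B s * H i s * minor H ?S (B - {s})) =
     (if i \<in> ?S then 0 else sg ?S i * minor H (insert i ?S) B)"
    using assms by (intro minor_row) auto
  also have "sg ?S i = (sg A (Suc i) :: 'a)"
  proof -
    have "{a \<in> ?S. i < a} = {a \<in> A. Suc i < a}" by force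
    then show ?thesis by (simp add: sg_def)
  qed
  finally show ?thesis using True by (simp add: mult_ac)
qed

lemma minor_identity:
  assumes "finite A" "finite B"
  shows "minor (\<lambda>r s. if r = s then 1 else 0 :: 'a::comm_ring_1) A B = (if A = B then 1 else 0)"
  using assms
proof (induction A arbitrary: B rule: finite_linorder_max_induct)
  case (insert m S)
  have mS: "m \<notin> S" using insert by auto
  have "minor (\<lambda>r s. if r = s then 1 else 0 :: 'a) (insert m S) B =
    (\<Sum>s\<in>B. if s = m then sg B m * (if S = B - {m} then 1 else 0) else 0)"
  proof -
    have "minor (\<lambda>r s. if r = s then 1 else 0 :: 'a) S (B - {s}) = (if S = B - {s} then 1 else 0 :: 'a)" for s
      using insert.prems by (intro insert.IH) auto
    then show ?thesis using insert.hyps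
      unfolding minor_insert_top[OF insert.hyps] by (intro sum.cong) auto
  qed
  also have "\<dots> = (if insert m S = B then 1 else 0)"
  proof (cases "insert m S = B")
    case True
    then have "sg B m = (1 :: 'a)" using insert by (intro sg_top) force
    then show ?thesis using True insert.prems mS by auto
  next
    case False
    have "sg B m * (if S = B - {m} then 1 else 0 :: 'a) = 0" if "m \<in> B"
    proof -
      have "S \<noteq> B - {m}" using False that by blast
      then show ?thesis by simp
    qed
    then show ?thesis using False insert.prems by (simp add: sum.delta)
  qed
  finally show ?case .
qed auto

lemma minor_transpose:
  assumes "finite A" "finite B"
  shows "minor (\<lambda>r s. H s r) A B = minor H B A"
  using assms
proof (induction A arbitrary: B rule: finite_linorder_max_induct)
  case empty
  then show ?case using minor_card[of B "{}" H] by (cases "B = {}") auto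
next
  case (insert m S)
  have mS: "m \<notin> S" using insert by auto
  have "sg S m = (1 :: 'a)" using insert.hyps by (intro sg_top) auto
  then show ?case using insert mS minor_col[of B S H m] by (simp add: minor_insert_top)
qed

section \<open>The Cauchy-Binet formula\<close>

lemma sum_Pow_remove:
  fixes f :: "nat \<Rightarrow> nat set \<Rightarrow> 'a::comm_monoid_add"
  assumes "finite U"
  shows "(\<Sum>C\<in>Pow U. \<Sum>t\<in>C. f t (C - {t})) = (\<Sum>C\<in>Pow U. \<Sum>t\<in>U - C. f t C)"
proof -
  have "finite C" if "C \<in> Pow U" for C using that assms finite_subset by auto
  then show ?thesis using assms
    by (simp add: sum.Sigma)
       (rule sum.reindex_bij_witness[of _ "\<lambda>(C, t). (insert t C, t)" "\<lambda>(C, t). (C - {t}, t)"], auto)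
qed

text \<open>Induction on the top row, which contributes a sum over t. The remaining sum over s is by
  \<open>minor_row\<close> the minor of V with row t added to C, or 0 if t is in C; collecting the
  terms by the enlarged set gives back the recursion for H.\<close>

lemma cauchy_binet:
  fixes H V :: "nat \<Rightarrow> nat \<Rightarrow> 'a::comm_ring_1"
  assumes "finite U" "finite A" "finite B"
  shows "minor (\<lambda>r s. \<Sum>t\<in>U. H r t * V t s) A B = (\<Sum>C\<in>Pow U. minor H A C * minor V C B)"
  using assms(2,3)
proof (induction A arbitrary: B rule: finite_linorder_max_induct)
  case empty
  have "(\<Sum>C\<in>Pow U. minor H {} C * minor V C B) = (\<Sum>C\<in>Pow U. if C = {} then minor V C B else 0)"
    by (intro sum.cong) auto
  then show ?case using assms(1) by simp
next
  case (insert m S)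
  have fin: "finite C" if "C \<subseteq> U" for C using that assms(1) finite_subset by auto
  have "minor (\<lambda>r s. \<Sum>t\<in>U. H r t * V t s) (insert m S) B
     = (\<Sum>s\<in>B. sg B s * (\<Sum>t\<in>U. H m t * V t s) * (\<Sum>C\<in>Pow U. minor H S C * minor V C (B - {s})))"
    using insert by (simp add: minor_insert_top)
  also have "\<dots> = (\<Sum>s\<in>B. \<Sum>C\<in>Pow U. \<Sum>t\<in>U. H m t * minor H S C * (sg B s * V t s * minor V C (B - {s})))"
    by (simp add: sum_distrib_left sum_distrib_right mult_ac)
  also have "\<dots> = (\<Sum>C\<in>Pow U. \<Sum>t\<in>U. H m t * minor H S C * (\<Sum>s\<in>B. sg B s * V t s * minor V C (B - {s})))"
    by (subst sum.swap, subst sum.swap[of _ U]) (simp add: sum_distrib_left mult_ac)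
  also have "\<dots> = (\<Sum>C\<in>Pow U. \<Sum>t\<in>U. if t \<in> C then 0 else H m t * minor H S C * (sg C t * minor V (insert t C) B))"
    using insert.prems fin by (intro sum.cong refl) (simp add: minor_row)
  also have "\<dots> = (\<Sum>C\<in>Pow U. \<Sum>t\<in>U - C. H m t * minor H S C * (sg C t * minor V (insert t C) B))"
    using assms(1) by (intro sum.cong refl sum.mono_neutral_cong_right) auto
  also have "\<dots> = (\<Sum>C\<in>Pow U. \<Sum>t\<in>C. H m t * minor H S (C - {t}) * (sg (C - {t}) t * minor V (insert t (C - {t})) B))"
    by (rule sum_Pow_remove[OF assms(1), symmetric])
  also have "\<dots> = (\<Sum>C\<in>Pow U. minor H (insert m S) C * minor V C B)"
    using insert.hyps by (intro sum.cong refl)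
      (auto simp: minor_insert_top sum_distrib_right sum_distrib_left insert_absorb mult_ac intro!: sum.cong)
  finally show ?case .
qed

text \<open>The ring operations are confined to a set R because the specialization is a homomorphism
  only on \<open>sym_functions\<close>.\<close>

lemma hom_minor:
  fixes f :: "'a::comm_ring_1 \<Rightarrow> 'b::comm_ring_1"
  assumes zero: "0 \<in> R" and one: "1 \<in> R" and neg: "\<And>x. x \<in> R \<Longrightarrow> - x \<in> R"
    and add: "\<And>x y. x \<in> R \<Longrightarrow> y \<in> R \<Longrightarrow> x + y \<in> R"
    and mult: "\<And>x y. x \<in> R \<Longrightarrow> y \<in> R \<Longrightarrow> x * y \<in> R"
    and f1: "f 1 = 1"
    and fadd: "\<And>x y. x \<in> R \<Longrightarrow> y \<in> R \<Longrightarrow> f (x + y) = f x + f y"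
    and fmult: "\<And>x y. x \<in> R \<Longrightarrow> y \<in> R \<Longrightarrow> f (x * y) = f x * f y"
    and "finite A" "finite B" and H: "\<And>r s. H r s \<in> R"
  shows "minor H A B \<in> R \<and> f (minor H A B) = minor (\<lambda>r s. f (H r s)) A B"
proof -
  have f0: "f 0 = 0" using fadd[OF zero zero] by simp
  have fneg: "f (- x) = - f x" if "x \<in> R" for x
    using fadd[OF that neg[OF that]] f0 by (simp add: add_eq_0_iff)
  have sum: "(\<Sum>s\<in>C. g s) \<in> R \<and> f (\<Sum>s\<in>C. g s) = (\<Sum>s\<in>C. f (g s))"
    if "\<And>s. s \<in> C \<Longrightarrow> g s \<in> R" for C :: "nat set" and g
    using that by (induction C rule: infinite_finite_induct) (auto simp: zero f0 add fadd)
  have sgR: "sg C s \<in> R \<and> f (sg C s) = sg C s" for C s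
  proof -
    have "(-1) ^ n \<in> R \<and> f ((-1) ^ n) = (-1) ^ n" for n
      by (induction n) (auto simp: one neg f1 fneg)
    then show ?thesis by (simp add: sg_def)
  qed
  show ?thesis
    using \<open>finite A\<close> \<open>finite B\<close>
  proof (induction A arbitrary: B rule: finite_linorder_max_induct)
    case empty
    then show ?case by (simp add: zero one f0 f1)
  next
    case (insert m S)
    have "sg B s * H m s * minor H S (B - {s}) \<in> R \<and>
      f (sg B s * H m s * minor H S (B - {s})) = sg B s * f (H m s) * minor (\<lambda>r s. f (H r s)) S (B - {s})" for s
      using insert sgR[of B s] H[of m s] by (simp add: mult fmult)
    then show ?case using insert.hyps sum[of B "\<lambda>s. sg B s * H m s * minor H S (B - {s})"]
      by (simp add: minor_insert_top)
  qed
qed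

section \<open>Pluecker relations\<close>

text \<open>The coefficient of \<open>S \<otimes> S'\<close> in \<open>\<Sum>\<^sub>r \<psi>\<^sub>r v \<otimes> \<psi>\<^sub>r\<^sup>* v\<close>, up to a sign.\<close>

definition plucker :: "nat \<Rightarrow> (nat set \<Rightarrow> 'a::comm_ring_1) \<Rightarrow> bool" where
  "plucker L v \<longleftrightarrow> (\<forall>S S'. S \<subseteq> {..<L} \<longrightarrow> S' \<subseteq> {..<L} \<longrightarrow>
     (\<Sum>r\<in>S - S'. sg S r * sg S' r * v (S - {r}) * v (insert r S')) = 0)"

text \<open>Row expansion in the second factor trades the particle r for a column s; column
  expansion in the first factor then carries out the sum over r. What remains is the relation of v
  for T = \<open>insert s B\<close> and T' = \<open>B' - {s}\<close>. In other words, the exterior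
  power of H commutes with the sum of \<psi>_r \<otimes> \<psi>_r^*.\<close>

lemma plucker_minor:
  fixes v :: "nat set \<Rightarrow> 'a::comm_ring_1"
  assumes v: "plucker L v"
  shows "plucker L (\<lambda>A. \<Sum>B\<in>Pow {..<L}. minor H A B * v B)"
  unfolding plucker_def
proof (intro allI impI)
  fix S S' assume S: "S \<subseteq> {..<L}" "S' \<subseteq> {..<L}"
  let ?U = "{..<L}"
  have fin: "finite C" if "C \<subseteq> ?U" for C using that finite_subset by auto
  note finS = S[THEN fin]
  have finB: "finite (B' - B)" if "B' \<in> Pow ?U" for B' B using that fin by auto
  have finSig: "finite (SIGMA B':Pow ?U. B' - B)" "finite (Sigma (Pow ?U) ((-) B))" if "B \<in> Pow ?U" for B
    using that finB by auto
  have "(\<Sum>r\<in>S - S'. sg S r * sg S' r * (\<Sum>B\<in>Pow ?U. minor H (S - {r}) B * v B) *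
        (\<Sum>B\<in>Pow ?U. minor H (insert r S') B * v B))
    = (\<Sum>r\<in>S. \<Sum>B\<in>Pow ?U. \<Sum>B'\<in>Pow ?U. sg S r * minor H (S - {r}) B * v B * v B' *
        (if r \<in> S' then 0 else sg S' r * minor H (insert r S') B'))"
    using finS by (intro sum.mono_neutral_cong_left)
      (auto simp: sum_distrib_left sum_distrib_right mult_ac intro: sum.swap)
  also have "\<dots> = (\<Sum>r\<in>S. \<Sum>B\<in>Pow ?U. \<Sum>B'\<in>Pow ?U. sg S r * minor H (S - {r}) B * v B * v B' *
        (\<Sum>s\<in>B'. sg B' s * H r s * minor H S' (B' - {s})))"
    using finS fin by (intro sum.cong refl) (simp add: minor_row)
  also have "\<dots> = (\<Sum>B\<in>Pow ?U. \<Sum>B'\<in>Pow ?U. \<Sum>r\<in>S. \<Sum>s\<in>B'. v B * v B' * sg B' s * minor H S' (B' - {s}) *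
      (sg S r * H r s * minor H (S - {r}) B))"
    by (subst sum.swap, subst sum.swap[of _ "Pow ?U" S]) (simp add: sum_distrib_left mult_ac)
  also have "\<dots> = (\<Sum>B\<in>Pow ?U. \<Sum>B'\<in>Pow ?U. \<Sum>s\<in>B'. v B * v B' * sg B' s * minor H S' (B' - {s}) *
      (\<Sum>r\<in>S. sg S r * H r s * minor H (S - {r}) B))"
    by (subst sum.swap[of _ _ S]) (simp add: sum_distrib_left)
  also have "\<dots> = (\<Sum>B\<in>Pow ?U. \<Sum>B'\<in>Pow ?U. \<Sum>s\<in>B'. v B * v B' * sg B' s * minor H S' (B' - {s}) *
      (if s \<in> B then 0 else sg B s * minor H S (insert s B)))"
    using finS fin by (intro sum.cong refl) (simp add: minor_col)
  also have "\<dots> = (\<Sum>B\<in>Pow ?U. \<Sum>B'\<in>Pow ?U. \<Sum>s\<in>B' - B. v B * v B' * sg B' s * minor H S' (B' - {s}) *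
      (sg B s * minor H S (insert s B)))"
    using fin by (intro sum.cong refl sum.mono_neutral_cong_right) auto
  also have "\<dots> = (\<Sum>T\<in>Pow ?U. \<Sum>T'\<in>Pow ?U. \<Sum>s\<in>T - T'. minor H S T * minor H S' T' *
      (sg T s * sg T' s * v (T - {s}) * v (insert s T')))"
    using finB by (simp add: sum.Sigma split_def finSig)
      (rule sum.reindex_bij_witness[of _ "\<lambda>(T, T', s). (T - {s}, insert s T', s)" "\<lambda>(B, B', s). (insert s B, B' - {s}, s)"],
       auto simp: mult_ac insert_absorb)
  also have "\<dots> = (\<Sum>T\<in>Pow ?U. \<Sum>T'\<in>Pow ?U. minor H S T * minor H S' T' *
      (\<Sum>s\<in>T - T'. sg T s * sg T' s * v (T - {s}) * v (insert s T')))"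
    by (simp add: sum_distrib_left)
  also have "\<dots> = 0" using v by (simp add: plucker_def)
  finally show "(\<Sum>r\<in>S - S'. sg S r * sg S' r * (\<Sum>B\<in>Pow ?U. minor H (S - {r}) B * v B) *
        (\<Sum>B\<in>Pow ?U. minor H (insert r S') B * v B)) = 0" .
qed

section \<open>Partitions as finite sets of natural numbers\<close>

lemma part_mono: "i \<le> j \<Longrightarrow> part \<mu> j \<le> part \<mu> i"
  using part[of \<mu>] by (auto dest: antimonoD)

lemma finite_part: "finite {i. part \<mu> i \<noteq> 0}"
  using part[of \<mu>] by auto

lemma partition_eqI: "(\<And>i. part \<mu> i = part \<nu> i) \<Longrightarrow> \<mu> = \<nu>"
  by (metis ext part_inject)

lemma partition_exists:
  assumes "antimono f" "finite {i. f i \<noteq> 0}"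
  obtains \<mu> where "part \<mu> = f"
  using Abs_partition_inverse[of f] assms by blast

lemma part_empty_partition [simp]: "part empty_partition i = 0"
  by (simp add: empty_partition.rep_eq)

lemma part_zero_mono: "part \<mu> N = 0 \<Longrightarrow> N \<le> i \<Longrightarrow> part \<mu> i = 0"
  using part_mono[of N i \<mu>] by simp

lemma support_lessThan: "part \<mu> N = 0 \<Longrightarrow> {i. part \<mu> i \<noteq> 0} \<subseteq> {..<N}"
  using part_zero_mono[of \<mu> N] not_less by blast

text \<open>The beta numbers of \<mu>: the staircase N - 1, ..., 0 makes the first N parts strictly
  decreasing, hence positions of distinct particles.\<close>

definition beta :: "nat \<Rightarrow> partition \<Rightarrow> nat \<Rightarrow> nat" where
  "beta N \<mu> i = part \<mu> i + (N - Suc i)"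

definition pset :: "nat \<Rightarrow> partition \<Rightarrow> nat set" where
  "pset N \<mu> = beta N \<mu> ` {..<N}"

lemma beta_less:
  assumes "i < j" "j < N"
  shows "beta N \<mu> j < beta N \<mu> i"
  using part_mono[of i j \<mu>] assms unfolding beta_def by linarith

lemma beta_inj: "inj_on (beta N \<mu>) {..<N}"
proof (rule linorder_inj_onI')
  fix i j :: nat assume "i \<in> {..<N}" "j \<in> {..<N}" "i < j"
  then show "beta N \<mu> i \<noteq> beta N \<mu> j"
    using beta_less[of i j N \<mu>] by simp
qed

lemma finite_pset [simp]: "finite (pset N \<mu>)"
  by (simp add: pset_def)

lemma card_pset [simp]: "card (pset N \<mu>) = N"
  by (simp add: pset_def card_image beta_inj)

lemma sum_pset: "sum f (pset N \<mu>) = (\<Sum>i<N. f (beta N \<mu> i))"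
  by (simp add: pset_def sum.reindex beta_inj)

lemma card_above_beta:
  assumes "i < N"
  shows "card {a \<in> pset N \<mu>. beta N \<mu> i < a} = i"
proof -
  let ?b = "beta N \<mu>"
  have "?b i < ?b j \<longleftrightarrow> j < i" if "j < N" for j
  proof
    assume "?b i < ?b j" then show "j < i"
      using beta_less[of i j N \<mu>] that by (cases i j rule: linorder_cases) auto
  qed (use beta_less[of j i N \<mu>] assms in auto)
  then have "{a \<in> pset N \<mu>. ?b i < a} = ?b ` {..<i}"
    using assms unfolding pset_def by (auto intro!: imageI)
  moreover have "inj_on ?b {..<i}" using assms by (intro inj_on_subset[OF beta_inj]) auto
  ultimately show ?thesis by (simp add: card_image)
qed

lemma pset_inject:
  assumes "part \<mu> N = 0" "part \<nu> N = 0" "pset N \<mu> = pset N \<nu>"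
  shows "\<mu> = \<nu>"
proof (rule partition_eqI)
  fix i
  show "part \<mu> i = part \<nu> i"
  proof (cases "i < N")
    case True
    then have "beta N \<mu> i \<in> pset N \<nu>" using assms(3) unfolding pset_def by auto
    then obtain j where j: "j < N" "beta N \<mu> i = beta N \<nu> j"
      unfolding pset_def by auto
    have "i = card {a \<in> pset N \<nu>. beta N \<nu> j < a}"
      using card_above_beta[OF True, of \<mu>] assms(3) j by simp
    then have "i = j" using card_above_beta[OF j(1)] by simp
    then show ?thesis using j by (simp add: beta_def)
  next
    case False
    then show ?thesis using assms part_zero_mono by simp
  qed
qed

lemma pset_surj:
  "finite A \<Longrightarrow> \<exists>\<mu>. part \<mu> (card A) = 0 \<and> pset (card A) \<mu> = A"
proof (induction A rule: finite_linorder_max_induct)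
  case empty
  show ?case by (intro exI[of _ empty_partition]) (simp add: pset_def)
next
  case (insert m S)
  then obtain \<nu> where \<nu>: "part \<nu> (card S) = 0" "pset (card S) \<nu> = S" by blast
  let ?n = "card S"
  have m: "m \<notin> S" using insert by auto
  have le: "part \<nu> 0 + ?n \<le> m"
  proof (cases "?n = 0")
    case True then show ?thesis using \<nu> by simp
  next
    case False
    then have "beta ?n \<nu> 0 \<in> S" using \<nu>(2) unfolding pset_def by blast
    then have "beta ?n \<nu> 0 < m" using insert.hyps by blast
    then show ?thesis using False by (simp add: beta_def)
  qed
  \<comment> \<open>The largest element becomes a new first part. It exceeds card S smaller
    elements, whence the difference, and \<open>le\<close> keeps the sequence decreasing.\<close>
  define f where "f = case_nat (m - ?n) (part \<nu>)"
  have "antimono f"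
  proof (rule antimonoI)
    fix i j :: nat assume "i \<le> j"
    then show "f j \<le> f i"
      using le part_mono[of 0 "j - 1" \<nu>] part_mono[of "i - 1" "j - 1" \<nu>]
      by (cases i; cases j) (simp_all add: f_def)
  qed
  moreover have "finite {i. f i \<noteq> 0}"
  proof (rule finite_subset)
    show "{i. f i \<noteq> 0} \<subseteq> insert 0 (Suc ` {i. part \<nu> i \<noteq> 0})"
    proof
      fix x assume "x \<in> {i. f i \<noteq> 0}"
      then show "x \<in> insert 0 (Suc ` {i. part \<nu> i \<noteq> 0})" by (cases x) (simp_all add: f_def)
    qed
  qed (use finite_part[of \<nu>] in simp)
  ultimately obtain \<mu> where \<mu>: "part \<mu> = f" using partition_exists by blast
  have "pset (Suc ?n) \<mu> = insert m S"
  proof -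
    have "{..<Suc ?n} = insert 0 (Suc ` {..<?n})" by (rule lessThan_Suc_eq_insert_0)
    then have "pset (Suc ?n) \<mu> = insert (beta (Suc ?n) \<mu> 0) ((\<lambda>i. beta (Suc ?n) \<mu> (Suc i)) ` {..<?n})"
      unfolding pset_def by (simp add: image_image)
    also have "beta (Suc ?n) \<mu> 0 = m" using le by (simp add: beta_def \<mu> f_def)
    also have "(\<lambda>i. beta (Suc ?n) \<mu> (Suc i)) = beta ?n \<nu>" by (simp add: fun_eq_iff beta_def \<mu> f_def)
    finally have "pset (Suc ?n) \<mu> = insert m (pset ?n \<nu>)" by (simp only: pset_def)
    then show ?thesis using \<nu> by simp
  qed
  then show ?case using m insert.hyps \<nu> \<mu> by (intro exI[of _ \<mu>]) (simp add: f_def)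
qed

definition pt :: "nat set \<Rightarrow> partition" where
  "pt A = (THE \<mu>. part \<mu> (card A) = 0 \<and> pset (card A) \<mu> = A)"

lemma pt_pset: "part \<mu> N = 0 \<Longrightarrow> pt (pset N \<mu>) = \<mu>"
  unfolding pt_def by (rule the_equality) (auto intro: pset_inject)

lemma pset_pt:
  assumes "finite A"
  shows "pset (card A) (pt A) = A" "part (pt A) (card A) = 0"
  using pset_surj[OF assms] pt_pset by metis+

lemma pset_empty_partition: "pset N empty_partition = {..<N}"
proof -
  have "(\<lambda>i. N - Suc i) ` {..<N} = {..<N}"
  proof (intro equalityI subsetI)
    fix a assume "a \<in> {..<N}"
    then show "a \<in> (\<lambda>i. N - Suc i) ` {..<N}" by (intro image_eqI[of _ _ "N - Suc a"]) auto
  qed auto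
  then show ?thesis by (simp add: pset_def beta_def[abs_def])
qed

lemma pt_lessThan [simp]: "pt {..<N} = empty_partition"
  using pt_pset[of empty_partition N] by (simp add: pset_empty_partition)

text \<open>Adding k particles means adding k zero parts; these occupy the positions below k and
  push all others up by k.\<close>

lemma pset_shift:
  assumes "part \<mu> N = 0"
  shows "pset (k + N) \<mu> = {..<k} \<union> (\<lambda>a. a + k) ` pset N \<mu>"
proof -
  have "{..<k + N} = {..<N} \<union> {N..<k + N}" by auto
  then have "pset (k + N) \<mu> = beta (k + N) \<mu> ` {..<N} \<union>
      beta (k + N) \<mu> ` {N..<k + N}"
    unfolding pset_def by (simp only: image_Un)
  also have "beta (k + N) \<mu> ` {..<N} = (\<lambda>a. a + k) ` pset N \<mu>"
    unfolding pset_def image_image by (intro image_cong) (auto simp: beta_def)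
  also have "beta (k + N) \<mu> ` {N..<k + N} = {..<k}"
  proof (intro equalityI subsetI)
    fix a assume "a \<in> {..<k}"
    then show "a \<in> beta (k + N) \<mu> ` {N..<k + N}"
      using assms part_zero_mono by (intro image_eqI[of _ _ "k + N - Suc a"]) (auto simp: beta_def)
  next
    fix a assume "a \<in> beta (k + N) \<mu> ` {N..<k + N}"
    then obtain i where "N \<le> i" "i < k + N" "a = beta (k + N) \<mu> i" by auto
    then show "a \<in> {..<k}" using part_zero_mono[OF assms, of i] by (simp add: beta_def)
  qed
  finally show ?thesis by auto
qed

lemma pt_shift:
  assumes "finite A"
  shows "pt ({..<k} \<union> (\<lambda>a. a + k) ` A) = pt A"
proof -
  let ?N = "card A"
  have "pset (k + ?N) (pt A) = {..<k} \<union> (\<lambda>a. a + k) ` A"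
    using pset_shift[OF pset_pt(2)[OF assms]] pset_pt(1)[OF assms] by simp
  moreover have "part (pt A) (k + ?N) = 0" using pset_pt(2)[OF assms] part_zero_mono by simp
  ultimately show ?thesis using pt_pset by metis
qed

lemma psize_eq_sum:
  assumes "part \<mu> N = 0"
  shows "psize \<mu> = (\<Sum>i<N. part \<mu> i)"
  unfolding psize_def
proof (rule sum.mono_neutral_left)
  show "{i. part \<mu> i \<noteq> 0} \<subseteq> {..<N}" by (rule support_lessThan[OF assms])
qed auto

lemma sum_pset_psize:
  assumes "part \<mu> N = 0"
  shows "\<Sum>(pset N \<mu>) = psize \<mu> + \<Sum>{..<N}"
proof -
  have "\<Sum>(pset N \<mu>) = psize \<mu> + (\<Sum>i<N. N - Suc i)"
    unfolding sum_pset beta_def sum.distrib psize_eq_sum[OF assms] ..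
  also have "(\<Sum>i<N. N - Suc i) = \<Sum>{..<N}" by (rule sum.nat_diff_reindex[of "\<lambda>x. x"])
  finally show ?thesis .
qed

lemma psize_pt: "finite A \<Longrightarrow> \<Sum>A = psize (pt A) + \<Sum>{..<card A}"
  using sum_pset_psize[OF pset_pt(2)] pset_pt(1) by metis

text \<open>\<kappa>_\<mu> is twice the sum of the contents of the cells. A particle moving from a
  to a + 1 adds a cell of content a + 1 - N, and twice this is the increment of the quadratic
  function. So \<kappa> is additive over particles, up to a constant.\<close>

lemma kappa_eq_sum:
  assumes "part \<mu> N = 0"
  shows "kappa \<mu> = (\<Sum>a\<in>pset N \<mu>. (int a - int N) * (int a - int N + 1)) -
     (\<Sum>a<N. (int a - int N) * (int a - int N + 1))"
proof -
  let ?F = "\<lambda>a. (int a - int N) * (int a - int N + 1)"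
  have "kappa \<mu> = (\<Sum>i<N. int (part \<mu> i) * (int (part \<mu> i) - 2 * int i - 1))"
    unfolding kappa_def
  proof (rule sum.mono_neutral_left)
    show "{i. part \<mu> i \<noteq> 0} \<subseteq> {..<N}" by (rule support_lessThan[OF assms])
  qed auto
  also have "\<dots> = (\<Sum>i<N. ?F (beta N \<mu> i) - ?F (N - Suc i))"
  proof (intro sum.cong refl)
    fix i assume "i \<in> {..<N}"
    then have "int (N - Suc i) = int N - int i - 1" by auto
    then show "int (part \<mu> i) * (int (part \<mu> i) - 2 * int i - 1) = ?F (beta N \<mu> i) - ?F (N - Suc i)"
      by (simp add: beta_def algebra_simps)
  qed
  also have "\<dots> = (\<Sum>a\<in>pset N \<mu>. ?F a) - (\<Sum>i<N. ?F (N - Suc i))"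
    unfolding sum_subtractf sum_pset ..
  also have "(\<Sum>i<N. ?F (N - Suc i)) = (\<Sum>a<N. ?F a)" by (rule sum.nat_diff_reindex[of ?F])
  finally show ?thesis .
qed

lemma psize_bounds:
  assumes "psize \<mu> \<le> D"
  shows "part \<mu> D = 0" "part \<mu> i \<le> D"
proof -
  obtain N where N: "part \<mu> N = 0" "D < N" "i < N"
  proof -
    have "finite ({i. part \<mu> i \<noteq> 0} \<union> {..D} \<union> {..i})" using finite_part by auto
    then obtain N where "N \<notin> {i. part \<mu> i \<noteq> 0} \<union> {..D} \<union> {..i}" using ex_new_if_finite infinite_UNIV_nat by metis
    then show ?thesis by (intro that[of N]) auto
  qed
  have "part \<mu> i \<le> (\<Sum>i<N. part \<mu> i)" using N by (intro member_le_sum) auto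
  then show "part \<mu> i \<le> D" using assms psize_eq_sum[OF N(1)] by simp
  show "part \<mu> D = 0"
  proof (rule ccontr)
    assume "part \<mu> D \<noteq> 0"
    then have "1 \<le> part \<mu> i" if "i \<le> D" for i using part_mono[OF that, of \<mu>] by simp
    then have "(\<Sum>i\<le>D. 1) \<le> (\<Sum>i\<le>D. part \<mu> i)" by (intro sum_mono) auto
    also have "\<dots> \<le> (\<Sum>i<N. part \<mu> i)" using N by (intro sum_mono2) auto
    finally show False using assms psize_eq_sum[OF N(1)] by simp
  qed
qed

lemma pset_subset:
  assumes "part \<mu> 0 + N \<le> L"
  shows "pset N \<mu> \<subseteq> {..<L}"
  unfolding pset_def
proof
  fix a assume "a \<in> beta N \<mu> ` {..<N}"
  then obtain i where "i < N" "a = part \<mu> i + (N - Suc i)" by (auto simp: beta_def)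
  then show "a \<in> {..<L}" using assms part_mono[of 0 i \<mu>] by simp
qed

lemma finite_partitions_le: "finite {\<mu>. psize \<mu> \<le> d}"
proof (rule finite_imageD)
  show "finite (pset d ` {\<mu>. psize \<mu> \<le> d})"
  proof (rule finite_subset)
    show "pset d ` {\<mu>. psize \<mu> \<le> d} \<subseteq> Pow {..<2 * d}"
    proof
      fix A assume "A \<in> pset d ` {\<mu>. psize \<mu> \<le> d}"
      then obtain \<mu> where \<mu>: "psize \<mu> \<le> d" "A = pset d \<mu>" by auto
      show "A \<in> Pow {..<2 * d}"
        using pset_subset[of \<mu> d "2 * d"] psize_bounds(2)[OF \<mu>(1), of 0] \<mu>(2) by simp
    qed
  qed simp
  show "inj_on (pset d) {\<mu>. psize \<mu> \<le> d}"
    using psize_bounds(1) by (auto intro!: inj_onI intro: pset_inject)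
qed

lemma finite_partitions [simp]: "finite {\<mu>. psize \<mu> = d}"
  by (rule finite_subset[OF _ finite_partitions_le[of d]]) auto

subsection \<open>Conjugation\<close>

text \<open>As the parts decrease, the rows longer than j form an initial segment, and its length is
  the conjugate part. The facts on conjugation below rest on this equivalence.\<close>

lemma less_part_conj: "i < part (conj_partition \<mu>) j \<longleftrightarrow> j < part \<mu> i"
proof -
  have fin: "finite {i. j < part \<mu> i}" by (rule finite_subset[OF _ finite_part[of \<mu>]]) auto
  have "\<exists>n. {i. j < part \<mu> i} = {..<n}"
  proof -
    define n where "n = (LEAST i. \<not> j < part \<mu> i)"
    have ex: "\<exists>i. \<not> j < part \<mu> i" using fin by (metis UNIV_I ex_new_if_finite infinite_UNIV_nat mem_Collect_eq)
    then have n: "\<not> j < part \<mu> n" unfolding n_def by (rule LeastI_ex)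
    have "j < part \<mu> i" if "i < n" for i using that not_less_Least unfolding n_def by blast
    moreover have "i < n" if "j < part \<mu> i" for i
      using that n part_mono[of n i \<mu>] by (meson le_less_trans not_less order_less_le_trans)
    ultimately show ?thesis by (intro exI[of _ n]) auto
  qed
  then obtain n where n: "{i. j < part \<mu> i} = {..<n}" by blast
  have "part (conj_partition \<mu>) j = card {i. j < part \<mu> i}" by (simp add: conj_partition.rep_eq)
  then have "part (conj_partition \<mu>) j = n" using n by simp
  moreover have "j < part \<mu> i \<longleftrightarrow> i < n" using n by blast
  ultimately show ?thesis by simp
qed

lemma nat_eq_iff_less: "(x :: nat) = y \<longleftrightarrow> (\<forall>i. i < x \<longleftrightarrow> i < y)"
  by (metis linorder_neq_iff order_less_irrefl)

lemma conj_empty [simp]: "conj_partition empty_partition = empty_partition"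
  by (rule partition_eqI) (simp add: nat_eq_iff_less less_part_conj)

text \<open>Particles and holes of the window are exchanged and the order of the positions is
  reversed: a reflection of the boundary path of the diagram.\<close>

definition flipc :: "nat \<Rightarrow> nat set \<Rightarrow> nat set" where
  "flipc L A = (\<lambda>b. L - Suc b) ` ({..<L} - A)"

lemma flipc_mem: "x < L \<Longrightarrow> L - Suc x \<in> flipc L A \<longleftrightarrow> x \<notin> A"
proof -
  assume x: "x < L"
  have "y = x" if "L - Suc x = L - Suc y" "y < L" for y using that x by linarith
  then show ?thesis unfolding flipc_def using x by blast
qed

lemma flipc_subset: "flipc L A \<subseteq> {..<L}"
  unfolding flipc_def by auto

text \<open>Both sides have L - N elements, so one inclusion is enough.\<close>

lemma pset_conj:
  assumes "part \<mu> N = 0" "part \<mu> 0 + N \<le> L"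
  shows "pset (L - N) (conj_partition \<mu>) = flipc L (pset N \<mu>)"
proof (rule card_subset_eq)
  show "finite (flipc L (pset N \<mu>))" by (rule finite_subset[OF flipc_subset]) simp
  have inj: "inj_on (\<lambda>b. L - Suc b) ({..<L} - pset N \<mu>)" by (auto simp: inj_on_def)
  show "card (pset (L - N) (conj_partition \<mu>)) = card (flipc L (pset N \<mu>))"
    using pset_subset[OF assms(2)] by (simp add: flipc_def card_image[OF inj] card_Diff_subset)
  show "pset (L - N) (conj_partition \<mu>) \<subseteq> flipc L (pset N \<mu>)"
  proof
    fix a assume "a \<in> pset (L - N) (conj_partition \<mu>)"
    then obtain j where j: "j < L - N" "a = part (conj_partition \<mu>) j + (L - N - Suc j)"
      unfolding pset_def beta_def by auto
    let ?c = "part (conj_partition \<mu>) j"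
    have c: "?c \<le> N" using less_part_conj[of N \<mu> j] assms(1) by simp
    \<comment> \<open>The j-th hole from below: along the boundary path, column j is preceded by j
      holes and by the N - c particles of the rows that do not reach it.\<close>
    let ?b = "N + j - ?c"
    have "?b \<notin> pset N \<mu>"
    proof
      assume "?b \<in> pset N \<mu>"
      then obtain i where i: "i < N" "?b = part \<mu> i + (N - Suc i)" unfolding pset_def beta_def by auto
      then have eq: "j + Suc i = part \<mu> i + ?c" using c by simp
      \<comment> \<open>If i < c then also j < \<mu>_i, and the right side of \<open>eq\<close> is
        too large; otherwise both inequalities fail and it is too small.\<close>
      show False using less_part_conj[of i \<mu> j] eq by (cases "i < ?c") auto
    qed
    moreover have "?b < L" using j by simp
    moreover have "a = L - Suc ?b" using j c by simp
    ultimately show "a \<in> flipc L (pset N \<mu>)" by (auto simp: flipc_mem)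
  qed
qed

lemma pt_bound:
  assumes "A \<subseteq> {..<L}"
  shows "part (pt A) 0 + card A \<le> L"
proof (cases "card A = 0")
  case True
  moreover have "finite A" using assms finite_subset by blast
  ultimately have "A = {}" by simp
  then show ?thesis using pt_lessThan[of 0] by simp
next
  case False
  have fin: "finite A" using assms finite_subset by blast
  have "part (pt A) 0 + (card A - 1) \<in> pset (card A) (pt A)"
    unfolding pset_def using False by (intro image_eqI[of _ _ 0]) (auto simp: beta_def)
  then have "part (pt A) 0 + (card A - 1) < L" using pset_pt(1)[OF fin] assms by auto
  then show ?thesis using False by simp
qed

lemma pt_flipc:
  assumes "A \<subseteq> {..<L}"
  shows "pt (flipc L A) = conj_partition (pt A)"
proof -
  have fin: "finite A" using assms finite_subset by blast
  have le: "card A \<le> L" using card_mono[OF _ assms] by simp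
  have "pset (L - card A) (conj_partition (pt A)) = flipc L A"
    using pset_conj[OF pset_pt(2)[OF fin] pt_bound[OF assms]] pset_pt(1)[OF fin] by simp
  moreover have "part (conj_partition (pt A)) (L - card A) = 0"
    using pt_bound[OF assms] less_part_conj[of 0 "pt A" "L - card A"] by linarith
  ultimately show ?thesis using pt_pset by metis
qed

subsection \<open>Removing a corner\<close>

text \<open>Neighbouring rows of equal length occupy adjacent positions, so the lower one blocks the
  step down of the upper one; a last row of length 0 sits at position 0 and cannot step down
  either.\<close>

lemma corner_iff:
  assumes "finite A" "card A = N"
  shows "Suc i \<in> A \<and> i \<notin> A \<longleftrightarrow>
    (\<exists>\<rho><N. beta N (pt A) \<rho> = Suc i \<and> part (pt A) (Suc \<rho>) < part (pt A) \<rho>)"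
proof -
  define l where "l = pt A"
  let ?l = "part l"
  let ?b = "beta N l"
  have A: "A = ?b ` {..<N}" using pset_pt(1)[OF assms(1)] assms(2) unfolding pset_def l_def by simp
  have lN: "?l N = 0" using pset_pt(2)[OF assms(1)] assms(2) unfolding l_def by simp
  show ?thesis
    unfolding l_def[symmetric]
  proof
    assume *: "Suc i \<in> A \<and> i \<notin> A"
    then obtain \<rho> where \<rho>: "\<rho> < N" "?b \<rho> = Suc i" using A by auto
    have "?l (Suc \<rho>) \<noteq> ?l \<rho>"
    proof
      assume e: "?l (Suc \<rho>) = ?l \<rho>"
      show False
      proof (cases "Suc \<rho> < N")
        case True
        then have "?b (Suc \<rho>) = i" using \<rho> e by (simp add: beta_def)
        then show False using * A True by blast
      next
        case False
        then have "Suc \<rho> = N" using \<rho> by simp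
        then show False using e lN \<rho> by (auto simp: beta_def)
      qed
    qed
    then show "\<exists>\<rho><N. ?b \<rho> = Suc i \<and> ?l (Suc \<rho>) < ?l \<rho>"
      using \<rho> part_mono[of \<rho> "Suc \<rho>" l] by (intro exI[of _ \<rho>]) auto
  next
    assume "\<exists>\<rho><N. ?b \<rho> = Suc i \<and> ?l (Suc \<rho>) < ?l \<rho>"
    then obtain \<rho> where \<rho>: "\<rho> < N" "?b \<rho> = Suc i" "?l (Suc \<rho>) < ?l \<rho>" by blast
    have "i \<notin> A"
    proof
      assume "i \<in> A"
      then obtain j where j: "j < N" "?b j = i" using A by auto
      have "\<rho> < j" using \<rho> j beta_less[of j \<rho> N l] by (cases \<rho> j rule: linorder_cases) auto
      then have "?l j \<le> ?l (Suc \<rho>)" using part_mono[of "Suc \<rho>" j] by simp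
      then show False using \<rho> j \<open>\<rho> < j\<close> by (simp add: beta_def)
    qed
    moreover have "?b \<rho> \<in> A" using A \<rho>(1) by blast
    ultimately show "Suc i \<in> A \<and> i \<notin> A" using \<rho>(2) by simp
  qed
qed

lemma pt_hop:
  assumes "finite A" "card A = N" "\<rho> < N" "beta N (pt A) \<rho> = Suc i"
    "part (pt A) (Suc \<rho>) < part (pt A) \<rho>"
  shows "part (pt (insert i (A - {Suc i}))) = (part (pt A))(\<rho> := part (pt A) \<rho> - 1)"
proof -
  define l where "l = pt A"
  let ?l = "part l"
  let ?b = "beta N l"
  let ?f = "?l(\<rho> := ?l \<rho> - 1)"
  have A: "A = ?b ` {..<N}" using pset_pt(1)[OF assms(1)] assms(2) unfolding pset_def l_def by simp
  have lN: "?l N = 0" using pset_pt(2)[OF assms(1)] assms(2) unfolding l_def by simp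
  note hop = assms(3-5)[folded l_def]
  have "antimono ?f"
  proof (rule antimonoI)
    fix i j :: nat assume "i \<le> j"
    then show "?f j \<le> ?f i"
      using part_mono[of i j l] part_mono[of "Suc \<rho>" j l] hop(3) by auto
  qed
  moreover have "finite {i. ?f i \<noteq> 0}"
    by (rule finite_subset[OF _ finite_part[of l]]) auto
  ultimately obtain \<mu> where \<mu>: "part \<mu> = ?f" using partition_exists by blast
  have "pset N \<mu> = insert i (A - {Suc i})"
  proof -
    have "{..<N} = insert \<rho> ({..<N} - {\<rho>})" using assms(3) by auto
    then have "beta N \<mu> ` {..<N} = beta N \<mu> ` insert \<rho> ({..<N} - {\<rho>})" by simp
    then have "pset N \<mu> = insert (beta N \<mu> \<rho>) (beta N \<mu> ` ({..<N} - {\<rho>}))"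
      unfolding pset_def image_insert .
    also have "beta N \<mu> \<rho> = i" using hop(2,3) by (simp add: beta_def \<mu>)
    also have "beta N \<mu> ` ({..<N} - {\<rho>}) = ?b ` ({..<N} - {\<rho>})"
      by (intro image_cong) (auto simp: beta_def \<mu>)
    also have "\<dots> = A - {?b \<rho>}"
      unfolding A using inj_on_image_set_diff[OF beta_inj, of "{..<N}" "{\<rho>}" N l] assms(3) by auto
    finally show ?thesis using hop(2) by simp
  qed
  moreover have "part \<mu> N = 0" using \<mu> lN assms(3) by simp
  ultimately show ?thesis using pt_pset \<mu> unfolding l_def[symmetric] by metis
qed

section \<open>Pluecker relations for functions on partitions\<close>

text \<open>The condition on cardinalities fixes the charge: \<open>S - {r}\<close> and
  \<open>insert r S'\<close> have equally many elements, so \<open>pt\<close> reads both at the same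
  cutoff.\<close>

definition plucker_part :: "(partition \<Rightarrow> 'a::comm_ring_1) \<Rightarrow> bool" where
  "plucker_part c \<longleftrightarrow> (\<forall>S S'. finite S \<longrightarrow> finite S' \<longrightarrow> card S = card S' + 2 \<longrightarrow>
     (\<Sum>r\<in>S - S'. sg S r * sg S' r * c (pt (S - {r})) * c (pt (insert r S'))) = 0)"

text \<open>Extension by 0 to the other cardinalities, so that sums over all subsets of a window see
  only the sector of N particles.\<close>

definition on_sets :: "nat \<Rightarrow> (partition \<Rightarrow> 'a::comm_ring_1) \<Rightarrow> nat set \<Rightarrow> 'a" where
  "on_sets N c A = (if card A = N then c (pt A) else 0)"

lemma plucker_part_iff:
  "plucker_part c \<longleftrightarrow> (\<forall>L N. plucker L (on_sets N c))"
proof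
  assume c: "plucker_part c"
  show "\<forall>L N. plucker L (on_sets N c)"
    unfolding plucker_def
  proof (intro allI impI)
    fix L N and S S' :: "nat set" assume S: "S \<subseteq> {..<L}" "S' \<subseteq> {..<L}"
    have fin: "finite S" "finite S'" using S finite_subset by auto
    show "(\<Sum>r\<in>S - S'. sg S r * sg S' r * on_sets N c (S - {r}) * on_sets N c (insert r S')) = 0"
    proof (cases "card S = Suc N \<and> Suc (card S') = N")
      case True
      then have "(\<Sum>r\<in>S - S'. sg S r * sg S' r * on_sets N c (S - {r}) * on_sets N c (insert r S'))
        = (\<Sum>r\<in>S - S'. sg S r * sg S' r * c (pt (S - {r})) * c (pt (insert r S')))"
        using fin by (intro sum.cong) (auto simp: on_sets_def)
      then show ?thesis using c True fin by (simp add: plucker_part_def)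
    next
      case False
      have "on_sets N c (S - {r}) * on_sets N c (insert r S') = 0" if "r \<in> S - S'" for r
        using False that fin card.remove[of S r] by (auto simp: on_sets_def)
      then show ?thesis by (intro sum.neutral) (auto simp: mult.assoc)
    qed
  qed
next
  assume c: "\<forall>L N. plucker L (on_sets N c)"
  show "plucker_part c"
    unfolding plucker_part_def
  proof (intro allI impI)
    fix S S' :: "nat set" assume fin: "finite S" "finite S'" and card: "card S = card S' + 2"
    define L where "L = Suc (Max (insert 0 (S \<union> S')))"
    have L: "S \<union> S' \<subseteq> {..<L}"
      using fin Max_ge[of "insert 0 (S \<union> S')"] by (auto simp: L_def less_Suc_eq_le)
    then have "(\<Sum>r\<in>S - S'. sg S r * sg S' r * on_sets (Suc (card S')) c (S - {r}) * on_sets (Suc (card S')) c (insert r S')) = 0"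
      using c unfolding plucker_def by auto
    moreover have "(\<Sum>r\<in>S - S'. sg S r * sg S' r * on_sets (Suc (card S')) c (S - {r}) * on_sets (Suc (card S')) c (insert r S'))
        = (\<Sum>r\<in>S - S'. sg S r * sg S' r * c (pt (S - {r})) * c (pt (insert r S')))"
      using fin card by (intro sum.cong) (auto simp: on_sets_def)
    ultimately show "(\<Sum>r\<in>S - S'. sg S r * sg S' r * c (pt (S - {r})) * c (pt (insert r S'))) = 0" by simp
  qed
qed

section \<open>The Jacobi--Trudi formula\<close>

lemma mps_nth_zero [simp]: "mps_nth 0 M = 0"
  by (simp add: zero_mps_def)

lemma mps_nth_one: "mps_nth 1 M = (if M = {#} then 1 else 0)"
  by (simp add: one_mps_def)

lemma mps_nth_add [simp]: "mps_nth (f + g) M = mps_nth f M + mps_nth g M"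
  by (simp add: plus_mps_def)

lemma mps_nth_uminus [simp]: "mps_nth (- f) M = - mps_nth f M"
  by (simp add: uminus_mps_def)

lemma mps_nth_sum [simp]: "mps_nth (sum f A) M = (\<Sum>x\<in>A. mps_nth (f x) M)"
  by (induction A rule: infinite_finite_induct) auto

lemma mps_nth_mult: "mps_nth (f * g) M = (\<Sum>(A, B)\<in>mset_splits M. mps_nth f A * mps_nth g B)"
  by (simp add: times_mps_def)

definition var :: "nat \<Rightarrow> 'a::comm_ring_1 mps" where
  "var n = Abs_mps (\<lambda>M. if M = {#n#} then 1 else 0)"

lemma mps_nth_var_mult:
  "mps_nth (var n * f) M = (if n \<in># M then mps_nth f (M - {#n#}) else 0)"
proof -
  have "mps_nth (var n * f) M =
     (\<Sum>p\<in>mset_splits M. if p = ({#n#}, M - {#n#}) then mps_nth f (M - {#n#}) else 0)"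
    unfolding mps_nth_mult by (intro sum.cong) (auto simp: var_def mset_splits_def split: if_splits)
  also have "\<dots> = (if n \<in># M then mps_nth f (M - {#n#}) else 0)"
  proof -
    have "({#n#}, M - {#n#}) \<in> mset_splits M \<longleftrightarrow> n \<in># M"
      by (simp add: mset_splits_def) (metis insert_DiffM union_single_eq_member)
    then show ?thesis by (simp add: sum.delta)
  qed
  finally show ?thesis .
qed

section \<open>Complete homogeneous functions in finitely many variables\<close>

definition complete_hom :: "nat \<Rightarrow> 'a::comm_ring_1 mps" where
  "complete_hom k = Abs_mps (\<lambda>M. if size M = k then 1 else 0)"

text \<open>Sets the variables x_n, x_(n+1), ... to zero; as a ring homomorphism it passes through
  minors.\<close>

definition truncate :: "nat \<Rightarrow> 'a::comm_ring_1 mps \<Rightarrow> 'a mps" where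
  "truncate n f = Abs_mps (\<lambda>M. if set_mset M \<subseteq> {..<n} then mps_nth f M else 0)"

lemma mps_nth_truncate: "mps_nth (truncate n f) M = (if set_mset M \<subseteq> {..<n} then mps_nth f M else 0)"
  by (simp add: truncate_def)

lemma truncate_add: "truncate n (f + g) = truncate n f + truncate n g"
  by (rule mps_eqI) (simp add: mps_nth_truncate)

lemma truncate_one: "truncate n 1 = 1"
  by (rule mps_eqI) (simp add: mps_nth_truncate mps_nth_one)

lemma truncate_mult: "truncate n (f * g) = truncate n f * truncate n g"
proof (rule mps_eqI)
  fix M
  have "mps_nth (truncate n f * truncate n g) M =
     (\<Sum>p\<in>mset_splits M. if set_mset M \<subseteq> {..<n} then mps_nth f (fst p) * mps_nth g (snd p) else 0)"
    unfolding mps_nth_mult by (intro sum.cong) (auto simp: mset_splits_def mps_nth_truncate split: if_splits)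
  then show "mps_nth (truncate n (f * g)) M = mps_nth (truncate n f * truncate n g) M"
    by (simp add: mps_nth_truncate mps_nth_mult case_prod_unfold)
qed

lemma truncate_eqI:
  assumes "\<And>n. truncate n f = truncate n g"
  shows "f = g"
proof (rule mps_eqI)
  fix M
  define n where "n = Suc (Max (insert 0 (set_mset M)))"
  have "set_mset M \<subseteq> {..<n}" using Max_ge[of "insert 0 (set_mset M)"] by (auto simp: n_def less_Suc_eq_le)
  then show "mps_nth f M = mps_nth g M" using assms[of n] by (metis mps_nth_truncate)
qed

lemma truncate_minor:
  assumes "finite A" "finite B"
  shows "truncate n (minor H A B) = minor (\<lambda>r s. truncate n (H r s)) A B"
  using hom_minor[of UNIV "truncate n" A B H] assms by (simp add: truncate_add truncate_one truncate_mult)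

lemma complete_hom_0: "complete_hom 0 = 1"
  by (rule mps_eqI) (simp add: complete_hom_def mps_nth_one)

lemma truncate_complete_hom_0 [simp]: "truncate n (complete_hom 0) = 1"
  by (simp add: complete_hom_0 truncate_one)

text \<open>Monomials are divided by whether x_n occurs in them; if so, one factor x_n is split
  off.\<close>

lemma truncate_complete_hom_Suc:
  "truncate (Suc n) (complete_hom (Suc k)) =
     truncate n (complete_hom (Suc k)) + var n * truncate (Suc n) (complete_hom k)"
proof (rule mps_eqI)
  fix M :: "nat multiset"
  have sub: "set_mset M \<subseteq> {..<Suc n} \<longleftrightarrow> set_mset (M - {#n#}) \<subseteq> {..<Suc n}" if "n \<in># M"
    using that by (metis insert_DiffM insert_subset lessI lessThan_iff set_mset_add_mset_insert)
  have sub2: "set_mset M \<subseteq> {..<Suc n} \<longleftrightarrow> set_mset M \<subseteq> {..<n}" if "n \<notin># M"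
    using that by (auto simp: less_Suc_eq)
  have sub3: "\<not> set_mset M \<subseteq> {..<n}" if "n \<in># M" using that by auto
  show "mps_nth (truncate (Suc n) (complete_hom (Suc k))) M =
    mps_nth (truncate n (complete_hom (Suc k)) + var n * truncate (Suc n) (complete_hom k)) M"
  proof (cases "n \<in># M")
    case True
    then have "size M = Suc k \<longleftrightarrow> size (M - {#n#}) = k" by (metis Suc_inject size_Suc_Diff1)
    then show ?thesis using True sub sub3 by (simp add: mps_nth_truncate mps_nth_var_mult complete_hom_def)
  next
    case False
    then show ?thesis using sub2 by (simp add: mps_nth_truncate mps_nth_var_mult complete_hom_def)
  qed
qed

text \<open>Interpolation between n and n + 1 variables: the rows up to i may already use x_n. Row 0
  may do so from the start, because its only nonzero entry is h_0 = 1.\<close>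

definition stage_matrix :: "nat \<Rightarrow> nat \<Rightarrow> nat \<Rightarrow> nat \<Rightarrow> 'a::comm_ring_1 mps" where
  "stage_matrix n i r s =
     (if s \<le> r then truncate (if r \<le> i then Suc n else n) (complete_hom (r - s)) else 0)"

lemma stage_matrix_Suc:
  "stage_matrix n (Suc i) r s =
     (if r = Suc i then stage_matrix n i (Suc i) s + var n * stage_matrix n i i s else stage_matrix n i r s)"
proof (cases "r = Suc i")
  case True
  consider "s \<le> i" | "s = Suc i" | "s > Suc i" by linarith
  then show ?thesis
  proof cases
    case 1
    then have "Suc i - s = Suc (i - s)" by simp
    then show ?thesis using True 1 by (simp add: stage_matrix_def truncate_complete_hom_Suc)
  qed (use True in \<open>auto simp: stage_matrix_def\<close>)
next
  case False
  then show ?thesis by (auto simp: stage_matrix_def)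
qed

subsection \<open>Adding cells one by one\<close>

lemma finite_skew_cells: "finite (skew_cells \<alpha> \<eta>)"
proof (rule finite_subset)
  show "skew_cells \<alpha> \<eta> \<subseteq> Sigma {i. part \<alpha> i \<noteq> 0} (\<lambda>i. {..<part \<alpha> i})"
    by (auto simp: skew_cells_def)
qed (simp add: finite_part[of \<alpha>, simplified])

text \<open>
  Tableaux are built up cell by cell, in the lexicographic order of (entry, content). The last cell
  is a corner, because entries strictly increase along diagonals; so adding it amounts to moving one
  element of the associated set from \<open>i\<close> to \<open>i + 1\<close>, which is the row operation of
  \<open>minor_row_operation\<close>.
\<close>

definition bounded_tableaux ::
    "nat \<Rightarrow> int \<Rightarrow> partition \<Rightarrow> partition \<Rightarrow> nat multiset \<Rightarrow> (nat \<times> nat \<Rightarrow> nat) set" where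
  "bounded_tableaux n c \<alpha> \<eta> M = {T \<in> ssyt \<alpha> \<eta>.
     (\<forall>i j. (i, j) \<in> skew_cells \<alpha> \<eta> \<longrightarrow> T (i, j) < n \<or> T (i, j) = n \<and> int j - int i < c) \<and>
     image_mset T (mset_set (skew_cells \<alpha> \<eta>)) = M}"

definition bounded_schur :: "nat \<Rightarrow> int \<Rightarrow> partition \<Rightarrow> partition \<Rightarrow> 'a::comm_ring_1 mps" where
  "bounded_schur n c \<alpha> \<eta> =
     (if \<forall>i. part \<eta> i \<le> part \<alpha> i then Abs_mps (\<lambda>M. of_nat (card (bounded_tableaux n c \<alpha> \<eta> M))) else 0)"

lemma finite_bounded_tableaux: "finite (bounded_tableaux n c \<alpha> \<eta> M)"
proof (rule finite_subset)
  show "bounded_tableaux n c \<alpha> \<eta> M \<subseteq> PiE (skew_cells \<alpha> \<eta>) (\<lambda>_. set_mset M)"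
    using finite_skew_cells by (auto simp: bounded_tableaux_def ssyt_def PiE_def)
  show "finite (PiE (skew_cells \<alpha> \<eta>) (\<lambda>_. set_mset M))"
    by (intro finite_PiE finite_skew_cells) auto
qed

lemma bounded_schur_zero: "\<not> part \<eta> i \<le> part \<alpha> i \<Longrightarrow> bounded_schur n c \<alpha> \<eta> = 0"
  unfolding bounded_schur_def by (rule if_not_P) blast

text \<open>A cell to the right would carry at least n on the diagonal c + 1, a cell below would
  carry more than n; the bound forbids both.\<close>

lemma maximal_cell_corner:
  assumes T: "T \<in> ssyt \<alpha> \<eta>"
    and bound: "\<And>i j. (i, j) \<in> skew_cells \<alpha> \<eta> \<Longrightarrow> T (i, j) < n \<or> T (i, j) = n \<and> int j - int i < c + 1"
    and cell: "(r, d) \<in> skew_cells \<alpha> \<eta>" "T (r, d) = n" "int d - int r = c"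
  shows "part \<alpha> r = Suc d" "part \<alpha> (Suc r) \<le> d"
proof -
  have d: "part \<eta> r \<le> d" "d < part \<alpha> r" using cell by (auto simp: skew_cells_def)
  have "\<not> Suc d < part \<alpha> r"
  proof
    assume "Suc d < part \<alpha> r"
    then have right: "(r, Suc d) \<in> skew_cells \<alpha> \<eta>" using d by (simp add: skew_cells_def)
    then have "n \<le> T (r, Suc d)" using T cell unfolding ssyt_def by force
    then show False using bound[OF right] cell by auto
  qed
  then show "part \<alpha> r = Suc d" using d by simp
  have "\<not> d < part \<alpha> (Suc r)"
  proof
    assume "d < part \<alpha> (Suc r)"
    then have below: "(Suc r, d) \<in> skew_cells \<alpha> \<eta>"
      using d part_mono[of r "Suc r" \<eta>] by (simp add: skew_cells_def)
    then have "n < T (Suc r, d)" using T cell unfolding ssyt_def by force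
    then show False using bound[OF below] by auto
  qed
  then show "part \<alpha> (Suc r) \<le> d" by simp
qed

lemma bounded_tableaux_Suc_eq:
  assumes "\<And>r d. part \<alpha> r = Suc d \<Longrightarrow> part \<alpha> (Suc r) \<le> d \<Longrightarrow> int d - int r = c \<Longrightarrow> (r, d) \<notin> skew_cells \<alpha> \<eta>"
  shows "bounded_tableaux n (c + 1) \<alpha> \<eta> M = bounded_tableaux n c \<alpha> \<eta> M"
proof (intro equalityI subsetI)
  fix T assume T: "T \<in> bounded_tableaux n (c + 1) \<alpha> \<eta> M"
  have "T (i, j) < n \<or> T (i, j) = n \<and> int j - int i < c" if "(i, j) \<in> skew_cells \<alpha> \<eta>" for i j
  proof (rule ccontr)
    assume "\<not> ?thesis"
    moreover have "T (i, j) < n \<or> T (i, j) = n \<and> int j - int i < c + 1"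
      using T that by (simp add: bounded_tableaux_def)
    ultimately have "T (i, j) = n" "int j - int i = c" by auto
    then show False using maximal_cell_corner[of T \<alpha> \<eta> n c i j] T that assms[of i j]
      by (auto simp: bounded_tableaux_def)
  qed
  then show "T \<in> bounded_tableaux n c \<alpha> \<eta> M" using T by (auto simp: bounded_tableaux_def)
next
  fix T assume "T \<in> bounded_tableaux n c \<alpha> \<eta> M"
  then show "T \<in> bounded_tableaux n (c + 1) \<alpha> \<eta> M"
    unfolding bounded_tableaux_def by force
qed

lemma bounded_schur_no_corner:
  assumes "\<And>r. part \<alpha> (Suc r) < part \<alpha> r \<Longrightarrow> int (part \<alpha> r) - 1 - int r \<noteq> c"
  shows "bounded_schur n (c + 1) \<alpha> \<eta> = bounded_schur n c \<alpha> \<eta>"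
proof -
  have "bounded_tableaux n (c + 1) \<alpha> \<eta> M = bounded_tableaux n c \<alpha> \<eta> M" for M
  proof (rule bounded_tableaux_Suc_eq)
    fix r d assume "part \<alpha> r = Suc d" "part \<alpha> (Suc r) \<le> d" "int d - int r = c"
    then show "(r, d) \<notin> skew_cells \<alpha> \<eta>" using assms[of r] by auto
  qed
  then show ?thesis by (simp add: bounded_schur_def)
qed

text \<open>If the corner does not carry n, the tableau already obeys the bound c, since no other
  cell on the diagonal c can carry n. If it does, removing it leaves a tableau of shape
  \<mu>.\<close>

lemma bounded_tableaux_corner:
  assumes corner: "part \<alpha> \<rho> = Suc d" "part \<alpha> (Suc \<rho>) \<le> d"
    and \<mu>: "part \<mu> = (part \<alpha>)(\<rho> := d)"
    and \<eta>: "part \<eta> \<rho> \<le> d"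
  defines "c \<equiv> int d - int \<rho>"
  shows "bounded_tableaux n (c + 1) \<alpha> \<eta> M = bounded_tableaux n c \<alpha> \<eta> M \<union>
    (if n \<in># M then (\<lambda>T. T((\<rho>, d) := n)) ` bounded_tableaux n c \<mu> \<eta> (M - {#n#}) else {})"
    (is "?L = ?R1 \<union> ?R2")
proof -
  let ?\<kappa> = "(\<rho>, d)"
  have cells: "skew_cells \<alpha> \<eta> = insert ?\<kappa> (skew_cells \<mu> \<eta>)" "?\<kappa> \<notin> skew_cells \<mu> \<eta>"
    using corner \<eta> by (auto simp: skew_cells_def \<mu> less_Suc_eq split: if_splits)
  \<comment> \<open>The ends of successive rows have strictly decreasing contents, so only one of
    them lies on the diagonal c.\<close>
  have unique: "(r, j) = ?\<kappa>" if "part \<alpha> r = Suc j" "int j - int r = c" for r j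
    using that corner part_mono[of r \<rho> \<alpha>] part_mono[of \<rho> r \<alpha>] unfolding c_def
    by (cases r \<rho> rule: linorder_cases) auto
  have mset: "image_mset T (mset_set (skew_cells \<alpha> \<eta>)) =
      add_mset (T ?\<kappa>) (image_mset T (mset_set (skew_cells \<mu> \<eta>)))" for T :: "nat \<times> nat \<Rightarrow> nat"
    using cells finite_skew_cells[of \<mu> \<eta>] by simp
  have cong: "image_mset (T(?\<kappa> := x)) (mset_set (skew_cells \<mu> \<eta>)) = image_mset T (mset_set (skew_cells \<mu> \<eta>))"
    for T :: "nat \<times> nat \<Rightarrow> nat" and x
    using cells(2) finite_skew_cells[of \<mu> \<eta>] by (intro image_mset_cong) auto
  show ?thesis
  proof (intro equalityI subsetI)
    fix T assume T: "T \<in> ?L"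
    have Tb: "T (i, j) < n \<or> T (i, j) = n \<and> int j - int i < c + 1" if "(i, j) \<in> skew_cells \<alpha> \<eta>" for i j
      using T that by (simp add: bounded_tableaux_def)
    have Ts: "T \<in> ssyt \<alpha> \<eta>" using T by (simp add: bounded_tableaux_def)
    have bound: "T (i, j) < n \<or> T (i, j) = n \<and> int j - int i < c"
      if "(i, j) \<in> skew_cells \<alpha> \<eta>" "(i, j) = ?\<kappa> \<Longrightarrow> T ?\<kappa> \<noteq> n" for i j
    proof (rule ccontr)
      assume *: "\<not> ?thesis"
      then have eq: "T (i, j) = n" "int j - int i = c" using Tb[OF that(1)] by auto
      then have "(i, j) = ?\<kappa>"
        using maximal_cell_corner(1)[OF Ts Tb that(1)] unique by blast
      then show False using that eq by auto
    qed
    show "T \<in> ?R1 \<union> ?R2"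
    proof (cases "T ?\<kappa> = n")
      case False
      then have "T \<in> ?R1" using T bound by (simp add: bounded_tableaux_def)
      then show ?thesis ..
    next
      case True
      \<comment> \<open>Tableaux are extensional, so the removed cell is reset to
        \<open>undefined\<close>.\<close>
      let ?T = "T(?\<kappa> := undefined)"
      have M: "image_mset T (mset_set (skew_cells \<alpha> \<eta>)) = M" using T by (simp add: bounded_tableaux_def)
      then have nM: "n \<in># M" "M - {#n#} = image_mset T (mset_set (skew_cells \<mu> \<eta>))"
        unfolding mset True by auto
      have "?T \<in> ssyt \<mu> \<eta>"
        using Ts cells unfolding ssyt_def extensional_def by (auto split: if_splits)
      moreover have "?T (i, j) < n \<or> ?T (i, j) = n \<and> int j - int i < c" if "(i, j) \<in> skew_cells \<mu> \<eta>" for i j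
        using that cells bound[of i j] by auto
      ultimately have "?T \<in> bounded_tableaux n c \<mu> \<eta> (M - {#n#})"
        by (simp add: bounded_tableaux_def nM cong)
      moreover have "T = ?T(?\<kappa> := n)" using True by auto
      ultimately have "T \<in> (\<lambda>T. T(?\<kappa> := n)) ` bounded_tableaux n c \<mu> \<eta> (M - {#n#})"
        by (intro image_eqI[of T _ ?T])
      then show ?thesis using nM(1) by simp
    qed
  next
    fix T assume "T \<in> ?R1 \<union> ?R2"
    then show "T \<in> ?L"
    proof
      assume "T \<in> ?R1"
      then show ?thesis unfolding bounded_tableaux_def by force
    next
      assume "T \<in> ?R2"
      then obtain T' where nM: "n \<in># M" and T': "T' \<in> bounded_tableaux n c \<mu> \<eta> (M - {#n#})"
        and T: "T = T'(?\<kappa> := n)" by (auto split: if_splits)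
      have bound: "T' (i, j) < n \<or> T' (i, j) = n \<and> int j - int i < c" if "(i, j) \<in> skew_cells \<mu> \<eta>" for i j
        using T' that by (simp add: bounded_tableaux_def)
      have le: "T (i, j) \<le> n" if "(i, j) \<in> skew_cells \<alpha> \<eta>" for i j
        using bound[of i j] that cells(1) unfolding T by auto
      have ext: "T' \<in> extensional (skew_cells \<mu> \<eta>)" using T' by (simp add: bounded_tableaux_def ssyt_def)
      have row: "T' (i, j) \<le> T' (i, j')" if "(i, j) \<in> skew_cells \<mu> \<eta>" "(i, j') \<in> skew_cells \<mu> \<eta>" "j \<le> j'" for i j j'
        using T' that by (simp add: bounded_tableaux_def ssyt_def)
      have col: "T' (i, j) < T' (i', j)" if "(i, j) \<in> skew_cells \<mu> \<eta>" "(i', j) \<in> skew_cells \<mu> \<eta>" "i < i'" for i i' j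
        using T' that by (simp add: bounded_tableaux_def ssyt_def)
      have "T \<in> ssyt \<alpha> \<eta>"
        unfolding ssyt_def
      proof (intro CollectI conjI allI impI)
        show "T \<in> extensional (skew_cells \<alpha> \<eta>)"
          using ext cells(1) unfolding T extensional_def by auto
      next
        fix i j j' assume *: "(i, j) \<in> skew_cells \<alpha> \<eta>" "(i, j') \<in> skew_cells \<alpha> \<eta>" "j \<le> j'"
        show "T (i, j) \<le> T (i, j')"
        proof (cases "(i, j') = ?\<kappa>")
          case True
          then show ?thesis using le[OF *(1)] by (simp add: T)
        next
          case False
          have "(i, j) \<noteq> ?\<kappa>" using False * corner(1) by (auto simp: skew_cells_def)
          then show ?thesis using False * cells(1) row unfolding T by auto
        qed
      next
        fix i i' j assume *: "(i, j) \<in> skew_cells \<alpha> \<eta>" "(i', j) \<in> skew_cells \<alpha> \<eta>" "i < i'"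
        have 1: "(i, j) \<noteq> ?\<kappa>"
          using * corner part_mono[of "Suc \<rho>" i' \<alpha>] by (auto simp: skew_cells_def)
        then have c1: "(i, j) \<in> skew_cells \<mu> \<eta>" using * cells by auto
        show "T (i, j) < T (i', j)"
        proof (cases "(i', j) = ?\<kappa>")
          case True
          \<comment> \<open>The cells above the corner have larger content than c, so their entries
            are bounded strictly by n.\<close>
          then have "\<not> int j - int i < c" using *(3) by (auto simp: c_def)
          then show ?thesis using bound[OF c1] 1 True by (auto simp: T)
        next
          case False
          then show ?thesis using 1 c1 * cells(1) col unfolding T by auto
        qed
      qed
      moreover have "T (i, j) < n \<or> T (i, j) = n \<and> int j - int i < c + 1" if "(i, j) \<in> skew_cells \<alpha> \<eta>" for i j
        using that cells(1) bound[of i j] unfolding T by (auto simp: c_def)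
      moreover have "image_mset T (mset_set (skew_cells \<alpha> \<eta>)) = M"
        using T' nM unfolding mset T cong by (auto simp: bounded_tableaux_def)
      ultimately show ?thesis by (simp add: bounded_tableaux_def)
    qed
  qed
qed

lemma bounded_schur_corner:
  assumes corner: "part \<alpha> (Suc \<rho>) < part \<alpha> \<rho>"
    and \<mu>: "part \<mu> = (part \<alpha>)(\<rho> := part \<alpha> \<rho> - 1)"
    and c: "c = int (part \<alpha> \<rho>) - 1 - int \<rho>"
  shows "bounded_schur n (c + 1) \<alpha> \<eta> =
    (bounded_schur n c \<alpha> \<eta> + var n * bounded_schur n c \<mu> \<eta> :: 'a::comm_ring_1 mps)"
proof -
  obtain d where d: "part \<alpha> \<rho> = Suc d" using corner by (cases "part \<alpha> \<rho>") auto
  have d': "part \<alpha> (Suc \<rho>) \<le> d" "part \<mu> = (part \<alpha>)(\<rho> := d)" "c = int d - int \<rho>"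
    using corner d \<mu> c by auto
  show ?thesis
  proof (cases "\<forall>i. part \<eta> i \<le> part \<alpha> i")
    case False
    then obtain i where i: "\<not> part \<eta> i \<le> part \<alpha> i" by blast
    then have "\<not> part \<eta> i \<le> part \<mu> i" using \<mu> by (cases "i = \<rho>") auto
    then show ?thesis using i by (simp add: bounded_schur_zero)
  next
    case sub: True
    show ?thesis
    proof (cases "part \<eta> \<rho> \<le> d")
      case True
      have sub': "\<forall>i. part \<eta> i \<le> part \<mu> i" using sub True d' by auto
      show ?thesis
      proof (rule mps_eqI)
        fix M
        let ?f = "\<lambda>T :: nat \<times> nat \<Rightarrow> nat. T((\<rho>, d) := n)"
        have disj: "bounded_tableaux n c \<alpha> \<eta> M \<inter> ?f ` bounded_tableaux n c \<mu> \<eta> (M - {#n#}) = {}"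
        proof -
          have "(\<rho>, d) \<in> skew_cells \<alpha> \<eta>" using d True by (simp add: skew_cells_def)
          then have "T (\<rho>, d) \<noteq> n" if "T \<in> bounded_tableaux n c \<alpha> \<eta> M" for T
            using that d'(3) unfolding bounded_tableaux_def by force
          then show ?thesis by (metis (no_types, lifting) disjoint_iff fun_upd_same imageE)
        qed
        have inj: "inj_on ?f (bounded_tableaux n c \<mu> \<eta> (M - {#n#}))"
        proof (rule inj_onI)
          fix T T' assume T: "T \<in> bounded_tableaux n c \<mu> \<eta> (M - {#n#})" "T' \<in> bounded_tableaux n c \<mu> \<eta> (M - {#n#})"
            and eq: "?f T = ?f T'"
          have "(\<rho>, d) \<notin> skew_cells \<mu> \<eta>" using d' by (simp add: skew_cells_def)
          then have "T (\<rho>, d) = T' (\<rho>, d)" using T by (simp add: bounded_tableaux_def ssyt_def extensional_def)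
          then show "T = T'" using eq by (metis fun_upd_triv fun_upd_upd)
        qed
        have "card (bounded_tableaux n (c + 1) \<alpha> \<eta> M) = card (bounded_tableaux n c \<alpha> \<eta> M) +
           (if n \<in># M then card (bounded_tableaux n c \<mu> \<eta> (M - {#n#})) else 0)"
          using bounded_tableaux_corner[OF d d'(1,2) True, of n M] disj inj
          by (simp add: d'(3)[symmetric] card_Un_disjoint finite_bounded_tableaux card_image)
        then show "mps_nth (bounded_schur n (c + 1) \<alpha> \<eta>) M =
           mps_nth (bounded_schur n c \<alpha> \<eta> + var n * bounded_schur n c \<mu> \<eta>) M"
          using sub sub' by (simp add: bounded_schur_def mps_nth_var_mult)
      qed
    next
      \<comment> \<open>Here \<eta> fills row \<rho> entirely: the corner is not a cell of the skew
        shape, and the bound c + 1 admits nothing new.\<close>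
      case False
      then have "\<not> part \<eta> \<rho> \<le> part \<mu> \<rho>" using d' by simp
      then have "bounded_schur n c \<mu> \<eta> = (0 :: 'a mps)" by (rule bounded_schur_zero)
      moreover have "bounded_tableaux n (c + 1) \<alpha> \<eta> M = bounded_tableaux n c \<alpha> \<eta> M" for M
      proof (rule bounded_tableaux_Suc_eq)
        fix r j assume *: "part \<alpha> r = Suc j" "part \<alpha> (Suc r) \<le> j" "int j - int r = c"
        have "r = \<rho>"
          using * d d' part_mono[of r \<rho> \<alpha>] part_mono[of \<rho> r \<alpha>]
          by (cases r \<rho> rule: linorder_cases) auto
        then show "(r, j) \<notin> skew_cells \<alpha> \<eta>" using * d False by (simp add: skew_cells_def)
      qed
      ultimately show ?thesis by (simp add: bounded_schur_def)
    qed
  qed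
qed

text \<open>A particle hopping from i + 1 to i removes a corner of content i + 1 - card A, so each
  stage admits the entry n on one more diagonal. If there is such a corner,
  \<open>bounded_schur_corner\<close> matches the row operation; if not, both sides stay as they
  are.\<close>

lemma bounded_schur_stage:
  assumes base: "\<And>A B. finite A \<Longrightarrow> finite B \<Longrightarrow> card A = card B \<Longrightarrow>
      bounded_schur n (1 - int (card A)) (pt A) (pt B) = (minor (stage_matrix n 0) A B :: 'a::comm_ring_1 mps)"
    and "finite A" "finite B" "card A = card B"
  shows "bounded_schur n (int i - int (card A) + 1) (pt A) (pt B) = (minor (stage_matrix n i) A B :: 'a mps)"
  using assms(2-)
proof (induction i arbitrary: A)
  case 0
  then show ?case using base[of A B] by (simp add: algebra_simps)
next
  case (Suc i)
  let ?N = "card A"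
  let ?c = "int i - int ?N + 1"
  have c: "int (Suc i) - int ?N + 1 = ?c + 1" by simp
  have row_op: "minor (stage_matrix n (Suc i)) A B = minor (stage_matrix n i) A B +
     (if Suc i \<in> A \<and> i \<notin> A then var n * minor (stage_matrix n i) (insert i (A - {Suc i})) B else 0 :: 'a mps)"
    using minor_row_operation[OF Suc.prems(1,2), of i "stage_matrix n i" "var n"]
    by (simp only: stage_matrix_Suc[abs_def])
  show ?case
  proof (cases "Suc i \<in> A \<and> i \<notin> A")
    case True
    then obtain \<rho> where \<rho>: "\<rho> < ?N" "beta ?N (pt A) \<rho> = Suc i" "part (pt A) (Suc \<rho>) < part (pt A) \<rho>"
      using corner_iff[OF Suc.prems(1) refl, of i] by blast
    let ?A = "insert i (A - {Suc i})"
    have cA: "card ?A = ?N" using True Suc.prems(1) card.remove[of A "Suc i"] by simp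
    have "?c = int (part (pt A) \<rho>) - 1 - int \<rho>" using \<rho> by (simp add: beta_def)
    then have "bounded_schur n (?c + 1) (pt A) (pt B) =
       (bounded_schur n ?c (pt A) (pt B) + var n * bounded_schur n ?c (pt ?A) (pt B) :: 'a mps)"
      by (rule bounded_schur_corner[OF \<rho>(3) pt_hop[OF Suc.prems(1) refl \<rho>]])
    then show ?thesis using Suc.IH[of A] Suc.IH[of ?A] Suc.prems cA True unfolding c row_op by simp
  next
    case False
    have "bounded_schur n (?c + 1) (pt A) (pt B) = (bounded_schur n ?c (pt A) (pt B) :: 'a mps)"
    proof (rule bounded_schur_no_corner)
      fix r assume r: "part (pt A) (Suc r) < part (pt A) r"
      show "int (part (pt A) r) - 1 - int r \<noteq> ?c"
      proof
        assume eq: "int (part (pt A) r) - 1 - int r = ?c"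
        have "r < ?N" using r part_zero_mono[OF pset_pt(2)[OF Suc.prems(1)], of r] by (simp add: not_le[symmetric]) (metis leI)
        moreover from this have "beta ?N (pt A) r = Suc i" using eq by (simp add: beta_def)
        ultimately show False using False r corner_iff[OF Suc.prems(1) refl, of i] by blast
      qed
    qed
    then show ?thesis using Suc.IH[of A] Suc.prems unfolding c row_op if_not_P[OF False] by simp
  qed
qed

lemma row_less_card:
  assumes "finite A" "(i, j) \<in> skew_cells (pt A) \<eta>"
  shows "i < card A"
proof (rule ccontr)
  assume "\<not> i < card A"
  then have "part (pt A) i = 0" using part_zero_mono[OF pset_pt(2)[OF assms(1)]] by simp
  then show False using assms(2) by (simp add: skew_cells_def)
qed

text \<open>The cells lie in the first card A rows, so their contents are at least 1 - card A. At
  this bound only entries below n are allowed, and for n = 0 only the empty tableau remains. One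
  step in n runs through the stages i.\<close>

lemma bounded_schur_minor:
  "finite A \<Longrightarrow> finite B \<Longrightarrow> card A = card B \<Longrightarrow>
     bounded_schur n (1 - int (card A)) (pt A) (pt B) = (minor (stage_matrix n 0) A B :: 'a::comm_ring_1 mps)"
proof (induction n arbitrary: A B)
  case 0
  have "minor (stage_matrix 0 0) A B = minor (\<lambda>r s. if r = s then 1 else 0 :: 'a mps) A B"
  proof (rule minor_cong[OF 0(1,2)])
    fix r s :: nat
    have "truncate 0 (complete_hom (Suc k)) = (0 :: 'a mps)" for k
      by (rule mps_eqI) (auto simp: mps_nth_truncate complete_hom_def)
    then show "stage_matrix 0 0 r s = (if r = s then 1 else 0 :: 'a mps)"
      by (cases "r - s") (auto simp: stage_matrix_def)
  qed
  also have "\<dots> = (if A = B then 1 else 0)" by (rule minor_identity[OF 0(1,2)])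
  also have "\<dots> = bounded_schur 0 (1 - int (card A)) (pt A) (pt B)"
  proof (cases "\<forall>i. part (pt B) i \<le> part (pt A) i")
    case False
    then obtain i where "\<not> part (pt B) i \<le> part (pt A) i" by blast
    moreover from this have "A \<noteq> B" by auto
    ultimately show ?thesis by (simp add: bounded_schur_zero)
  next
    case sub: True
    have tab: "bounded_tableaux 0 (1 - int (card A)) (pt A) (pt B) M =
       {T \<in> ssyt (pt A) (pt B). skew_cells (pt A) (pt B) = {} \<and> M = {#}}" for M
    proof -
      have "\<not> int j - int i < 1 - int (card A)" if "(i, j) \<in> skew_cells (pt A) (pt B)" for i j
        using row_less_card[OF 0(1) that] by simp
      then show ?thesis
        by (cases "skew_cells (pt A) (pt B) = {}") (auto simp: bounded_tableaux_def)
    qed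
    have eq: "skew_cells (pt A) (pt B) = {} \<longleftrightarrow> A = B"
    proof
      assume "skew_cells (pt A) (pt B) = {}"
      then have "\<not> part (pt B) i < part (pt A) i" for i by (auto simp: skew_cells_def)
      then have "pt A = pt B" using sub by (intro partition_eqI) (simp add: le_antisym not_less)
      then show "A = B" using pset_pt(1)[OF 0(1)] pset_pt(1)[OF 0(2)] 0(3) by metis
    qed (auto simp: skew_cells_def)
    have "card (bounded_tableaux 0 (1 - int (card A)) (pt A) (pt B) M) = (if A = B \<and> M = {#} then 1 else 0)" for M
    proof (cases "A = B \<and> M = {#}")
      case True
      then have "skew_cells (pt A) (pt B) = {}" using eq by simp
      then have "bounded_tableaux 0 (1 - int (card A)) (pt A) (pt B) M = {\<lambda>_. undefined}"
        unfolding tab using True by (auto simp: ssyt_def)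
      then show ?thesis using True by simp
    next
      case False
      then have "{T \<in> ssyt (pt A) (pt B). A = B \<and> M = {#}} = {}" by blast
      then show ?thesis unfolding tab eq using False by (simp only: card.empty if_False)
    qed
    then show ?thesis using sub by (intro mps_eqI) (simp add: bounded_schur_def mps_nth_one)
  qed
  finally show ?case by simp
next
  case (Suc n)
  \<comment> \<open>At the stage of the top position every row of A uses x_n and every content is
    below the bound, so the entry n has become free everywhere.\<close>
  let ?i = "Max (insert 0 A)"
  have le: "a \<le> ?i" if "a \<in> A" for a using that Suc.prems by (intro Max_ge) auto
  have "bounded_tableaux (Suc n) (1 - int (card A)) (pt A) (pt B) M =
      bounded_tableaux n (int ?i - int (card A) + 1) (pt A) (pt B) M" for M
  proof -
    have 1: "\<not> int j - int i < 1 - int (card A)" "int j - int i < int ?i - int (card A) + 1"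
      if "(i, j) \<in> skew_cells (pt A) (pt B)" for i j
    proof -
      have i: "i < card A" by (rule row_less_card[OF Suc.prems(1) that])
      then show "\<not> int j - int i < 1 - int (card A)" by simp
      have "beta (card A) (pt A) i \<in> A" using i pset_pt(1)[OF Suc.prems(1)] unfolding pset_def by blast
      then have "part (pt A) i + (card A - Suc i) \<le> ?i" unfolding beta_def by (rule le)
      moreover have "j < part (pt A) i" using that by (simp add: skew_cells_def)
      ultimately show "int j - int i < int ?i - int (card A) + 1"
        using i by linarith
    qed
    have "T (i, j) < Suc n \<or> T (i, j) = Suc n \<and> int j - int i < 1 - int (card A) \<longleftrightarrow>
        T (i, j) < n \<or> T (i, j) = n \<and> int j - int i < int ?i - int (card A) + 1"
      if "(i, j) \<in> skew_cells (pt A) (pt B)" for T :: "nat \<times> nat \<Rightarrow> nat" and i j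
      using 1[OF that] by (simp only: less_Suc_eq) simp
    then show ?thesis unfolding bounded_tableaux_def by auto
  qed
  then have "bounded_schur (Suc n) (1 - int (card A)) (pt A) (pt B) =
      (bounded_schur n (int ?i - int (card A) + 1) (pt A) (pt B) :: 'a mps)"
    by (simp add: bounded_schur_def)
  also have "\<dots> = minor (stage_matrix n ?i) A B"
    by (rule bounded_schur_stage[OF _ Suc.prems]) (rule Suc.IH)
  also have "\<dots> = minor (stage_matrix (Suc n) 0) A B"
    using Suc.prems le by (intro minor_cong) (auto simp: stage_matrix_def)
  finally show ?case .
qed

definition schur_matrix :: "nat \<Rightarrow> nat \<Rightarrow> 'a::comm_ring_1 mps" where
  "schur_matrix r s = (if s \<le> r then complete_hom (r - s) else 0)"

text \<open>A monomial involves finitely many variables, so it suffices to compare truncations;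
  truncating to n variables means bounding the entries by n.\<close>

theorem skew_schur_eq_minor:
  assumes "finite A" "finite B" "card A = card B"
  shows "skew_schur (pt A) (pt B) = (minor schur_matrix A B :: 'a::comm_ring_1 mps)"
proof (rule truncate_eqI)
  fix n
  have tab: "{T \<in> ssyt (pt A) (pt B). image_mset T (mset_set (skew_cells (pt A) (pt B))) = M} =
     bounded_tableaux n (1 - int (card A)) (pt A) (pt B) M" if "set_mset M \<subseteq> {..<n}" for M
  proof -
    have "T (i, j) < n" if T: "image_mset T (mset_set (skew_cells (pt A) (pt B))) = M"
      and ij: "(i, j) \<in> skew_cells (pt A) (pt B)" for T i j
    proof -
      have "T (i, j) \<in># M" using ij T[symmetric] by (simp add: finite_skew_cells)
      then show ?thesis using \<open>set_mset M \<subseteq> {..<n}\<close> by auto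
    qed
    then show ?thesis unfolding bounded_tableaux_def by blast
  qed
  have tab': "bounded_tableaux n (1 - int (card A)) (pt A) (pt B) M = {}" if "\<not> set_mset M \<subseteq> {..<n}" for M
  proof -
    have "set_mset M \<subseteq> {..<n}" if T: "T \<in> bounded_tableaux n (1 - int (card A)) (pt A) (pt B) M" for T
    proof
      fix x assume "x \<in># M"
      then have "x \<in># image_mset T (mset_set (skew_cells (pt A) (pt B)))"
        using T by (simp add: bounded_tableaux_def)
      then obtain i j where ij: "(i, j) \<in> skew_cells (pt A) (pt B)" "x = T (i, j)"
        by (auto simp: finite_skew_cells)
      have "\<not> int j - int i < 1 - int (card A)" using row_less_card[OF assms(1) ij(1)] by simp
      then show "x \<in> {..<n}" using T ij by (auto simp: bounded_tableaux_def)
    qed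
    then show ?thesis using that by blast
  qed
  have "truncate n (skew_schur (pt A) (pt B)) = (bounded_schur n (1 - int (card A)) (pt A) (pt B) :: 'a mps)"
    by (rule mps_eqI) (auto simp: mps_nth_truncate skew_schur_def bounded_schur_def tab tab')
  also have "\<dots> = minor (stage_matrix n 0) A B" by (rule bounded_schur_minor[OF assms])
  also have "\<dots> = minor (\<lambda>r s. truncate n (schur_matrix r s)) A B"
  proof (rule minor_cong[OF assms(1,2)])
    fix r s :: nat
    have "truncate n 0 = (0 :: 'a mps)" by (rule mps_eqI) (simp add: mps_nth_truncate)
    then show "stage_matrix n 0 r s = (truncate n (schur_matrix r s) :: 'a mps)"
      by (auto simp: stage_matrix_def schur_matrix_def)
  qed
  also have "\<dots> = truncate n (minor schur_matrix A B)" by (rule truncate_minor[OF assms(1,2), symmetric])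
  finally show "truncate n (skew_schur (pt A) (pt B)) = truncate n (minor schur_matrix A B :: 'a mps)" .
qed

section \<open>Symmetric functions and the specialization\<close>

lemma sym_zero: "0 \<in> sym_functions"
  by (simp add: sym_functions_def)

lemma sym_one: "1 \<in> sym_functions"
  by (auto simp: sym_functions_def mps_nth_one)

lemma sym_uminus: "f \<in> sym_functions \<Longrightarrow> - f \<in> sym_functions"
  by (simp add: sym_functions_def)

lemma sym_add:
  assumes "f \<in> sym_functions" "g \<in> sym_functions"
  shows "f + g \<in> sym_functions"
proof -
  obtain d e where "\<And>M. d < size M \<Longrightarrow> mps_nth f M = 0" "\<And>M. e < size M \<Longrightarrow> mps_nth g M = 0"
    using assms unfolding sym_functions_def by blast
  then have "\<forall>M. max d e < size M \<longrightarrow> mps_nth (f + g) M = 0" by simp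
  then have "\<exists>d. \<forall>M. d < size M \<longrightarrow> mps_nth (f + g) M = 0" by blast
  moreover have "\<forall>\<pi>. bij \<pi> \<longrightarrow> (\<forall>M. mps_nth (f + g) (image_mset \<pi> M) = mps_nth (f + g) M)"
    using assms by (simp add: sym_functions_def)
  ultimately show ?thesis unfolding sym_functions_def by blast
qed

lemma mset_splits_image:
  assumes "bij \<pi>"
  shows "bij_betw (\<lambda>(A, B). (image_mset \<pi> A, image_mset \<pi> B)) (mset_splits M) (mset_splits (image_mset \<pi> M))"
proof (rule bij_betw_byWitness[where f' = "\<lambda>(A, B). (image_mset (inv \<pi>) A, image_mset (inv \<pi>) B)"])
  have 1: "image_mset (inv \<pi>) (image_mset \<pi> A) = A" for A
    using assms by (simp add: multiset.map_comp comp_def bij_is_inj)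
  have 2: "image_mset \<pi> (image_mset (inv \<pi>) A) = A" for A
    using assms by (simp add: multiset.map_comp comp_def bij_is_surj surj_f_inv_f)
  show "\<forall>p\<in>mset_splits M. (\<lambda>(A, B). (image_mset (inv \<pi>) A, image_mset (inv \<pi>) B))
      ((\<lambda>(A, B). (image_mset \<pi> A, image_mset \<pi> B)) p) = p"
    by (auto simp: 1)
  show "\<forall>p\<in>mset_splits (image_mset \<pi> M). (\<lambda>(A, B). (image_mset \<pi> A, image_mset \<pi> B))
      ((\<lambda>(A, B). (image_mset (inv \<pi>) A, image_mset (inv \<pi>) B)) p) = p"
    by (auto simp: 2)
  show "(\<lambda>(A, B). (image_mset \<pi> A, image_mset \<pi> B)) ` mset_splits M \<subseteq> mset_splits (image_mset \<pi> M)"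
    by (auto simp: mset_splits_def)
  show "(\<lambda>(A, B). (image_mset (inv \<pi>) A, image_mset (inv \<pi>) B)) ` mset_splits (image_mset \<pi> M) \<subseteq> mset_splits M"
    by (auto simp: mset_splits_def image_mset_union[symmetric] 1 simp del: image_mset_union)
qed

lemma sym_mult:
  assumes f: "f \<in> sym_functions" and g: "g \<in> sym_functions"
  shows "f * g \<in> sym_functions"
proof -
  obtain d e where de: "\<And>M. d < size M \<Longrightarrow> mps_nth f M = 0" "\<And>M. e < size M \<Longrightarrow> mps_nth g M = 0"
    using assms unfolding sym_functions_def by blast
  have "mps_nth (f * g) (image_mset \<pi> M) = mps_nth (f * g) M" if \<pi>: "bij \<pi>" for \<pi> M
  proof -
    have "mps_nth (f * g) (image_mset \<pi> M) =
      (\<Sum>(A, B)\<in>mset_splits M. mps_nth f (image_mset \<pi> A) * mps_nth g (image_mset \<pi> B))"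
      unfolding mps_nth_mult
      by (subst sum.reindex_bij_betw[OF mset_splits_image[OF \<pi>], symmetric]) (simp add: case_prod_unfold)
    also have "\<dots> = mps_nth (f * g) M"
      using f g \<pi> unfolding mps_nth_mult by (intro sum.cong) (auto simp: sym_functions_def)
    finally show ?thesis .
  qed
  moreover have "mps_nth (f * g) M = 0" if "d + e < size M" for M
    unfolding mps_nth_mult
  proof (intro sum.neutral ballI)
    fix p assume "p \<in> mset_splits M"
    then have "d < size (fst p) \<or> e < size (snd p)" using that by (auto simp: mset_splits_def)
    then show "(case p of (A, B) \<Rightarrow> mps_nth f A * mps_nth g B) = 0"
      using de by (auto simp: case_prod_unfold)
  qed
  ultimately show ?thesis unfolding sym_functions_def by blast
qed

lemma sym_complete_hom: "complete_hom k \<in> sym_functions"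
  by (auto simp: sym_functions_def complete_hom_def)

lemma sym_schur_matrix: "schur_matrix r s \<in> sym_functions"
  by (simp add: schur_matrix_def sym_zero sym_complete_hom)

lemma qrho_one:
  assumes "qrho_specialization u \<phi>"
  shows "\<phi> 1 = 1"
proof -
  have "mps_const 1 = (1 :: 'a mps)" by (rule mps_eqI) (simp add: mps_const_def mps_nth_one)
  then show ?thesis using assms unfolding qrho_specialization_def by metis
qed

lemma qrho_zero:
  assumes "qrho_specialization u \<phi>"
  shows "\<phi> 0 = 0"
proof -
  have "mps_const 0 = (0 :: 'a mps)" by (rule mps_eqI) (simp add: mps_const_def)
  then show ?thesis using assms unfolding qrho_specialization_def by metis
qed

text \<open>The Jacobi--Trudi minor is a polynomial in the complete homogeneous functions and stays
  in \<open>sym_functions\<close>, where \<phi> is multiplicative.\<close>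

lemma specialized_skew_schur:
  assumes \<phi>: "qrho_specialization u \<phi>" and "finite A" "finite B" "card A = card B"
  shows "\<phi> (skew_schur (pt A) (pt B)) = minor (\<lambda>r s. \<phi> (schur_matrix r s)) A B"
proof -
  have "\<phi> (minor schur_matrix A B) = minor (\<lambda>r s. \<phi> (schur_matrix r s)) A B"
    using hom_minor[of sym_functions \<phi> A B schur_matrix] \<phi> assms(2,3)
    by (simp add: sym_zero sym_one sym_uminus sym_add sym_mult sym_schur_matrix qrho_one[OF \<phi>]
        qrho_specialization_def)
  then show ?thesis by (simp only: skew_schur_eq_minor[OF assms(2-)])
qed

section \<open>Operations preserving the Pluecker relations\<close>

lemma plucker_cong:
  assumes "plucker L v" "\<And>A. A \<subseteq> {..<L} \<Longrightarrow> v A = w A"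
  shows "plucker L w"
  unfolding plucker_def
proof (intro allI impI)
  fix S S' assume S: "S \<subseteq> {..<L}" "S' \<subseteq> {..<L}"
  have "(\<Sum>r\<in>S - S'. sg S r * sg S' r * w (S - {r}) * w (insert r S')) =
    (\<Sum>r\<in>S - S'. sg S r * sg S' r * v (S - {r}) * v (insert r S'))"
  proof (intro sum.cong refl)
    fix r assume "r \<in> S - S'"
    then have "v (S - {r}) = w (S - {r})" "v (insert r S') = w (insert r S')" using S by (auto intro!: assms(2))
    then show "sg S r * sg S' r * w (S - {r}) * w (insert r S') = sg S r * sg S' r * v (S - {r}) * v (insert r S')"
      by simp
  qed
  then show "(\<Sum>r\<in>S - S'. sg S r * sg S' r * w (S - {r}) * w (insert r S')) = 0"
    using assms(1) S unfolding plucker_def by auto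
qed

text \<open>The two states of a term have equally many particles, so if both were the vacuum they
  would be the same set; but only one of them contains r.\<close>

lemma plucker_part_vacuum: "plucker_part (\<lambda>\<mu>. if \<mu> = empty_partition then 1 else 0)"
  unfolding plucker_part_def
proof (intro allI impI sum.neutral ballI)
  fix S S' :: "nat set" and r
  assume fin: "finite S" "finite S'" and card: "card S = card S' + 2" and r: "r \<in> S - S'"
  have empty: "pt A = empty_partition \<longleftrightarrow> A = {..<card A}" if "finite A" for A
    using pset_pt(1)[OF that] pset_empty_partition[of "card A"] pt_lessThan by metis
  have "card (S - {r}) = card (insert r S')" using fin card r by simp
  then have "\<not> (pt (S - {r}) = empty_partition \<and> pt (insert r S') = empty_partition)"
    using r fin empty[of "S - {r}"] empty[of "insert r S'"] by auto
  then show "sg S r * sg S' r * (if pt (S - {r}) = empty_partition then 1 else 0) *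
      (if pt (insert r S') = empty_partition then 1 else 0) = 0" by auto
qed

section \<open>Partitions fitting into a window\<close>

lemma bij_betw_pset:
  "bij_betw (pset N) {\<mu>. part \<mu> N = 0 \<and> part \<mu> 0 + N \<le> L} {A. A \<subseteq> {..<L} \<and> card A = N}"
proof (rule bij_betw_byWitness[where f' = pt])
  have fin: "finite A" if "A \<subseteq> {..<L}" for A using that finite_subset by blast
  show "\<forall>A\<in>{A. A \<subseteq> {..<L} \<and> card A = N}. pset N (pt A) = A"
    using pset_pt(1)[OF fin] by auto
  show "pset N ` {\<mu>. part \<mu> N = 0 \<and> part \<mu> 0 + N \<le> L} \<subseteq> {A. A \<subseteq> {..<L} \<and> card A = N}"
    using pset_subset by fastforce
  show "pt ` {A. A \<subseteq> {..<L} \<and> card A = N} \<subseteq> {\<mu>. part \<mu> N = 0 \<and> part \<mu> 0 + N \<le> L}"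
    using pset_pt(2)[OF fin] pt_bound by auto
qed (simp add: pt_pset)

lemma finite_bounded_partitions: "finite {\<mu>. part \<mu> N = 0 \<and> part \<mu> 0 + N \<le> L}"
proof -
  have "finite {A. A \<subseteq> {..<L} \<and> card A = N}" by (rule finite_subset[of _ "Pow {..<L}"]) auto
  then show ?thesis using bij_betw_finite[OF bij_betw_pset] by blast
qed

lemma sum_Pow_pset:
  fixes f :: "nat set \<Rightarrow> 'a::comm_monoid_add"
  assumes "\<And>A. A \<subseteq> {..<L} \<Longrightarrow> card A \<noteq> N \<Longrightarrow> f A = 0"
  shows "(\<Sum>A\<in>Pow {..<L}. f A) = (\<Sum>\<mu> | part \<mu> N = 0 \<and> part \<mu> 0 + N \<le> L. f (pset N \<mu>))"
proof -
  have "(\<Sum>A\<in>Pow {..<L}. f A) = (\<Sum>A | A \<subseteq> {..<L} \<and> card A = N. f A)"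
    using assms by (intro sum.mono_neutral_right) auto
  then show ?thesis by (simp add: sum.reindex_bij_betw[OF bij_betw_pset])
qed

definition contained :: "partition \<Rightarrow> partition \<Rightarrow> bool" where
  "contained \<eta> \<mu> \<longleftrightarrow> (\<forall>i. part \<eta> i \<le> part \<mu> i)"

lemma contained_bounded:
  assumes "finite A" "A \<subseteq> {..<L}"
  shows "{\<eta>. contained \<eta> (pt A)} \<subseteq> {\<mu>. part \<mu> (card A) = 0 \<and> part \<mu> 0 + card A \<le> L}"
proof (clarsimp simp: contained_def)
  fix \<eta> assume *: "\<forall>i. part \<eta> i \<le> part (pt A) i"
  then show "part \<eta> (card A) = 0 \<and> part \<eta> 0 + card A \<le> L"
    using pset_pt(2)[OF assms(1)] pt_bound[OF assms(2)]
    by (metis add_le_mono1 le_zero_eq order_trans)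
qed

lemma finite_contained: "finite {\<eta>. contained \<eta> \<mu>}"
proof -
  define A where "A = pset (psize \<mu>) \<mu>"
  have "part \<mu> (psize \<mu>) = 0" using psize_bounds(1) by simp
  then have A: "pt A = \<mu>" "finite A" unfolding A_def by (simp_all add: pt_pset)
  have "A \<subseteq> {..<Suc (Max (insert 0 A))}"
    using A(2) Max_ge[of "insert 0 A"] by (auto simp: less_Suc_eq_le)
  then show ?thesis using contained_bounded[OF A(2)] A(1) finite_bounded_partitions finite_subset by metis
qed

text \<open>As p is triangular for containment, every \<eta> contributing at A fits into the window
  of A, so the sum is the action of H treated in \<open>plucker_minor\<close>.\<close>

lemma plucker_part_skew:
  fixes p :: "partition \<Rightarrow> partition \<Rightarrow> 'a::comm_ring_1"
  assumes c: "plucker_part c"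
    and p: "\<And>A B. finite A \<Longrightarrow> finite B \<Longrightarrow> card A = card B \<Longrightarrow> p (pt A) (pt B) = minor H A B"
    and p0: "\<And>\<mu> \<eta>. \<not> contained \<eta> \<mu> \<Longrightarrow> p \<mu> \<eta> = 0"
  shows "plucker_part (\<lambda>\<mu>. \<Sum>\<eta> | contained \<eta> \<mu>. p \<mu> \<eta> * c \<eta>)"
  unfolding plucker_part_iff
proof (intro allI)
  fix L N
  have "plucker L (\<lambda>A. \<Sum>B\<in>Pow {..<L}. minor H A B * on_sets N c B)"
    using c unfolding plucker_part_iff by (intro plucker_minor) blast
  then show "plucker L (on_sets N (\<lambda>\<mu>. \<Sum>\<eta> | contained \<eta> \<mu>. p \<mu> \<eta> * c \<eta>))"
  proof (rule plucker_cong)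
    fix A assume A: "A \<subseteq> {..<L}"
    then have finA: "finite A" using finite_subset by blast
    have "(\<Sum>B\<in>Pow {..<L}. minor H A B * on_sets N c B) =
      (\<Sum>\<eta> | part \<eta> N = 0 \<and> part \<eta> 0 + N \<le> L. minor H A (pset N \<eta>) * on_sets N c (pset N \<eta>))"
      by (rule sum_Pow_pset) (simp add: on_sets_def)
    also have "\<dots> = on_sets N (\<lambda>\<mu>. \<Sum>\<eta> | contained \<eta> \<mu>. p \<mu> \<eta> * c \<eta>) A"
    proof (cases "card A = N")
      case True
      have "(\<Sum>\<eta> | part \<eta> N = 0 \<and> part \<eta> 0 + N \<le> L. minor H A (pset N \<eta>) * on_sets N c (pset N \<eta>))
         = (\<Sum>\<eta> | part \<eta> N = 0 \<and> part \<eta> 0 + N \<le> L. p (pt A) \<eta> * c \<eta>)"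
      proof (intro sum.cong refl)
        fix \<eta> assume "\<eta> \<in> {\<eta>. part \<eta> N = 0 \<and> part \<eta> 0 + N \<le> L}"
        then have "pt (pset N \<eta>) = \<eta>" by (simp add: pt_pset)
        then show "minor H A (pset N \<eta>) * on_sets N c (pset N \<eta>) = p (pt A) \<eta> * c \<eta>"
          using p[OF finA, of "pset N \<eta>"] True by (simp add: on_sets_def)
      qed
      also have "\<dots> = (\<Sum>\<eta> | contained \<eta> (pt A). p (pt A) \<eta> * c \<eta>)"
        using contained_bounded[OF finA A] True p0
        by (intro sum.mono_neutral_right finite_bounded_partitions) auto
      finally show ?thesis using True by (simp add: on_sets_def)
    next
      case False
      then show ?thesis using finA by (simp add: on_sets_def minor_card)
    qed
    finally show "(\<Sum>B\<in>Pow {..<L}. minor H A B * on_sets N c B) =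
      on_sets N (\<lambda>\<mu>. \<Sum>\<eta> | contained \<eta> \<mu>. p \<mu> \<eta> * c \<eta>) A" .
  qed
qed

text \<open>Moving r from S to S' does not change the total occupation, so a weight that is
  multiplicative over positions gives all terms a common factor k.\<close>

lemma plucker_part_scale:
  fixes c :: "partition \<Rightarrow> 'a::comm_ring_1"
  assumes c: "plucker_part c"
    and w: "\<And>S S'. finite S \<Longrightarrow> finite S' \<Longrightarrow> card S = card S' + 2 \<Longrightarrow>
      \<exists>k. \<forall>r\<in>S - S'. w (pt (S - {r})) * w (pt (insert r S')) = k"
  shows "plucker_part (\<lambda>\<mu>. w \<mu> * c \<mu>)"
  unfolding plucker_part_def
proof (intro allI impI)
  fix S S' :: "nat set" assume fin: "finite S" "finite S'" "card S = card S' + 2"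
  obtain k where k: "\<forall>r\<in>S - S'. w (pt (S - {r})) * w (pt (insert r S')) = k" using w[OF fin] by blast
  have "(\<Sum>r\<in>S - S'. sg S r * sg S' r * (w (pt (S - {r})) * c (pt (S - {r}))) * (w (pt (insert r S')) * c (pt (insert r S')))) =
    (\<Sum>r\<in>S - S'. k * (sg S r * sg S' r * c (pt (S - {r})) * c (pt (insert r S'))))"
  proof (intro sum.cong refl)
    fix r assume "r \<in> S - S'"
    then have "k = w (pt (S - {r})) * w (pt (insert r S'))" using k by simp
    then show "sg S r * sg S' r * (w (pt (S - {r})) * c (pt (S - {r}))) * (w (pt (insert r S')) * c (pt (insert r S')))
      = k * (sg S r * sg S' r * c (pt (S - {r})) * c (pt (insert r S')))" by (simp only: mult_ac)
  qed
  also have "\<dots> = k * (\<Sum>r\<in>S - S'. sg S r * sg S' r * c (pt (S - {r})) * c (pt (insert r S')))"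
    by (simp add: sum_distrib_left)
  also have "\<dots> = 0" using c fin by (simp add: plucker_part_def)
  finally show "(\<Sum>r\<in>S - S'. sg S r * sg S' r * (w (pt (S - {r})) * c (pt (S - {r}))) *
     (w (pt (insert r S')) * c (pt (insert r S')))) = 0" .
qed

lemma plucker_part_psize:
  fixes x :: "'a::comm_ring_1"
  assumes "plucker_part c"
  shows "plucker_part (\<lambda>\<mu>. x ^ psize \<mu> * c \<mu>)"
proof (rule plucker_part_scale[OF assms])
  fix S S' :: "nat set" assume fin: "finite S" "finite S'" and card: "card S = card S' + 2"
  have "x ^ psize (pt (S - {r})) * x ^ psize (pt (insert r S')) =
     x ^ (\<Sum>S + \<Sum>S' - 2 * \<Sum>{..<Suc (card S')})" if r: "r \<in> S - S'" for r
  proof -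
    have "\<Sum>S = r + \<Sum>(S - {r})" using r fin sum.remove[of S r "\<lambda>x. x"] by simp
    moreover have "\<Sum>(insert r S') = r + \<Sum>S'" using r fin by simp
    moreover have "card (S - {r}) = Suc (card S')" "card (insert r S') = Suc (card S')" using r fin card by auto
    ultimately have "psize (pt (S - {r})) + psize (pt (insert r S')) = \<Sum>S + \<Sum>S' - 2 * \<Sum>{..<Suc (card S')}"
      using psize_pt[of "S - {r}"] psize_pt[of "insert r S'"] fin by simp
    then show ?thesis by (simp flip: power_add)
  qed
  then show "\<exists>k. \<forall>r\<in>S - S'. x ^ psize (pt (S - {r})) * x ^ psize (pt (insert r S')) = k" by blast
qed

lemma plucker_part_kappa:
  fixes u :: "'k::field_char_0"
  assumes "plucker_part c" "u \<noteq> 0"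
  shows "plucker_part (\<lambda>\<mu>. fps_const (u powi (b * kappa \<mu>)) * c \<mu>)"
proof (rule plucker_part_scale[OF assms(1)])
  fix S S' :: "nat set" assume fin: "finite S" "finite S'" and card: "card S = card S' + 2"
  define N where "N = Suc (card S')"
  define F where "F = (\<lambda>a. (int a - int N) * (int a - int N + 1))"
  have \<kappa>: "kappa (pt A) = sum F A - sum F {..<N}" if "finite A" "card A = N" for A
    using kappa_eq_sum[OF pset_pt(2)[OF that(1)]] pset_pt(1)[OF that(1)] that(2) by (simp add: F_def)
  have "fps_const (u powi (b * kappa (pt (S - {r})))) * fps_const (u powi (b * kappa (pt (insert r S')))) =
     fps_const (u powi (b * (sum F S + sum F S' - 2 * sum F {..<N})))" if r: "r \<in> S - S'" for r
  proof -
    have "sum F S = F r + sum F (S - {r})" using r fin sum.remove[of S r F] by simp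
    moreover have "sum F (insert r S') = F r + sum F S'" using r fin by simp
    moreover have "card (S - {r}) = N" "card (insert r S') = N" using r fin card by (auto simp: N_def)
    ultimately have "kappa (pt (S - {r})) + kappa (pt (insert r S')) = sum F S + sum F S' - 2 * sum F {..<N}"
      using \<kappa>[of "S - {r}"] \<kappa>[of "insert r S'"] fin by simp
    then have "b * (sum F S + sum F S' - 2 * sum F {..<N}) = b * kappa (pt (S - {r})) + b * kappa (pt (insert r S'))"
      by (simp add: distrib_left[symmetric])
    then show ?thesis using assms(2) by (simp add: power_int_add)
  qed
  then show "\<exists>k. \<forall>r\<in>S - S'. fps_const (u powi (b * kappa (pt (S - {r})))) *
      fps_const (u powi (b * kappa (pt (insert r S')))) = k" by blast
qed

text \<open>The elements of the flipped set above \<open>L - Suc r\<close> come from the holes below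
  r, and r is the number of holes and particles below r together. If r is itself in A, it adds to
  \<open>card A\<close> without being counted by \<open>sg A r\<close>; hence the extra
  sign.\<close>

lemma sg_flipc:
  assumes "A \<subseteq> {..<L}" "r < L"
  shows "sg (flipc L A) (L - Suc r) * (-1) ^ (r + card A) = (if r \<in> A then - sg A r else sg A r :: 'a::comm_ring_1)"
proof -
  have fin: "finite A" using assms finite_subset by blast
  have "{x \<in> flipc L A. L - Suc r < x} = (\<lambda>b. L - Suc b) ` ({..<r} - A)"
    using assms unfolding flipc_def by auto
  moreover have "inj_on (\<lambda>b. L - Suc b) ({..<r} - A)" using assms by (auto simp: inj_on_def)
  ultimately have 1: "card {x \<in> flipc L A. L - Suc r < x} = card ({..<r} - A)" by (simp add: card_image)
  have 2: "card ({..<r} - A) + card (A \<inter> {..<r}) = r"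
  proof -
    have "card ({..<r} - A \<union> A \<inter> {..<r}) = card ({..<r} - A) + card (A \<inter> {..<r})"
      by (rule card_Un_disjoint) auto
    moreover have "{..<r} - A \<union> A \<inter> {..<r} = {..<r}" by auto
    ultimately show ?thesis by simp
  qed
  have "card A = card (A \<inter> {..<r} \<union> {a \<in> A. r \<le> a})" by (rule arg_cong[where f = card]) auto
  also have "\<dots> = card (A \<inter> {..<r}) + card {a \<in> A. r \<le> a}" using fin by (intro card_Un_disjoint) auto
  also have "card {a \<in> A. r \<le> a} = (if r \<in> A then 1 else 0) + card {a \<in> A. r < a}"
  proof (cases "r \<in> A")
    case True
    then have "{a \<in> A. r \<le> a} = insert r {a \<in> A. r < a}" by auto
    then show ?thesis using True fin by simp
  next
    case False
    then have "{a \<in> A. r \<le> a} = {a \<in> A. r < a}" by (auto simp: le_less)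
    then show ?thesis using False by simp
  qed
  finally have 3: "card A = card (A \<inter> {..<r}) + ((if r \<in> A then 1 else 0) + card {a \<in> A. r < a})" .
  have "card ({..<r} - A) + (r + card A) = 2 * r + (if r \<in> A then 1 else 0) + card {a \<in> A. r < a}"
    using 2 3 by simp
  then have "(-1) ^ (card ({..<r} - A) + (r + card A)) = ((-1) ^ (2 * r + (if r \<in> A then 1 else 0) + card {a \<in> A. r < a}) :: 'a)"
    by (rule arg_cong)
  then show ?thesis by (simp add: sg_def 1 power_add split: if_splits)
qed

text \<open>In the flipped window, removing r becomes inserting \<open>L - Suc r\<close>, so S and
  S' change roles. The powers of -1 from \<open>sg_flipc\<close> cancel because
  \<open>card S\<close> and \<open>card S'\<close> have equal parity; one overall sign
  remains.\<close>

lemma plucker_part_conj: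
  fixes c :: "partition \<Rightarrow> 'a::comm_ring_1"
  assumes c: "plucker_part c"
  shows "plucker_part (\<lambda>\<mu>. c (conj_partition \<mu>))"
  unfolding plucker_part_def
proof (intro allI impI)
  fix S S' :: "nat set" assume fin: "finite S" "finite S'" and card: "card S = card S' + 2"
  define L where "L = Suc (Max (insert 0 (S \<union> S')))"
  have L: "S \<subseteq> {..<L}" "S' \<subseteq> {..<L}"
    using fin Max_ge[of "insert 0 (S \<union> S')"] by (auto simp: L_def less_Suc_eq_le)
  let ?T = "flipc L S'" and ?T' = "flipc L S"
  have card_flipc: "card (flipc L A) = L - card A" if "A \<subseteq> {..<L}" for A
  proof -
    have "inj_on (\<lambda>b. L - Suc b) ({..<L} - A)" by (auto simp: inj_on_def)
    moreover have "finite A" using that finite_subset by blast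
    ultimately show ?thesis using that by (simp add: flipc_def card_image card_Diff_subset)
  qed
  have le: "card S \<le> L" using card_mono[OF _ L(1)] by simp
  have fT: "finite ?T" "finite ?T'" using finite_subset[OF flipc_subset] by auto
  have flip_remove: "flipc L (insert r A) = flipc L A - {L - Suc r}" if "r < L" for A r
    using that unfolding flipc_def by auto
  have flip_insert: "flipc L (A - {r}) = insert (L - Suc r) (flipc L A)" if "r < L" for A r
    using that unfolding flipc_def by auto
  have mem: "L - Suc r \<in> flipc L A \<longleftrightarrow> r \<notin> A" if "r < L" for A r using flipc_mem[OF that] .
  have "(\<Sum>r\<in>S - S'. sg S r * sg S' r * c (conj_partition (pt (S - {r}))) * c (conj_partition (pt (insert r S'))))
     = (\<Sum>r\<in>S - S'. - (sg ?T (L - Suc r) * sg ?T' (L - Suc r) * c (pt (?T - {L - Suc r})) * c (pt (insert (L - Suc r) ?T'))))"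
  proof (intro sum.cong refl)
    fix r assume r: "r \<in> S - S'"
    then have rL: "r < L" using L by auto
    have "pt (?T - {L - Suc r}) = conj_partition (pt (insert r S'))"
      using pt_flipc[of "insert r S'" L] rL L by (simp add: flip_remove)
    moreover have "pt (insert (L - Suc r) ?T') = conj_partition (pt (S - {r}))"
      using pt_flipc[of "S - {r}" L] rL L by (simp add: flip_insert Diff_subset[THEN subset_trans])
    moreover have "sg S r * sg S' r = - (sg ?T (L - Suc r) * sg ?T' (L - Suc r) :: 'a)"
    proof -
      have "sg S r * sg S' r = - (sg ?T (L - Suc r) * (-1) ^ (r + card S') * (sg ?T' (L - Suc r) * (-1) ^ (r + card S)) :: 'a)"
        using sg_flipc[OF L(1) rL, where ?'a = 'a] sg_flipc[OF L(2) rL, where ?'a = 'a] r by (simp add: mult.commute)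
      also have "\<dots> = - (sg ?T (L - Suc r) * sg ?T' (L - Suc r) * ((-1) ^ (r + card S') * (-1) ^ (r + card S)))"
        by (simp only: mult_ac)
      also have "(-1) ^ (r + card S') * (-1) ^ (r + card S) = (1 :: 'a)"
      proof -
        have "even (r + card S' + (r + card S))" using card by simp
        then show ?thesis by (simp only: power_add[symmetric] power_minus1_even neg_one_even_power)
      qed
      finally show ?thesis by simp
    qed
    ultimately show "sg S r * sg S' r * c (conj_partition (pt (S - {r}))) * c (conj_partition (pt (insert r S'))) =
       - (sg ?T (L - Suc r) * sg ?T' (L - Suc r) * c (pt (?T - {L - Suc r})) * c (pt (insert (L - Suc r) ?T')))"
      by (simp add: mult_ac)
  qed
  also have "\<dots> = - (\<Sum>r\<in>S - S'. sg ?T (L - Suc r) * sg ?T' (L - Suc r) * c (pt (?T - {L - Suc r})) * c (pt (insert (L - Suc r) ?T')))"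
    by (simp add: sum_negf)
  also have "(\<Sum>r\<in>S - S'. sg ?T (L - Suc r) * sg ?T' (L - Suc r) * c (pt (?T - {L - Suc r})) * c (pt (insert (L - Suc r) ?T')))
    = (\<Sum>r\<in>?T - ?T'. sg ?T r * sg ?T' r * c (pt (?T - {r})) * c (pt (insert r ?T')))"
  proof (rule sum.reindex_bij_witness[of _ "\<lambda>r. L - Suc r" "\<lambda>r. L - Suc r"])
    fix x assume "x \<in> ?T - ?T'"
    then have x: "x < L" "x \<in> ?T" "x \<notin> ?T'" using flipc_subset by auto
    then have e: "L - Suc (L - Suc x) = x" by simp
    show "L - Suc (L - Suc x) = x" by (rule e)
    have "L - Suc x < L" using x by simp
    from mem[OF this] show "L - Suc x \<in> S - S'" using x e by auto
  next
    fix r assume "r \<in> S - S'"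
    then have "r < L" "r \<in> S" "r \<notin> S'" using L by auto
    then show "L - Suc (L - Suc r) = r" "L - Suc r \<in> ?T - ?T'" using mem by auto
  qed simp
  also have "\<dots> = 0"
    using c fT card_flipc[OF L(1)] card_flipc[OF L(2)] card le by (simp add: plucker_part_def)
  finally show "(\<Sum>r\<in>S - S'. sg S r * sg S' r * c (conj_partition (pt (S - {r}))) * c (conj_partition (pt (insert r S')))) = 0"
    by simp
qed

lemma plucker_part_fps_const:
  assumes "plucker_part c"
  shows "plucker_part (\<lambda>\<mu>. fps_const (c \<mu> :: 'k::comm_ring_1))"
  unfolding plucker_part_def
proof (intro allI impI)
  fix S S' :: "nat set" assume fin: "finite S" "finite S'" "card S = card S' + 2"
  have sg: "sg A r = fps_const (sg A r :: 'k)" for A r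
  proof -
    have "(-1) ^ n = fps_const ((-1) ^ n :: 'k)" for n
      by (induction n) (simp_all flip: fps_const_mult fps_const_neg)
    then show ?thesis by (simp add: sg_def)
  qed
  have sum: "(\<Sum>r\<in>A. fps_const (f r)) = fps_const (\<Sum>r\<in>A. f r :: 'k)" for A :: "nat set" and f
    by (induction A rule: infinite_finite_induct) (simp_all flip: fps_const_add)
  show "(\<Sum>r\<in>S - S'. sg S r * sg S' r * fps_const (c (pt (S - {r}))) * fps_const (c (pt (insert r S')))) = 0"
    using assms fin by (simp add: sg sum plucker_part_def)
qed

text \<open>The k added positions belong to both sets, so they are neither removed nor inserted, and
  they lie below all positions counted by the signs.\<close>

lemma plucker_sum_shift:
  fixes c :: "partition \<Rightarrow> 'a::comm_ring_1" and k :: nat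
  assumes fin: "finite S" "finite S'"
  defines "sh \<equiv> \<lambda>A. {..<k} \<union> (\<lambda>a. a + k) ` A"
  shows "(\<Sum>r\<in>sh S - sh S'. sg (sh S) r * sg (sh S') r * c (pt (sh S - {r})) * c (pt (insert r (sh S')))) =
     (\<Sum>r\<in>S - S'. sg S r * sg S' r * c (pt (S - {r})) * c (pt (insert r S')))"
proof (rule sum.reindex_bij_witness[of _ "\<lambda>r. r + k" "\<lambda>r. r - k"])
  have sgn: "sg (sh A) (r + k) = (sg A r :: 'a)" for A r
  proof -
    have "{a \<in> sh A. r + k < a} = (\<lambda>a. a + k) ` {a \<in> A. r < a}" by (auto simp: sh_def)
    then show ?thesis by (simp add: sg_def card_image)
  qed
  fix r assume r: "r \<in> sh S - sh S'"
  then have k: "k \<le> r" "r - k \<in> S" "r - k \<notin> S'" by (auto simp: sh_def)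
  then show "r - k + k = r" "r - k \<in> S - S'" by auto
  have "sh S - {r} = sh (S - {r - k})" "insert r (sh S') = sh (insert (r - k) S')"
    using k by (auto simp: sh_def image_iff)
  then have "pt (sh S - {r}) = pt (S - {r - k})" "pt (insert r (sh S')) = pt (insert (r - k) S')"
    using pt_shift[of "S - {r - k}" k] pt_shift[of "insert (r - k) S'" k] fin
    by (simp_all only: sh_def finite_Diff finite_insert)
  then show "sg S (r - k) * sg S' (r - k) * c (pt (S - {r - k})) * c (pt (insert (r - k) S')) =
    sg (sh S) r * sg (sh S') r * c (pt (sh S - {r})) * c (pt (insert r (sh S')))"
    using sgn[of _ "r - k"] k by simp
qed (auto simp: sh_def)

text \<open>
  The adjoint operator involves infinite sums over \<open>\<nu>\<close>; modulo \<open>Q^(D+1)\<close> only those \<open>\<nu>\<close> matter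
  which fit into a window, after the number of particles has been made large by a shift.
\<close>

lemma plucker_part_skew_adjoint:
  fixes x :: "partition \<Rightarrow> 'k::comm_ring_1" and p :: "partition \<Rightarrow> partition \<Rightarrow> 'k"
  assumes x: "plucker_part (\<lambda>\<nu>. fps_X ^ psize \<nu> * fps_const (x \<nu>))"
    and p: "\<And>A B. finite A \<Longrightarrow> finite B \<Longrightarrow> card A = card B \<Longrightarrow> p (pt A) (pt B) = minor H A B"
  shows "plucker_part (\<lambda>\<eta>. Abs_fps (\<lambda>d. \<Sum>\<nu> | psize \<nu> = d. p \<nu> \<eta> * x \<nu>))"
    (is "plucker_part ?c")
  unfolding plucker_part_def
proof (intro allI impI fps_ext)
  fix S0 S0' :: "nat set" and D :: nat
  assume fin0: "finite S0" "finite S0'" and card0: "card S0 = card S0' + 2"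
  let ?sh = "\<lambda>A. {..<D} \<union> (\<lambda>a. a + D) ` A"
  let ?S = "?sh S0" and ?S' = "?sh S0'"
  have card_sh: "card (?sh A) = D + card A" if "finite A" for A
    using that by (subst card_Un_disjoint) (auto simp: card_image)
  \<comment> \<open>After the shift by D, \<open>?S - {r}\<close> and \<open>insert r ?S'\<close>
    have N elements, and N \<ge> D leaves room for all parts of a partition of size at most
    D.\<close>
  define N where "N = D + Suc (card S0')"
  \<comment> \<open>The last summand leaves D positions above the first N, enough because no part of
    such a partition exceeds D.\<close>
  define L where "L = Suc (Max (insert 0 (?S \<union> ?S'))) + N + D"
  have le: "a < L" if "a \<in> ?S \<union> ?S'" for a
  proof -
    have "a \<le> Max (insert 0 (?S \<union> ?S'))" using that fin0 by (intro Max_ge) auto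
    then show ?thesis unfolding L_def by linarith
  qed
  then have L: "?S \<subseteq> {..<L}" "?S' \<subseteq> {..<L}" by blast+
  let ?w = "\<lambda>\<nu>. fps_X ^ psize \<nu> * fps_const (x \<nu>) :: 'k fps"
  \<comment> \<open>Transposed, because the sum now runs over the outer partition of the skew
    shape.\<close>
  let ?HT = "\<lambda>r s. fps_const (H s r)"
  let ?v = "\<lambda>B. \<Sum>A\<in>Pow {..<L}. minor ?HT B A * on_sets N ?w A"
  have v: "plucker L ?v" using x unfolding plucker_part_iff by (intro plucker_minor) blast
  have coeff: "?v B $ d = ?c (pt B) $ d" if B: "B \<subseteq> {..<L}" "card B = N" and d: "d \<le> D" for B d
  proof -
    have finB: "finite B" using B finite_subset by blast
    have mc: "minor ?HT B A = fps_const (minor H A B)" if "finite A" for A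
    proof -
      have "fps_const (minor H A B) = minor (\<lambda>r s. fps_const (H r s)) A B"
        using hom_minor[of UNIV fps_const A B H] that finB by simp
      then show ?thesis using minor_transpose[OF finB that, of "\<lambda>r s. fps_const (H r s)"] by simp
    qed
    have "?v B $ d = (\<Sum>A\<in>Pow {..<L}. (minor ?HT B A * on_sets N ?w A) $ d)"
      by (simp add: fps_sum_nth)
    also have "\<dots> = (\<Sum>\<nu> | part \<nu> N = 0 \<and> part \<nu> 0 + N \<le> L. (minor ?HT B (pset N \<nu>) * on_sets N ?w (pset N \<nu>)) $ d)"
      by (rule sum_Pow_pset) (simp add: on_sets_def)
    also have "\<dots> = (\<Sum>\<nu> | part \<nu> N = 0 \<and> part \<nu> 0 + N \<le> L. if psize \<nu> = d then p \<nu> (pt B) * x \<nu> else 0)"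
    proof (intro sum.cong refl)
      fix \<nu> assume "\<nu> \<in> {\<nu>. part \<nu> N = 0 \<and> part \<nu> 0 + N \<le> L}"
      then have pt: "pt (pset N \<nu>) = \<nu>" by (simp add: pt_pset)
      have "minor H (pset N \<nu>) B = p \<nu> (pt B)"
        using p[of "pset N \<nu>" B] finB B pt by simp
      then show "(minor ?HT B (pset N \<nu>) * on_sets N ?w (pset N \<nu>)) $ d = (if psize \<nu> = d then p \<nu> (pt B) * x \<nu> else 0)"
        by (simp add: mc on_sets_def pt fps_X_power_mult_nth fps_mult_left_const_nth)
    qed
    also have "\<dots> = (\<Sum>\<nu> | psize \<nu> = d. p \<nu> (pt B) * x \<nu>)"
    proof (rule sum.mono_neutral_cong_right[OF finite_bounded_partitions])
      show "{\<nu>. psize \<nu> = d} \<subseteq> {\<nu>. part \<nu> N = 0 \<and> part \<nu> 0 + N \<le> L}"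
      proof
        fix \<nu> assume "\<nu> \<in> {\<nu>. psize \<nu> = d}"
        then have "psize \<nu> \<le> D" using d by simp
        then have "part \<nu> D = 0" "part \<nu> 0 \<le> D" using psize_bounds by auto
        then show "\<nu> \<in> {\<nu>. part \<nu> N = 0 \<and> part \<nu> 0 + N \<le> L}"
          using part_zero_mono[of \<nu> D N] by (simp add: N_def L_def)
      qed
    qed auto
    finally show ?thesis by simp
  qed
  have "(\<Sum>r\<in>?S - ?S'. sg ?S r * sg ?S' r * ?c (pt (?S - {r})) * ?c (pt (insert r ?S'))) $ D =
    (\<Sum>r\<in>?S - ?S'. sg ?S r * sg ?S' r * ?v (?S - {r}) * ?v (insert r ?S')) $ D"
    unfolding fps_sum_nth
  proof (intro sum.cong refl)
    fix r assume r: "r \<in> ?S - ?S'"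
    have 1: "?S - {r} \<subseteq> {..<L}" "card (?S - {r}) = N"
      using r L card_sh[OF fin0(1)] card0 fin0 by (auto simp: N_def)
    have 2: "insert r ?S' \<subseteq> {..<L}" "card (insert r ?S') = N"
      using r L card_sh[OF fin0(2)] fin0 by (auto simp: N_def)
    \<comment> \<open>The coefficient D of a product involves only the coefficients up to D of its
      factors, where \<open>?c\<close> agrees with its window version \<open>?v\<close>.\<close>
    have "(?c (pt (?S - {r})) * ?c (pt (insert r ?S'))) $ d = (?v (?S - {r}) * ?v (insert r ?S')) $ d" if "d \<le> D" for d
      unfolding fps_mult_nth using that by (intro sum.cong refl arg_cong2[where f = "(*)"] coeff[symmetric] 1 2) auto
    then show "(sg ?S r * sg ?S' r * ?c (pt (?S - {r})) * ?c (pt (insert r ?S'))) $ D =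
       (sg ?S r * sg ?S' r * ?v (?S - {r}) * ?v (insert r ?S')) $ D"
      unfolding mult.assoc[of "sg ?S r * sg ?S' r"] fps_mult_nth[of "sg ?S r * sg ?S' r"]
      by (intro sum.cong refl) simp
  qed
  also have "\<dots> = 0" using v L unfolding plucker_def by simp
  finally have "(\<Sum>r\<in>?S - ?S'. sg ?S r * sg ?S' r * ?c (pt (?S - {r})) * ?c (pt (insert r ?S'))) $ D = 0" .
  then show "(\<Sum>r\<in>S0 - S0'. sg S0 r * sg S0' r * ?c (pt (S0 - {r})) * ?c (pt (insert r S0'))) $ D = 0 $ D"
    by (simp only: plucker_sum_shift[OF fin0, where c = ?c and k = D] fps_zero_nth)
qed

section \<open>The open invariants satisfy the Pluecker relations\<close>

lemma skew_schur_zero: "\<not> contained \<eta> \<mu> \<Longrightarrow> skew_schur \<mu> \<eta> = 0"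
  unfolding skew_schur_def contained_def by (rule if_not_P)

lemma skew_schur_refl: "skew_schur \<mu> \<mu> = 1"
proof (rule mps_eqI)
  fix M
  have e: "skew_cells \<mu> \<mu> = {}" by (auto simp: skew_cells_def)
  have "{T \<in> ssyt \<mu> \<mu>. image_mset T (mset_set (skew_cells \<mu> \<mu>)) = M} = (if M = {#} then {\<lambda>_. undefined} else {})"
    unfolding e ssyt_def by auto
  then show "mps_nth (skew_schur \<mu> \<mu>) M = mps_nth 1 M"
    by (simp add: skew_schur_def mps_nth_one)
qed

lemma contained_empty_iff: "contained \<eta> empty_partition \<longleftrightarrow> \<eta> = empty_partition"
  by (auto simp: contained_def intro: partition_eqI)

lemma psize_0_iff: "psize \<mu> = 0 \<longleftrightarrow> \<mu> = empty_partition"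
proof
  assume "psize \<mu> = 0"
  then have "psize \<mu> \<le> 0" by simp
  then show "\<mu> = empty_partition" using psize_bounds(2)[of \<mu> 0] by (intro partition_eqI) auto
qed (simp add: psize_def)

lemma closed_Z0_nth_0:
  assumes "qrho_specialization u \<phi>"
  shows "closed_Z0 \<phi> $ 0 = 1"
  using qrho_one[OF assms] by (simp add: closed_Z0_def psize_0_iff schur_def skew_schur_refl)

text \<open>The sums over \<nu> and \<eta> are interchanged, which exhibits the coefficient as a
  composition of operations preserving the relations. Z_0 has constant term 1, so dividing by it is
  multiplying by its inverse.\<close>

lemma open_coeff_alt:
  assumes \<phi>: "qrho_specialization u \<phi>"
  shows "open_coeff u \<phi> a \<mu> = inverse (closed_Z0 \<phi>) * (fps_const (u powi ((a + 1) * kappa \<mu>)) *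
    (\<Sum>\<eta> | contained \<eta> (conj_partition \<mu>). fps_const (\<phi> (skew_schur (conj_partition \<mu>) \<eta>)) *
       Abs_fps (\<lambda>d. \<Sum>\<nu> | psize \<nu> = d. \<phi> (skew_schur \<nu> \<eta>) * \<phi> (schur (conj_partition \<nu>)))))"
proof -
  let ?p = "\<lambda>\<mu> \<eta>. \<phi> (skew_schur \<mu> \<eta>)"
  let ?\<mu> = "conj_partition \<mu>"
  have C2: "vertex_C2 u \<phi> a \<mu> \<nu> = u powi ((a + 1) * kappa \<mu>) * (\<Sum>\<eta> | contained \<eta> ?\<mu>. ?p ?\<mu> \<eta> * ?p \<nu> \<eta>)" for \<nu>
  proof -
    have "Sum_any (\<lambda>\<eta>. ?p ?\<mu> \<eta> * ?p \<nu> \<eta>) = (\<Sum>\<eta> | contained \<eta> ?\<mu>. ?p ?\<mu> \<eta> * ?p \<nu> \<eta>)"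
      by (rule Sum_any.expand_superset[OF finite_contained])
         (auto simp: skew_schur_zero qrho_zero[OF \<phi>] intro: ccontr)
    then show ?thesis by (simp add: vertex_C2_def)
  qed
  have "Abs_fps (\<lambda>d. \<Sum>\<nu> | psize \<nu> = d. vertex_C2 u \<phi> a \<mu> \<nu> * vertex_C1 \<phi> (conj_partition \<nu>)) =
    fps_const (u powi ((a + 1) * kappa \<mu>)) * (\<Sum>\<eta> | contained \<eta> ?\<mu>. fps_const (?p ?\<mu> \<eta>) *
       Abs_fps (\<lambda>d. \<Sum>\<nu> | psize \<nu> = d. ?p \<nu> \<eta> * \<phi> (schur (conj_partition \<nu>))))"
  proof (rule fps_ext)
    fix d
    show "Abs_fps (\<lambda>d. \<Sum>\<nu> | psize \<nu> = d. vertex_C2 u \<phi> a \<mu> \<nu> * vertex_C1 \<phi> (conj_partition \<nu>)) $ d =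
     (fps_const (u powi ((a + 1) * kappa \<mu>)) * (\<Sum>\<eta> | contained \<eta> ?\<mu>. fps_const (?p ?\<mu> \<eta>) *
       Abs_fps (\<lambda>d. \<Sum>\<nu> | psize \<nu> = d. ?p \<nu> \<eta> * \<phi> (schur (conj_partition \<nu>))))) $ d"
      by (simp add: C2 vertex_C1_def fps_mult_left_const_nth fps_sum_nth sum_distrib_left sum_distrib_right mult_ac)
         (rule sum.swap)
  qed
  then show ?thesis
    unfolding open_coeff_def using closed_Z0_nth_0[OF \<phi>]
    by (simp add: fps_divide_unit mult_ac)
qed

theorem plucker_part_open_coeff:
  assumes "u \<noteq> 0" and \<phi>: "qrho_specialization u \<phi>"
  shows "plucker_part (open_coeff u \<phi> a)"
proof -
  let ?p = "\<lambda>\<mu> \<eta>. \<phi> (skew_schur \<mu> \<eta>)"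
  let ?H = "\<lambda>r s. \<phi> (schur_matrix r s)"
  note p = specialized_skew_schur[OF \<phi>]
  have p0: "?p \<mu> \<eta> = 0" if "\<not> contained \<eta> \<mu>" for \<mu> \<eta>
    by (simp add: skew_schur_zero[OF that] qrho_zero[OF \<phi>])
  have "plucker_part (\<lambda>\<mu>. \<Sum>\<eta> | contained \<eta> \<mu>. ?p \<mu> \<eta> * (if \<eta> = empty_partition then 1 else 0))"
    by (rule plucker_part_skew[OF plucker_part_vacuum p p0])
  moreover have "(\<Sum>\<eta> | contained \<eta> \<mu>. ?p \<mu> \<eta> * (if \<eta> = empty_partition then 1 else 0)) = \<phi> (schur \<mu>)" for \<mu>
  proof -
    have "(\<Sum>\<eta> | contained \<eta> \<mu>. ?p \<mu> \<eta> * (if \<eta> = empty_partition then 1 else 0)) =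
      (\<Sum>\<eta> | contained \<eta> \<mu>. if \<eta> = empty_partition then \<phi> (schur \<mu>) else 0)"
      by (intro sum.cong) (auto simp: schur_def)
    also have "\<dots> = \<phi> (schur \<mu>)" using finite_contained by (simp add: contained_def)
    finally show ?thesis .
  qed
  ultimately have "plucker_part (\<lambda>\<mu>. \<phi> (schur \<mu>))" by simp
  from plucker_part_psize[OF plucker_part_fps_const[OF plucker_part_conj[OF this]]]
  have "plucker_part (\<lambda>\<nu>. fps_X ^ psize \<nu> * fps_const (\<phi> (schur (conj_partition \<nu>))))" .
  from plucker_part_skew_adjoint[OF this p]
  have 3: "plucker_part (\<lambda>\<eta>. Abs_fps (\<lambda>d. \<Sum>\<nu> | psize \<nu> = d. ?p \<nu> \<eta> * \<phi> (schur (conj_partition \<nu>))))" .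
  have p': "fps_const (?p (pt A) (pt B)) = minor (\<lambda>r s. fps_const (?H r s)) A B"
    if "finite A" "finite B" "card A = card B" for A B
    using p[OF that] hom_minor[of UNIV fps_const A B ?H] that by simp
  have "plucker_part (\<lambda>\<mu>. \<Sum>\<eta> | contained \<eta> \<mu>. fps_const (?p \<mu> \<eta>) *
      Abs_fps (\<lambda>d. \<Sum>\<nu> | psize \<nu> = d. ?p \<nu> \<eta> * \<phi> (schur (conj_partition \<nu>))))"
    by (rule plucker_part_skew[OF 3 p']) (simp_all add: p0)
  from plucker_part_kappa[OF plucker_part_conj[OF this] assms(1), of "a + 1"]
  show ?thesis
    \<comment> \<open>The inverse of Z_0 is a weight independent of \<mu>, and the relations are
      homogeneous.\<close>
    unfolding open_coeff_alt[OF \<phi>, abs_def] by (rule plucker_part_scale) auto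
qed

text \<open>The empty \<mu> leaves only the empty \<eta>, and the sum over \<nu> becomes Z_0
  itself.\<close>

theorem open_coeff_empty:
  assumes \<phi>: "qrho_specialization u \<phi>"
  shows "open_coeff u \<phi> a empty_partition = 1"
proof -
  have "kappa empty_partition = 0" by (simp add: kappa_def)
  moreover have "Abs_fps (\<lambda>d. \<Sum>\<nu> | psize \<nu> = d. \<phi> (skew_schur \<nu> empty_partition) * \<phi> (schur (conj_partition \<nu>))) = closed_Z0 \<phi>"
    by (simp add: closed_Z0_def schur_def)
  ultimately show ?thesis
    using closed_Z0_nth_0[OF \<phi>] qrho_one[OF \<phi>]
    by (simp add: open_coeff_alt[OF \<phi>] contained_empty_iff skew_schur_refl inverse_mult_eq_1)
qed

section \<open>States satisfying the Pluecker relations are Bogoliubov transforms\<close>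

text \<open>Position a of A stands for the code a - N, and everything below the cutoff - N is
  occupied. Charge 0 corresponds to \<open>card A = N\<close>.\<close>

definition dirac_sea :: "nat \<Rightarrow> nat set \<Rightarrow> int set" where
  "dirac_sea N A = {..< - int N} \<union> (\<lambda>a. int a - int N) ` A"

lemma dirac_sea_mem: "int a - int N \<in> dirac_sea N A \<longleftrightarrow> a \<in> A"
  by (auto simp: dirac_sea_def)

lemma dirac_sea_inject: "dirac_sea N A = dirac_sea N B \<Longrightarrow> A = B"
  using dirac_sea_mem by blast

lemma dirac_sea_lessThan: "dirac_sea N {..<N} = {..<0}"
proof (intro equalityI subsetI)
  fix x :: int assume "x \<in> {..<0}"
  then show "x \<in> dirac_sea N {..<N}"
    by (cases "x < - int N") (auto simp: dirac_sea_def intro!: image_eqI[of _ _ "nat (x + int N)"])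
qed (auto simp: dirac_sea_def)

lemma maya_eq_dirac_sea:
  assumes "part \<mu> N = 0"
  shows "maya \<mu> = dirac_sea N (pset N \<mu>)"
proof -
  have 1: "int (part \<mu> i) - int i - 1 = int (beta N \<mu> i) - int N" if "i < N" for i
    using that by (simp add: beta_def of_nat_diff)
  have 2: "int (part \<mu> i) - int i - 1 = - int i - 1" if "N \<le> i" for i
    using part_zero_mono[OF assms that] by simp
  have "(UNIV :: nat set) = {..<N} \<union> {N..}" by auto
  then have "maya \<mu> = (\<lambda>i. int (part \<mu> i) - int i - 1) ` {..<N} \<union> (\<lambda>i. int (part \<mu> i) - int i - 1) ` {N..}"
    unfolding maya_def by (metis image_Un)
  also have "(\<lambda>i. int (part \<mu> i) - int i - 1) ` {..<N} = (\<lambda>a. int a - int N) ` pset N \<mu>"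
    unfolding pset_def image_image by (rule image_cong) (simp_all add: 1)
  also have "(\<lambda>i. int (part \<mu> i) - int i - 1) ` {N..} = (\<lambda>i. - int i - 1) ` {N..}"
    by (rule image_cong) (simp_all add: 2)
  also have "(\<lambda>i. - int i - 1) ` {N..} = {..< - int N}"
  proof (intro equalityI subsetI)
    fix x :: int assume "x \<in> {..< - int N}"
    then show "x \<in> (\<lambda>i. - int i - 1) ` {N..}" by (intro image_eqI[of _ _ "nat (- x - 1)"]) auto
  qed auto
  finally show ?thesis by (auto simp: dirac_sea_def)
qed

lemma maya_pt: "finite A \<Longrightarrow> maya (pt A) = dirac_sea (card A) A"
  using maya_eq_dirac_sea[OF pset_pt(2)] pset_pt(1) by simp

lemma part_zero_large: "\<exists>N\<ge>K. part \<mu> N = 0"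
  using part_zero_mono[of \<mu> "psize \<mu>" "max K (psize \<mu>)"] psize_bounds(1)[of \<mu> "psize \<mu>"]
  by (intro exI[of _ "max K (psize \<mu>)"]) auto

lemma maya_inject: "maya \<mu> = maya \<nu> \<longleftrightarrow> \<mu> = \<nu>"
proof
  assume eq: "maya \<mu> = maya \<nu>"
  obtain K where K: "part \<mu> K = 0" using part_zero_large by blast
  obtain N where N: "K \<le> N" "part \<nu> N = 0" using part_zero_large by blast
  then have "part \<mu> N = 0" using part_zero_mono[OF K] by simp
  then show "\<mu> = \<nu>"
    using N eq maya_eq_dirac_sea dirac_sea_inject pset_inject by metis
qed simp

lemma maya_large:
  assumes "B \<in> range maya"
  obtains N A where "K \<le> N" "finite A" "card A = N" "B = dirac_sea N A"
proof -
  obtain \<mu> where \<mu>: "B = maya \<mu>" using assms by blast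
  obtain N where N: "K \<le> N" "part \<mu> N = 0" using part_zero_large by blast
  show ?thesis by (rule that[OF N(1), of "pset N \<mu>"]) (use \<mu> N maya_eq_dirac_sea in auto)
qed

lemma maya_hop:
  assumes "B \<in> range maya" "x \<in> B" "y \<notin> B"
  shows "insert y (B - {x}) \<in> range maya"
proof -
  \<comment> \<open>The cutoff is taken below both x and y, so the hop takes place within the finite
    set A.\<close>
  obtain N A where N: "nat \<bar>x\<bar> + nat \<bar>y\<bar> \<le> N" "finite A" "card A = N" "B = dirac_sea N A"
    using maya_large[OF assms(1)] by metis
  define a b where "a = nat (x + int N)" and "b = nat (y + int N)"
  have ab: "x = int a - int N" "y = int b - int N" using N(1) by (auto simp: a_def b_def)
  then have mem: "a \<in> A" "b \<notin> A" using assms(2,3) N(4) dirac_sea_mem by auto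
  have "x \<notin> {..< - int N}" using ab by auto
  then have "insert y (B - {x}) = dirac_sea N (insert b (A - {a}))"
    unfolding N(4) ab dirac_sea_def by auto
  moreover have "card (insert b (A - {a})) = N"
  proof -
    have "card (insert b (A - {a})) = Suc (card (A - {a}))" using mem N(2) by simp
    then show ?thesis using card.remove[OF N(2) mem(1)] N(3) by simp
  qed
  ultimately show ?thesis using maya_pt[of "insert b (A - {a})"] N(2) by (metis finite_Diff finite_insert rangeI)
qed

lemma admissible_maya:
  assumes "B \<in> range maya"
  shows "admissible B"
proof -
  obtain N A where N: "0 \<le> N" "finite A" "card A = N" "B = dirac_sea N A" using maya_large[OF assms] by metis
  have "{r \<in> B. 0 \<le> r} \<subseteq> (\<lambda>a. int a - int N) ` A" unfolding N(4) dirac_sea_def by auto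
  moreover have "{r. r < 0 \<and> r \<notin> B} \<subseteq> {- int N..<0}" unfolding N(4) dirac_sea_def by auto
  ultimately show ?thesis using N(2) unfolding admissible_def by (meson finite_atLeastLessThan_int finite_imageI finite_subset)
qed

lemma admissible_insert: "admissible (insert r B) = admissible B"
proof -
  have "finite {s \<in> insert r B. 0 \<le> s} = finite {s \<in> B. 0 \<le> s}"
  proof -
    have "{s \<in> insert r B. 0 \<le> s} \<subseteq> insert r {s \<in> B. 0 \<le> s}" "{s \<in> B. 0 \<le> s} \<subseteq> {s \<in> insert r B. 0 \<le> s}" by auto
    then show ?thesis by (meson finite_insert finite_subset)
  qed
  moreover have "finite {s. s < 0 \<and> s \<notin> insert r B} = finite {s. s < 0 \<and> s \<notin> B}"
  proof -
    have "{s. s < 0 \<and> s \<notin> B} \<subseteq> insert r {s. s < 0 \<and> s \<notin> insert r B}"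
      "{s. s < 0 \<and> s \<notin> insert r B} \<subseteq> {s. s < 0 \<and> s \<notin> B}" by auto
    then show ?thesis by (meson finite_insert finite_subset)
  qed
  ultimately show ?thesis by (simp add: admissible_def)
qed

lemma admissible_remove: "admissible (B - {r}) = admissible B"
  using admissible_insert[of r "B - {r}"] admissible_insert[of r B] by simp

lemma finite_above:
  assumes "admissible B"
  shows "finite {s \<in> B. r < s}"
proof (rule finite_subset)
  show "{s \<in> B. r < s} \<subseteq> {s \<in> B. 0 \<le> s} \<union> {r<..<0}" by auto
qed (use assms in \<open>auto simp: admissible_def\<close>)

section \<open>The fermion operators in coordinates\<close>

lemma Sum_any_single:
  assumes "\<And>x. x \<noteq> a \<Longrightarrow> f x = 0"
  shows "Sum_any f = f a"
proof -
  have "Sum_any f = sum f {a}" by (rule Sum_any.expand_superset) (use assms in auto)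
  then show ?thesis by simp
qed

lemma psi_eq:
  "psi r v B = (if r \<in> B \<and> admissible B then (-1) ^ card {s \<in> B. r < s} * v (B - {r}) else 0)"
proof -
  have "psi r v B = (if admissible (B - {r}) then v (B - {r}) * psi_basis r (B - {r}) B else 0)"
    unfolding psi_def
  proof (rule Sum_any_single)
    fix A assume "A \<noteq> B - {r}"
    then have "r \<in> A \<or> B \<noteq> insert r A" by auto
    then show "(if admissible A then v A * psi_basis r A B else 0) = 0"
      by (auto simp: psi_basis_def ket_def)
  qed
  moreover have "{s \<in> B. s \<noteq> r \<and> r < s} = {s \<in> B. r < s}" by auto
  ultimately show ?thesis
    by (cases "r \<in> B") (auto simp: psi_basis_def ket_def admissible_remove insert_absorb mult.commute)
qed

lemma psi_star_eq:
  "psi_star r v B = (if r \<notin> B \<and> admissible B then (-1) ^ card {s \<in> B. r < s} * v (insert r B) else 0)"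
proof -
  have 1: "psi_star r v B = (if admissible (insert r B) then v (insert r B) * psi_star_basis r (insert r B) B else 0)"
    unfolding psi_star_def
  proof (rule Sum_any_single)
    fix A assume "A \<noteq> insert r B"
    then have "r \<notin> A \<or> B \<noteq> A - {r}" by auto
    then show "(if admissible A then v A * psi_star_basis r A B else 0) = 0"
      by (auto simp: psi_star_basis_def ket_def)
  qed
  \<comment> \<open>Counting r itself adds one to the exponent and the definition of
    \<open>psi_star_basis\<close> another one, so the parity is that of the number of elements above
    r.\<close>
  have 2: "card {s. (s = r \<or> s \<in> B) \<and> r \<le> s} = Suc (card {s \<in> B. r < s})" if "r \<notin> B" "admissible B"
  proof -
    have "{s. (s = r \<or> s \<in> B) \<and> r \<le> s} = insert r {s \<in> B. r < s}" using that by (auto simp: le_less)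
    then show ?thesis using finite_above[OF that(2)] by simp
  qed
  show ?thesis
    unfolding 1 by (cases "r \<in> B") (auto simp: psi_star_basis_def ket_def admissible_insert 2 mult.commute)
qed

definition particles :: "int set \<Rightarrow> nat set" where
  "particles B = {m. int m \<in> B}"

definition holes :: "int set \<Rightarrow> nat set" where
  "holes B = {n. - int n - 1 \<notin> B}"

lemma finite_particles: "admissible B \<Longrightarrow> finite (particles B)"
proof -
  assume "admissible B"
  then have "finite (int -` {r \<in> B. 0 \<le> r})" by (intro finite_vimageI) (auto simp: admissible_def)
  then show ?thesis by (rule finite_subset[rotated]) (auto simp: particles_def)
qed

lemma finite_holes: "admissible B \<Longrightarrow> finite (holes B)"
proof -
  assume "admissible B"
  then have "finite ((\<lambda>n. - int n - 1) -` {r. r < 0 \<and> r \<notin> B})"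
    by (intro finite_vimageI) (auto simp: admissible_def inj_on_def)
  then show ?thesis by (rule finite_subset[rotated]) (auto simp: holes_def)
qed

lemma pair_operator_eq:
  "pair_operator R v B = (if admissible B then
     \<Sum>m\<in>particles B. \<Sum>n\<in>holes B. R m n * ((-1) ^ card {s \<in> B. int m < s} *
       (-1) ^ card {s \<in> B - {int m}. - int n - 1 < s} * v (insert (- int n - 1) (B - {int m}))) else 0)"
proof -
  have psi2: "psi (int m) (psi_star (- int n - 1) v) B =
    (if m \<in> particles B \<and> n \<in> holes B \<and> admissible B then (-1) ^ card {s \<in> B. int m < s} *
       ((-1) ^ card {s \<in> B - {int m}. - int n - 1 < s} * v (insert (- int n - 1) (B - {int m}))) else 0)" for m n
    by (simp only: psi_eq psi_star_eq admissible_remove particles_def holes_def) auto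
  show ?thesis
  proof (cases "admissible B")
    case True
    have "pair_operator R v B = (\<Sum>(m, n)\<in>particles B \<times> holes B. R m n * psi (int m) (psi_star (- int n - 1) v) B)"
      unfolding pair_operator_def
      by (rule Sum_any.expand_superset) (use True in \<open>auto simp: finite_particles finite_holes psi2 split: if_splits\<close>)
    also have "\<dots> = (\<Sum>m\<in>particles B. \<Sum>n\<in>holes B. R m n * psi (int m) (psi_star (- int n - 1) v) B)"
      by (simp add: sum.cartesian_product)
    also have "\<dots> = (\<Sum>m\<in>particles B. \<Sum>n\<in>holes B. R m n * ((-1) ^ card {s \<in> B. int m < s} *
       (-1) ^ card {s \<in> B - {int m}. - int n - 1 < s} * v (insert (- int n - 1) (B - {int m}))))"
      using True by (intro sum.cong refl) (simp add: psi2 mult.assoc)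
    finally show ?thesis using True by simp
  next
    case False
    then show ?thesis by (simp add: pair_operator_def psi2)
  qed
qed

definition state :: "(partition \<Rightarrow> 'a::comm_ring_1) \<Rightarrow> 'a fock" where
  "state c B = Sum_any (\<lambda>\<mu>. c \<mu> * partition_ket \<mu> B)"

lemma state_maya: "state c (maya \<mu>) = c \<mu>"
proof -
  have "state c (maya \<mu>) = c \<mu> * partition_ket \<mu> (maya \<mu>)"
    unfolding state_def by (rule Sum_any_single) (simp add: partition_ket_def ket_def maya_inject)
  then show ?thesis by (simp add: partition_ket_def ket_def)
qed

lemma state_not_maya:
  fixes c :: "partition \<Rightarrow> 'a::comm_ring_1"
  assumes "B \<notin> range maya"
  shows "state c B = 0"
proof -
  have "partition_ket \<mu> B = (0 :: 'a)" for \<mu> using assms by (auto simp: partition_ket_def ket_def)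
  then show ?thesis by (simp add: state_def)
qed

lemma state_dirac_sea: "finite A \<Longrightarrow> card A = N \<Longrightarrow> state c (dirac_sea N A) = c (pt A)"
  using state_maya[of c "pt A"] maya_pt[of A] by simp

lemma card_above_dirac_sea: "card {s \<in> dirac_sea N A. int a - int N < s} = card {x \<in> A. a < x}"
proof -
  have "{s \<in> dirac_sea N A. int a - int N < s} = (\<lambda>x. int x - int N) ` {x \<in> A. a < x}"
    by (auto simp: dirac_sea_def)
  moreover have "inj_on (\<lambda>x. int x - int N) {x \<in> A. a < x}" by (auto simp: inj_on_def)
  ultimately show ?thesis by (simp add: card_image)
qed

text \<open>The sign comes from \<open>psi_star\<close> passing the n occupied positions between the
  hole at - n - 1 and 0.\<close>

definition hook_coeff :: "(partition \<Rightarrow> 'a::comm_ring_1) \<Rightarrow> nat \<Rightarrow> nat \<Rightarrow> 'a" where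
  "hook_coeff c m n = (-1) ^ n * state c (insert (int m) ({..<0} - {- int n - 1}))"

text \<open>
  The Pluecker relation for \<open>S = {r < 0} \<union> {m}\<close> and \<open>S' = B - {m}\<close>, in which the term
  \<open>r = m\<close> is the coefficient at \<open>B\<close>.
\<close>

lemma hook_expansion:
  fixes c :: "partition \<Rightarrow> 'a::comm_ring_1"
  assumes c: "plucker_part c" and c1: "c empty_partition = 1"
    and B: "B \<in> range maya" and m: "m \<in> particles B"
  shows "(\<Sum>n\<in>holes B. hook_coeff c m n * ((-1) ^ card {s \<in> B. int m < s} *
       (-1) ^ card {s \<in> B - {int m}. - int n - 1 < s} * state c (insert (- int n - 1) (B - {int m})))) = state c B"
proof -
  obtain N A where N: "1 \<le> N" "finite A" "card A = N" "B = dirac_sea N A" using maya_large[OF B] by metis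
  define a where "a = N + m"
  have m_eq: "int m = int a - int N" by (simp add: a_def)
  have aA: "a \<in> A" using m N(4) dirac_sea_mem[of a N A] by (simp add: particles_def m_eq)
  let ?S = "insert a {..<N}" and ?S' = "A - {a}"
  have BS': "B - {int m} = dirac_sea N ?S'" unfolding N(4) m_eq by (auto simp: dirac_sea_def)
  have SS': "?S - ?S' = insert a ({..<N} - A)" using a_def by auto
  have "card ?S = Suc N" "card ?S' = N - 1" using N aA by (simp_all add: a_def)
  then have "(\<Sum>r\<in>?S - ?S'. sg ?S r * sg ?S' r * c (pt (?S - {r})) * c (pt (insert r ?S'))) = 0"
    using c N(1,2) unfolding plucker_part_def by simp
  moreover have "sg ?S a = (1 :: 'a)" by (rule sg_top) (auto simp: a_def)
  moreover have "?S - {a} = {..<N}" "insert a ?S' = A" using aA by (auto simp: a_def)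
  ultimately have "sg A a * c (pt A) + (\<Sum>r\<in>{..<N} - A. sg ?S r * sg ?S' r * c (pt (?S - {r})) * c (pt (insert r ?S'))) = 0"
    unfolding SS' using aA by (simp add: c1)
  then have "sg A a * (sg A a * c (pt A) + (\<Sum>r\<in>{..<N} - A. sg ?S r * sg ?S' r * c (pt (?S - {r})) * c (pt (insert r ?S')))) = 0"
    by simp
  then have eq: "c (pt A) = (\<Sum>r\<in>{..<N} - A. - (sg A a * (sg ?S r * sg ?S' r * c (pt (?S - {r})) * c (pt (insert r ?S')))))"
    by (simp add: distrib_left sum_distrib_left sum_negf add_eq_0_iff2)
  have "(\<Sum>n\<in>holes B. hook_coeff c m n * ((-1) ^ card {s \<in> B. int m < s} *
       (-1) ^ card {s \<in> B - {int m}. - int n - 1 < s} * state c (insert (- int n - 1) (B - {int m}))))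
    = (\<Sum>r\<in>{..<N} - A. - (sg A a * (sg ?S r * sg ?S' r * c (pt (?S - {r})) * c (pt (insert r ?S')))))"
  proof (rule sum.reindex_bij_witness[of _ "\<lambda>r. N - Suc r" "\<lambda>n. N - Suc n"])
    fix n assume n: "n \<in> holes B"
    have nN: "n < N"
    proof (rule ccontr)
      assume "\<not> n < N"
      then have "- int n - 1 \<in> B" unfolding N(4) dirac_sea_def by auto
      then show False using n by (simp add: holes_def)
    qed
    define r where "r = N - Suc n"
    have n_eq: "- int n - 1 = int r - int N" using nN by (simp add: r_def of_nat_diff)
    have r: "r < N" "r \<notin> A" using n nN N(4) dirac_sea_mem[of r N A] by (auto simp: holes_def n_eq r_def)
    have ra: "r \<noteq> a" using r by (simp add: a_def)
    show "N - Suc (N - Suc n) = n" "N - Suc n \<in> {..<N} - A" using nN r by (auto simp: r_def)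
    have 1: "insert (int m) ({..<0} - {- int n - 1}) = dirac_sea N (?S - {r})"
      unfolding dirac_sea_lessThan[of N, symmetric] m_eq n_eq using ra by (auto simp: dirac_sea_def)
    have 2: "insert (- int n - 1) (B - {int m}) = dirac_sea N (insert r ?S')"
      unfolding BS' n_eq by (auto simp: dirac_sea_def)
    have 3: "card (?S - {r}) = N" "card (insert r ?S') = N" using N aA r by (simp_all add: a_def)
    \<comment> \<open>Above r lie the n sea positions r + 1, ..., N - 1 and the particle a, hence n
      + 1 factors of -1.\<close>
    have "{x. (x = a \<or> x < N) \<and> r < x} = insert a {r<..<N}" using r by (auto simp: a_def)
    moreover have "card (insert a {r<..<N}) = Suc n" using nN by (simp add: a_def r_def)
    ultimately have 4: "sg ?S r = - ((-1) ^ n :: 'a)" by (simp add: sg_def)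
    have "hook_coeff c m n = (-1) ^ n * c (pt (?S - {r}))"
      unfolding hook_coeff_def 1 using 3 by (simp add: state_dirac_sea)
    moreover have "state c (insert (- int n - 1) (B - {int m})) = c (pt (insert r ?S'))"
      unfolding 2 using 3 N(2) by (simp add: state_dirac_sea)
    moreover have "(-1) ^ card {s \<in> B. int m < s} = (sg A a :: 'a)"
      unfolding N(4) m_eq card_above_dirac_sea sg_def ..
    moreover have "(-1) ^ card {s \<in> B - {int m}. - int n - 1 < s} = (sg ?S' r :: 'a)"
      unfolding BS' n_eq card_above_dirac_sea sg_def ..
    ultimately show "- (sg A a * (sg ?S (N - Suc n) * sg ?S' (N - Suc n) * c (pt (?S - {N - Suc n})) * c (pt (insert (N - Suc n) ?S'))))
      = hook_coeff c m n * ((-1) ^ card {s \<in> B. int m < s} *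
       (-1) ^ card {s \<in> B - {int m}. - int n - 1 < s} * state c (insert (- int n - 1) (B - {int m})))"
      unfolding r_def[symmetric] 4 by (simp add: mult_ac)
  next
    fix r assume r: "r \<in> {..<N} - A"
    then show "N - Suc (N - Suc r) = r" by auto
    have "- int (N - Suc r) - 1 = int r - int N" using r by (auto simp: of_nat_diff)
    then show "N - Suc r \<in> holes B" using r N(4) dirac_sea_mem[of r N A] by (simp add: holes_def)
  qed
  then show ?thesis using eq N by (simp add: state_dirac_sea)
qed

lemma particles_hop:
  assumes "m \<in> particles B"
  shows "particles (insert (- int n - 1) (B - {int m})) = particles B - {m}"
  using assms by (auto simp: particles_def)

text \<open>By \<open>hook_expansion\<close> each particle m of B contributes the full coefficient
  at B. Summing over the k + 1 particles turns the factor k! into (k + 1)!.\<close>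

lemma pair_operator_power:
  assumes c: "plucker_part c" and c1: "c empty_partition = 1"
  shows "(pair_operator (hook_coeff c) ^^ k) vacuum =
    (\<lambda>B. if B \<in> range maya \<and> card (particles B) = k then of_nat (fact k) * state c B else 0)"
proof (induction k)
  case 0
  show ?case
  proof
    fix B
    \<comment> \<open>With charge 0, the absence of particles forces all N positions between the
      cutoff and 0 to be occupied.\<close>
    have "B \<in> range maya \<and> card (particles B) = 0 \<longleftrightarrow> B = {..<0}"
    proof
      assume *: "B \<in> range maya \<and> card (particles B) = 0"
      then obtain N A where N: "0 \<le> N" "finite A" "card A = N" "B = dirac_sea N A" using maya_large by metis
      have "particles B = {}" using * finite_particles[OF admissible_maya] by auto
      then have "a < N" if "a \<in> A" for a
        using that N(4) dirac_sea_mem[of a N A]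
        by (cases "a < N") (auto simp: particles_def not_less dest!: spec[of _ "a - N"] simp: of_nat_diff)
      then have "A = {..<N}" using N(2,3) by (intro card_subset_eq) auto
      then show "B = {..<0}" using N(4) dirac_sea_lessThan by simp
    next
      assume B: "B = {..<0}"
      then have "B = maya (pt {})" using maya_pt[of "{}"] by (simp add: dirac_sea_def)
      moreover have "particles B = {}" using B by (simp add: particles_def)
      ultimately show "B \<in> range maya \<and> card (particles B) = 0" by simp
    qed
    moreover have "state c {..<0} = 1"
      using state_dirac_sea[of "{}" 0 c] c1 pt_lessThan[of 0] by (simp add: dirac_sea_def)
    moreover have "{r. r < 0} = {..<(0::int)}" by auto
    ultimately show "(pair_operator (hook_coeff c) ^^ 0) vacuum B =
      (if B \<in> range maya \<and> card (particles B) = 0 then of_nat (fact 0) * state c B else 0)"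
      by (simp add: vacuum_def ket_def)
  qed
next
  case (Suc k)
  let ?v = "\<lambda>B. if B \<in> range maya \<and> card (particles B) = k then of_nat (fact k) * state c B else 0"
  have "pair_operator (hook_coeff c) ?v B =
    (if B \<in> range maya \<and> card (particles B) = Suc k then of_nat (fact (Suc k)) * state c B else 0)" for B
  proof (cases "admissible B")
    case False
    then have "B \<notin> range maya" using admissible_maya by blast
    then show ?thesis using False by (simp add: pair_operator_eq)
  next
    case True
    have hop: "?v (insert (- int n - 1) (B - {int m})) =
       (if B \<in> range maya \<and> card (particles B) = Suc k then of_nat (fact k) * state c (insert (- int n - 1) (B - {int m})) else 0)"
      if mn: "m \<in> particles B" "n \<in> holes B" for m n
    proof -
      let ?B = "insert (- int n - 1) (B - {int m})"
      have "?B \<in> range maya \<longleftrightarrow> B \<in> range maya"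
      proof
        assume "?B \<in> range maya"
        then have "insert (int m) (?B - {- int n - 1}) \<in> range maya" by (rule maya_hop) (use mn in \<open>auto simp: holes_def particles_def\<close>)
        moreover have "insert (int m) (?B - {- int n - 1}) = B" using mn by (auto simp: particles_def holes_def)
        ultimately show "B \<in> range maya" by simp
      next
        assume "B \<in> range maya"
        then show "?B \<in> range maya" using mn by (intro maya_hop) (auto simp: particles_def holes_def)
      qed
      moreover have "card (particles ?B) = k \<longleftrightarrow> card (particles B) = Suc k"
        using particles_hop[OF mn(1)] card.remove[OF finite_particles[OF True] mn(1)] by simp
      ultimately show ?thesis by simp
    qed
    have "pair_operator (hook_coeff c) ?v B = (\<Sum>m\<in>particles B. \<Sum>n\<in>holes B.
       if B \<in> range maya \<and> card (particles B) = Suc k then of_nat (fact k) * (hook_coeff c m n * ((-1) ^ card {s \<in> B. int m < s} *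
       (-1) ^ card {s \<in> B - {int m}. - int n - 1 < s} * state c (insert (- int n - 1) (B - {int m})))) else 0)"
      unfolding pair_operator_eq using True
    proof (simp only: if_True, intro sum.cong refl)
      fix m n assume mn: "m \<in> particles B" "n \<in> holes B"
      show "hook_coeff c m n * ((-1) ^ card {s \<in> B. int m < s} *
       (-1) ^ card {s \<in> B - {int m}. - int n - 1 < s} * ?v (insert (- int n - 1) (B - {int m}))) =
       (if B \<in> range maya \<and> card (particles B) = Suc k then of_nat (fact k) * (hook_coeff c m n * ((-1) ^ card {s \<in> B. int m < s} *
       (-1) ^ card {s \<in> B - {int m}. - int n - 1 < s} * state c (insert (- int n - 1) (B - {int m})))) else 0)"
        unfolding hop[OF mn] by (simp add: mult_ac)
    qed
    also have "\<dots> = (if B \<in> range maya \<and> card (particles B) = Suc k then of_nat (fact (Suc k)) * state c B else 0)"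
    proof (cases "B \<in> range maya \<and> card (particles B) = Suc k")
      case *: True
      have "(\<Sum>m\<in>particles B. \<Sum>n\<in>holes B. hook_coeff c m n * ((-1) ^ card {s \<in> B. int m < s} *
       (-1) ^ card {s \<in> B - {int m}. - int n - 1 < s} * state c (insert (- int n - 1) (B - {int m})))) =
        of_nat (Suc k) * state c B"
        using * by (simp only: hook_expansion[OF c c1] sum_constant cong: sum.cong)
      then show ?thesis using *
        by (simp only: if_True simp_thms sum_distrib_left[symmetric]) (simp only: fact_Suc of_nat_mult of_nat_id mult_ac)
    qed (simp only: if_False sum.neutral_const)
    finally show ?thesis .
  qed
  then show ?case unfolding funpow.simps comp_def Suc.IH by (intro ext)
qed

theorem bogoliubov_state:
  fixes c :: "partition \<Rightarrow> 'k::field_char_0 fps"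
  assumes c: "plucker_part c" and c1: "c empty_partition = 1"
  shows "bogoliubov_vacuum (hook_coeff c) = state c"
proof
  fix B
  let ?f = "\<lambda>k. fps_const (1 / fact k) * (pair_operator (hook_coeff c) ^^ k) vacuum B"
  have f: "?f k = (if B \<in> range maya \<and> card (particles B) = k then state c B else 0)" for k
  proof -
    have "fps_const (1 / fact k) * (of_nat (fact k) * state c B) = state c B"
    proof -
      have "fps_const (1 / fact k) * of_nat (fact k) = (1 :: 'k fps)"
      proof -
        have "of_nat (fact k) = fps_const (of_nat (fact k) :: 'k)" by (simp only: fps_of_nat)
        then show ?thesis by (simp only: fps_const_mult) simp
      qed
      then show ?thesis by (simp add: mult.assoc[symmetric])
    qed
    then show ?thesis unfolding pair_operator_power[OF c c1] by simp
  qed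
  have "bogoliubov_vacuum (hook_coeff c) B = ?f (card (particles B))"
    unfolding bogoliubov_vacuum_def by (rule Sum_any_single) (simp add: f)
  then show "bogoliubov_vacuum (hook_coeff c) B = state c B"
    unfolding f using state_not_maya by auto
qed

section \<open>The shift of the KP times\<close>

lemma mps_nth_const_mult [simp]: "mps_nth (mps_const a * f) M = a * mps_nth f M"
proof -
  have "mps_nth (mps_const a * f) M = (\<Sum>p\<in>mset_splits M. if p = ({#}, M) then a * mps_nth f M else 0)"
    unfolding mps_nth_mult by (intro sum.cong) (auto simp: mps_const_def mset_splits_def split: if_splits)
  also have "\<dots> = a * mps_nth f M"
  proof -
    have "({#}, M) \<in> mset_splits M" by (simp add: mset_splits_def)
    then show ?thesis by simp
  qed
  finally show ?thesis .
qed

lemma mps_const_one_mult: "mps_const (fps_const 1) * f = f"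
  by (rule mps_eqI) simp

lemma of_nat_mps: "of_nat n = mps_const (of_nat n)"
  by (induction n) (auto intro!: mps_eqI simp: mps_const_def mps_nth_one)

lemma mps_nth_of_nat_mult [simp]: "mps_nth (of_nat n * f) M = of_nat n * mps_nth f M"
  by (simp add: of_nat_mps)

text \<open>The recursions below come from Euler's relation and determine n times a coefficient;
  this divides by n.\<close>

lemma mps_of_nat_cancel:
  fixes f g :: "'k::field_char_0 fps mps"
  assumes "of_nat n * f = of_nat n * g" "n > 0"
  shows "f = g"
proof (rule mps_eqI)
  fix M
  have "of_nat n * mps_nth f M = of_nat n * mps_nth g M" using assms(1) by (metis mps_nth_of_nat_mult)
  moreover have "of_nat n \<noteq> (0 :: 'k fps)" using assms(2) by (simp add: fps_of_nat[symmetric] del: fps_of_nat)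
  ultimately show "mps_nth f M = mps_nth g M" by simp
qed

section \<open>Partial derivatives in the times\<close>

definition pdiff :: "nat \<Rightarrow> 'a::comm_ring_1 mps \<Rightarrow> 'a mps" where
  "pdiff n f = Abs_mps (\<lambda>M. of_nat (Suc (count M n)) * mps_nth f (add_mset n M))"

lemma mps_nth_pdiff [simp]: "mps_nth (pdiff n f) M = of_nat (Suc (count M n)) * mps_nth f (add_mset n M)"
  by (simp add: pdiff_def)

lemma mset_splits_count_sum:
  fixes F :: "nat multiset \<Rightarrow> nat multiset \<Rightarrow> 'a::comm_ring_1"
  shows "(\<Sum>(P, Q)\<in>mset_splits (add_mset n M). of_nat (count P n) * F P Q) =
     (\<Sum>(P, Q)\<in>mset_splits M. of_nat (Suc (count P n)) * F (add_mset n P) Q)"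
proof -
  have "(\<Sum>(P, Q)\<in>mset_splits (add_mset n M). of_nat (count P n) * F P Q) =
     (\<Sum>(P, Q)\<in>{p \<in> mset_splits (add_mset n M). n \<in># fst p}. of_nat (count P n) * F P Q)"
    by (rule sum.mono_neutral_right) (force intro: count_inI)+
  also have "\<dots> = (\<Sum>(P, Q)\<in>mset_splits M. of_nat (Suc (count P n)) * F (add_mset n P) Q)"
  proof (rule sum.reindex_bij_witness[of _ "\<lambda>(P, Q). (add_mset n P, Q)" "\<lambda>(P, Q). (P - {#n#}, Q)"])
    fix p assume p: "p \<in> {p \<in> mset_splits (add_mset n M). n \<in># fst p}"
    obtain P Q where PQ: "p = (P, Q)" by (cases p)
    obtain P' where P': "P = add_mset n P'" using p multi_member_split[of n P] unfolding PQ by auto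
    show "(case case p of (P, Q) \<Rightarrow> (P - {#n#}, Q) of (P, Q) \<Rightarrow> (add_mset n P, Q)) = p"
      "(case p of (P, Q) \<Rightarrow> (P - {#n#}, Q)) \<in> mset_splits M"
      "(case case p of (P, Q) \<Rightarrow> (P - {#n#}, Q) of (P, Q) \<Rightarrow> of_nat (Suc (count P n)) * F (add_mset n P) Q) =
         (case p of (P, Q) \<Rightarrow> of_nat (count P n) * F P Q)"
      using p by (auto simp: PQ P' mset_splits_def)
  qed (auto simp: mset_splits_def)
  finally show ?thesis .
qed

lemma pdiff_mult: "pdiff n (f * g) = pdiff n f * g + f * pdiff n g"
proof (rule mps_eqI)
  fix M
  have swap: "(\<Sum>(P, Q)\<in>mset_splits K. G Q P) = (\<Sum>(P, Q)\<in>mset_splits K. G P Q)"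
    for G :: "nat multiset \<Rightarrow> nat multiset \<Rightarrow> 'a" and K
    by (rule sum.reindex_bij_witness[of _ prod.swap prod.swap]) (auto simp: mset_splits_def add.commute)
  have "mps_nth (pdiff n (f * g)) M =
     (\<Sum>(P, Q)\<in>mset_splits (add_mset n M). of_nat (Suc (count M n)) * (mps_nth f P * mps_nth g Q))"
    by (simp add: mps_nth_mult sum_distrib_left case_prod_unfold)
  also have "\<dots> = (\<Sum>(P, Q)\<in>mset_splits (add_mset n M). of_nat (count P n) * (mps_nth f P * mps_nth g Q)) +
     (\<Sum>(P, Q)\<in>mset_splits (add_mset n M). of_nat (count Q n) * (mps_nth f P * mps_nth g Q))"
    unfolding sum.distrib[symmetric]
  proof (intro sum.cong refl, clarify)
    fix P Q assume "(P, Q) \<in> mset_splits (add_mset n M)"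
    then have "Suc (count M n) = count P n + count Q n"
      unfolding mset_splits_def by (metis (mono_tags, lifting) case_prodD count_add_mset count_union mem_Collect_eq)
    then have "of_nat (Suc (count M n)) = (of_nat (count P n) + of_nat (count Q n) :: 'a)" by (metis of_nat_add)
    then show "of_nat (Suc (count M n)) * (mps_nth f P * mps_nth g Q) =
       of_nat (count P n) * (mps_nth f P * mps_nth g Q) + of_nat (count Q n) * (mps_nth f P * mps_nth g Q)"
      by (simp only: distrib_right)
  qed
  also have "(\<Sum>(P, Q)\<in>mset_splits (add_mset n M). of_nat (count P n) * (mps_nth f P * mps_nth g Q)) =
     mps_nth (pdiff n f * g) M"
    unfolding mset_splits_count_sum mps_nth_mult by (simp add: mult.assoc)
  also have "(\<Sum>(P, Q)\<in>mset_splits (add_mset n M). of_nat (count Q n) * (mps_nth f P * mps_nth g Q)) =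
     (\<Sum>(Q, P)\<in>mset_splits (add_mset n M). of_nat (count Q n) * (mps_nth g Q * mps_nth f P))"
    using swap[of "\<lambda>P Q. of_nat (count P n) * (mps_nth g P * mps_nth f Q)" "add_mset n M"]
    by (simp add: mult.commute)
  also have "\<dots> = mps_nth (pdiff n g * f) M"
    unfolding mset_splits_count_sum mps_nth_mult by (simp add: mult.assoc)
  finally show "mps_nth (pdiff n (f * g)) M = mps_nth (pdiff n f * g + f * pdiff n g) M"
    by (simp add: mult.commute)
qed

section \<open>Monomials of given weight\<close>

definition times_of_weight :: "nat \<Rightarrow> nat multiset set" where
  "times_of_weight k = {G. 0 \<notin># G \<and> sum_mset G = k}"

lemma weight_count_le: "n * count G n \<le> sum_mset G"
  by (induction G) auto

lemma weight_mem: "G \<in> times_of_weight k \<Longrightarrow> n \<in># G \<Longrightarrow> 1 \<le> n \<and> n \<le> k"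
proof -
  assume G: "G \<in> times_of_weight k" and n: "n \<in># G"
  then obtain G' where "G = add_mset n G'" by (metis (no_types, lifting) mem_Collect_eq multi_member_split)
  moreover have "n \<noteq> 0" using G n by (metis (mono_tags, lifting) mem_Collect_eq times_of_weight_def)
  ultimately show ?thesis using G by (auto simp: times_of_weight_def)
qed

lemma finite_times_of_weight: "finite (times_of_weight k)"
proof (rule finite_subset)
  \<comment> \<open>A part n occurs at most k / n \<le> k times, so this multiset contains every G
    of weight k.\<close>
  let ?B = "\<Sum>n\<in>{1..k}. replicate_mset k n"
  show "times_of_weight k \<subseteq> {G. G \<subseteq># ?B}"
  proof
    fix G assume G: "G \<in> times_of_weight k"
    have "count G n \<le> count ?B n" for n
    proof (cases "n \<in># G")
      case True
      then have n: "1 \<le> n" "n \<le> k" using weight_mem[OF G] by auto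
      have "count G n \<le> n * count G n" using n by simp
      also have "\<dots> \<le> k" using weight_count_le[of n G] G by (simp add: times_of_weight_def)
      also have "k = count ?B n" using n by (simp add: count_sum)
      finally show ?thesis .
    qed (simp add: not_in_iff)
    then show "G \<in> {G. G \<subseteq># ?B}" by (simp add: subseteq_mset_def)
  qed
qed (rule finite_subset_msets)

lemma times_of_weight_0: "times_of_weight 0 = {{#}}"
proof (intro equalityI subsetI)
  fix G assume G: "G \<in> times_of_weight 0"
  then have "n \<notin># G" for n using weight_mem[OF G, of n] by auto
  then show "G \<in> {{#}}" by (metis multiset_nonemptyE singletonI)
qed (simp add: times_of_weight_def)

lemma sum_mset_eq_sum_count: "sum_mset G = (\<Sum>n\<in>set_mset G. n * count G n)"
proof (induction G)
  case (add x G)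
  have "(\<Sum>n\<in>set_mset (add_mset x G). n * count (add_mset x G) n) =
     (\<Sum>n\<in>insert x (set_mset G). n * count G n + (if n = x then x else 0))"
    by (intro sum.cong) auto
  also have "\<dots> = (\<Sum>n\<in>insert x (set_mset G). n * count G n) + x" by (simp add: sum.distrib)
  also have "(\<Sum>n\<in>insert x (set_mset G). n * count G n) = (\<Sum>n\<in>set_mset G. n * count G n)"
    by (intro sum.mono_neutral_right) (auto simp: not_in_iff)
  finally show ?case using add by simp
qed simp

lemma sum_weight_count:
  assumes "G \<in> times_of_weight k"
  shows "(\<Sum>n\<in>{1..k}. n * count G n) = k"
proof -
  have "(\<Sum>n\<in>set_mset G. n * count G n) = (\<Sum>n\<in>{1..k}. n * count G n)"
    using weight_mem[OF assms] by (intro sum.mono_neutral_left) (auto simp: not_in_iff)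
  then show ?thesis using assms by (simp add: times_of_weight_def sum_mset_eq_sum_count)
qed

lemma sum_times_of_weight_count:
  fixes F :: "nat multiset \<Rightarrow> 'a::comm_ring_1"
  assumes n: "1 \<le> n" "n \<le> k"
  shows "(\<Sum>G\<in>times_of_weight k. of_nat (count G n) * F G) =
     (\<Sum>G\<in>times_of_weight (k - n). of_nat (Suc (count G n)) * F (add_mset n G))"
proof -
  have "(\<Sum>G\<in>times_of_weight k. of_nat (count G n) * F G) =
     (\<Sum>G\<in>{G \<in> times_of_weight k. n \<in># G}. of_nat (count G n) * F G)"
    by (rule sum.mono_neutral_right) (auto simp: finite_times_of_weight not_in_iff)
  also have "\<dots> = (\<Sum>G\<in>times_of_weight (k - n). of_nat (Suc (count G n)) * F (add_mset n G))"
  proof (rule sum.reindex_bij_witness[of _ "add_mset n" "\<lambda>G. G - {#n#}"])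
    fix G assume G: "G \<in> {G \<in> times_of_weight k. n \<in># G}"
    then obtain G' where G': "G = add_mset n G'" by (metis (no_types, lifting) mem_Collect_eq multi_member_split)
    show "add_mset n (G - {#n#}) = G" "G - {#n#} \<in> times_of_weight (k - n)"
      "of_nat (Suc (count (G - {#n#}) n)) * F (add_mset n (G - {#n#})) = of_nat (count G n) * F G"
      using G by (auto simp: G' times_of_weight_def)
  qed (use n in \<open>auto simp: times_of_weight_def\<close>)
  finally show ?thesis .
qed

definition shift_coeff :: "'k::field_char_0 \<Rightarrow> nat multiset \<Rightarrow> nat multiset \<Rightarrow> 'k" where
  "shift_coeff c M G = (\<Prod>n\<in>set_mset G. of_nat (count (M + G) n choose count G n) * (c / of_nat n) ^ count G n)"

text \<open>Only the factor of n changes, by the absorption identity (j + 1) C(i + 1, j + 1) = (i +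
  1) C(i, j).\<close>

lemma shift_coeff_add:
  assumes "1 \<le> n"
  shows "of_nat n * of_nat (Suc (count G n)) * shift_coeff c M (add_mset n G) =
     c * of_nat (Suc (count (M + G) n)) * shift_coeff c M G"
proof -
  let ?t = "\<lambda>G i. of_nat (count (M + G) i choose count G i) * (c / of_nat i) ^ count G i :: 'a"
  have sup: "shift_coeff c M G' = prod (?t G') (insert n (set_mset G))" if "set_mset G' \<subseteq> insert n (set_mset G)" for G'
    unfolding shift_coeff_def using that by (intro prod.mono_neutral_left) (auto simp: not_in_iff)
  have "shift_coeff c M (add_mset n G) = ?t (add_mset n G) n * prod (?t (add_mset n G)) (set_mset G - {n})"
    by (simp add: sup prod.insert_remove)
  also have "prod (?t (add_mset n G)) (set_mset G - {n}) = prod (?t G) (set_mset G - {n})"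
    by (intro prod.cong) auto
  finally have 1: "shift_coeff c M (add_mset n G) = ?t (add_mset n G) n * prod (?t G) (set_mset G - {n})" .
  have 2: "shift_coeff c M G = ?t G n * prod (?t G) (set_mset G - {n})"
    by (subst sup) (auto simp: prod.insert_remove)
  have "of_nat (Suc (count G n)) * of_nat (Suc (count (M + G) n) choose Suc (count G n)) =
     (of_nat (Suc (count (M + G) n)) * of_nat (count (M + G) n choose count G n) :: 'a)"
    by (metis Suc_times_binomial of_nat_mult)
  moreover have "of_nat n * (c / of_nat n) = c" using assms by simp
  ultimately have "(of_nat n * (c / of_nat n)) * (of_nat (Suc (count G n)) * of_nat (Suc (count (M + G) n) choose Suc (count G n))) *
      (c / of_nat n) ^ count G n = c * of_nat (Suc (count (M + G) n)) * ?t G n"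
    by (simp only: mult.assoc)
  then have "of_nat n * of_nat (Suc (count G n)) * ?t (add_mset n G) n = c * of_nat (Suc (count (M + G) n)) * ?t G n"
    by (simp only: union_mset_add_mset_right count_add_mset simp_thms if_True power_Suc mult_ac)
  then show ?thesis unfolding 1 2 by (simp only: mult.assoc[symmetric])
qed

definition shift :: "'k::field_char_0 \<Rightarrow> 'k fps mps \<Rightarrow> nat \<Rightarrow> 'k fps mps" where
  "shift c f k = Abs_mps (tau_shift c f k)"

lemma tau_shift_eq: "tau_shift c f k M = (\<Sum>G\<in>times_of_weight k. fps_const (shift_coeff c M G) * mps_nth f (M + G))"
  by (simp add: tau_shift_def shift_coeff_def times_of_weight_def)

lemma mps_nth_shift:
  "mps_nth (shift c f k) M = (\<Sum>G\<in>times_of_weight k. fps_const (shift_coeff c M G) * mps_nth f (M + G))"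
  by (simp add: shift_def tau_shift_eq)

lemma shift_add: "shift c (f + g) k = shift c f k + shift c g k"
  by (rule mps_eqI) (simp add: mps_nth_shift distrib_left sum.distrib)

lemma shift_const_mult: "shift c (mps_const a * f) k = mps_const a * shift c f k"
  by (rule mps_eqI) (simp add: mps_nth_shift sum_distrib_left mult.left_commute)

lemma shift_0 [simp]: "shift c f 0 = f"
  by (rule mps_eqI) (simp add: mps_nth_shift times_of_weight_0 shift_coeff_def)

text \<open>Put w = z^-1. Since the n-th time is moved by c w^n / n, the operator w d/dw maps f(t +
  c[w]) to c times the sum over n of w^n times the shifted derivative of f by t_n.\<close>

lemma shift_rec:
  "of_nat k * shift c f k = mps_const (fps_const c) * (\<Sum>n=1..k. shift c (pdiff n f) (k - n))"
proof (rule mps_eqI)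
  fix M
  have "mps_nth (of_nat k * shift c f k) M =
     (\<Sum>G\<in>times_of_weight k. (\<Sum>n=1..k. of_nat (n * count G n)) * (fps_const (shift_coeff c M G) * mps_nth f (M + G)))"
    unfolding mps_nth_of_nat_mult mps_nth_shift sum_distrib_left
    by (intro sum.cong refl) (simp only: of_nat_sum[symmetric] sum_weight_count)
  also have "\<dots> = (\<Sum>n=1..k. \<Sum>G\<in>times_of_weight k. of_nat (count G n) * (of_nat n * fps_const (shift_coeff c M G) * mps_nth f (M + G)))"
    unfolding sum_distrib_right by (subst sum.swap) (simp add: mult_ac)
  also have "\<dots> = (\<Sum>n=1..k. \<Sum>G\<in>times_of_weight (k - n). fps_const c * (fps_const (shift_coeff c M G) * mps_nth (pdiff n f) (M + G)))"
  proof (rule sum.cong[OF refl])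
    fix n assume n: "n \<in> {1..k}"
    have "(\<Sum>G\<in>times_of_weight k. of_nat (count G n) * (of_nat n * fps_const (shift_coeff c M G) * mps_nth f (M + G))) =
      (\<Sum>G\<in>times_of_weight (k - n). of_nat (Suc (count G n)) * (of_nat n * fps_const (shift_coeff c M (add_mset n G)) * mps_nth f (M + add_mset n G)))"
      using n by (intro sum_times_of_weight_count) auto
    also have "\<dots> = (\<Sum>G\<in>times_of_weight (k - n). fps_const c * (fps_const (shift_coeff c M G) * mps_nth (pdiff n f) (M + G)))"
    proof (intro sum.cong refl)
      fix G
      have "of_nat (Suc (count G n)) * (of_nat n * fps_const (shift_coeff c M (add_mset n G)) * mps_nth f (M + add_mset n G)) =
        fps_const (of_nat n * of_nat (Suc (count G n)) * shift_coeff c M (add_mset n G)) * mps_nth f (M + add_mset n G)"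
        by (simp only: fps_of_nat[symmetric] fps_const_mult mult.assoc[symmetric] mult.commute[of "of_nat (Suc (count G n))"])
      also have "\<dots> = fps_const (c * of_nat (Suc (count (M + G) n)) * shift_coeff c M G) * mps_nth f (M + add_mset n G)"
        using n by (simp only: shift_coeff_add atLeastAtMost_iff)
      also have "\<dots> = fps_const c * (fps_const (shift_coeff c M G) * mps_nth (pdiff n f) (M + G))"
        by (simp only: mps_nth_pdiff fps_of_nat[symmetric] fps_const_mult[symmetric] union_mset_add_mset_right mult_ac)
      finally show "of_nat (Suc (count G n)) * (of_nat n * fps_const (shift_coeff c M (add_mset n G)) * mps_nth f (M + add_mset n G)) =
        fps_const c * (fps_const (shift_coeff c M G) * mps_nth (pdiff n f) (M + G))" .
    qed
    finally show "(\<Sum>G\<in>times_of_weight k. of_nat (count G n) * (of_nat n * fps_const (shift_coeff c M G) * mps_nth f (M + G))) =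
      (\<Sum>G\<in>times_of_weight (k - n). fps_const c * (fps_const (shift_coeff c M G) * mps_nth (pdiff n f) (M + G)))" .
  qed
  also have "\<dots> = mps_nth (mps_const (fps_const c) * (\<Sum>n=1..k. shift c (pdiff n f) (k - n))) M"
    by (simp only: mps_nth_const_mult mps_nth_sum mps_nth_shift sum_distrib_left)
  finally show "mps_nth (of_nat k * shift c f k) M =
    mps_nth (mps_const (fps_const c) * (\<Sum>n=1..k. shift c (pdiff n f) (k - n))) M" .
qed

text \<open>Both sides obey the recursion \<open>shift_rec\<close>, the right one by the Leibniz
  rule, so induction on k takes the place of a convolution identity for binomial coefficients in
  many variables.\<close>

lemma shift_mult: "shift c (f * g) k = (\<Sum>i\<le>k. shift c f i * shift c g (k - i))"
proof (induction k arbitrary: f g rule: less_induct)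
  case (less k)
  show ?case
  proof (cases "k = 0")
    case False
    let ?c = "mps_const (fps_const c)"
    have "of_nat k * shift c (f * g) k = ?c * (\<Sum>n=1..k. shift c (pdiff n f * g + f * pdiff n g) (k - n))"
      unfolding shift_rec pdiff_mult ..
    also have "(\<Sum>n=1..k. shift c (pdiff n f * g + f * pdiff n g) (k - n)) =
       (\<Sum>n=1..k. \<Sum>i\<le>k - n. shift c (pdiff n f) i * shift c g (k - n - i)) +
       (\<Sum>n=1..k. \<Sum>i\<le>k - n. shift c f i * shift c (pdiff n g) (k - n - i))"
      unfolding sum.distrib[symmetric] shift_add by (intro sum.cong refl) (simp add: less.IH sum.distrib)
    also have "(\<Sum>n=1..k. \<Sum>i\<le>k - n. shift c (pdiff n f) i * shift c g (k - n - i)) =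
       (\<Sum>i\<le>k. \<Sum>n=1..i. shift c (pdiff n f) (i - n) * shift c g (k - i))"
      unfolding sum.Sigma[OF finite_atMost ballI[OF finite_atLeastAtMost]] sum.Sigma[OF finite_atLeastAtMost ballI[OF finite_atMost]]
      by (rule sum.reindex_bij_witness[of _ "\<lambda>(i, n). (n, i - n)" "\<lambda>(n, i). (i + n, n)"]) (auto simp: add.commute)
    also have "(\<Sum>n=1..k. \<Sum>i\<le>k - n. shift c f i * shift c (pdiff n g) (k - n - i)) =
       (\<Sum>i\<le>k. \<Sum>n=1..k - i. shift c f i * shift c (pdiff n g) (k - i - n))"
      unfolding sum.Sigma[OF finite_atMost ballI[OF finite_atLeastAtMost]] sum.Sigma[OF finite_atLeastAtMost ballI[OF finite_atMost]]
      by (rule sum.reindex_bij_witness[of _ "\<lambda>(i, n). (n, i)" "\<lambda>(n, i). (i, n)"]) (auto simp: diff_right_commute add.commute)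
    also have "?c * ((\<Sum>i\<le>k. \<Sum>n=1..i. shift c (pdiff n f) (i - n) * shift c g (k - i)) +
       (\<Sum>i\<le>k. \<Sum>n=1..k - i. shift c f i * shift c (pdiff n g) (k - i - n))) =
       (\<Sum>i\<le>k. (?c * (\<Sum>n=1..i. shift c (pdiff n f) (i - n))) * shift c g (k - i) +
          shift c f i * (?c * (\<Sum>n=1..k - i. shift c (pdiff n g) (k - i - n))))"
      by (simp add: sum.distrib sum_distrib_left sum_distrib_right distrib_left mult_ac)
    also have "\<dots> = (\<Sum>i\<le>k. of_nat i * shift c f i * shift c g (k - i) + shift c f i * (of_nat (k - i) * shift c g (k - i)))"
      unfolding shift_rec ..
    also have "\<dots> = (\<Sum>i\<le>k. of_nat k * (shift c f i * shift c g (k - i)))"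
    proof (intro sum.cong refl)
      fix i assume "i \<in> {..k}"
      then have "of_nat k = (of_nat i + of_nat (k - i) :: 'a fps mps)" by (simp flip: of_nat_add)
      then show "of_nat i * shift c f i * shift c g (k - i) + shift c f i * (of_nat (k - i) * shift c g (k - i)) =
         of_nat k * (shift c f i * shift c g (k - i))" by (simp add: algebra_simps)
    qed
    finally have "of_nat k * shift c (f * g) k = of_nat k * (\<Sum>i\<le>k. shift c f i * shift c g (k - i))"
      by (simp only: sum_distrib_left)
    then show ?thesis by (rule mps_of_nat_cancel) (use False in simp)
  qed simp
qed

text \<open>Here \<open>fps_X\<close> stands for z^-1. In this form the shift is a ring
  homomorphism, so it passes through minors.\<close>

definition shift_series :: "'k::field_char_0 \<Rightarrow> 'k fps mps \<Rightarrow> 'k fps mps fps" where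
  "shift_series c f = Abs_fps (shift c f)"

lemma shift_series_nth [simp]: "shift_series c f $ k = shift c f k"
  by (simp add: shift_series_def)

lemma shift_one: "k > 0 \<Longrightarrow> shift c 1 k = 0"
proof (rule mps_eqI)
  fix M assume k: "k > 0"
  have "G \<noteq> {#}" if "G \<in> times_of_weight k" for G using that k by (auto simp: times_of_weight_def)
  then have "mps_nth 1 (M + G) = (0 :: 'a fps)" if "G \<in> times_of_weight k" for G using that by (auto simp: mps_nth_one)
  then show "mps_nth (shift c 1 k) M = mps_nth 0 M" by (simp add: mps_nth_shift)
qed

lemma shift_series_minor:
  assumes "finite A" "finite B"
  shows "shift_series c (minor H A B) = minor (\<lambda>r s. shift_series c (H r s)) A B"
proof -
  have "shift_series c 1 = 1" by (rule fps_ext) (auto simp: shift_one)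
  moreover have "shift_series c (f + g) = shift_series c f + shift_series c g" for f g
    by (rule fps_ext) (simp add: shift_add)
  moreover have "shift_series c (f * g) = shift_series c f * shift_series c g" for f g
    by (rule fps_ext) (simp add: shift_mult fps_mult_nth atLeast0AtMost)
  ultimately show ?thesis using hom_minor[of UNIV "shift_series c" A B H] assms by simp
qed

section \<open>The coefficients of the exponential of the times\<close>

definition fact_mset :: "nat multiset \<Rightarrow> 'k::field_char_0" where
  "fact_mset M = (\<Prod>n\<in>set_mset M. fact (count M n))"

lemma fact_mset_nonzero [simp]: "fact_mset M \<noteq> 0"
  by (simp add: fact_mset_def)

lemma fact_mset_empty [simp]: "fact_mset {#} = 1"
  by (simp add: fact_mset_def)

lemma fact_mset_add: "fact_mset (add_mset n M) = of_nat (Suc (count M n)) * fact_mset M"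
proof -
  have sup: "fact_mset M' = (\<Prod>i\<in>insert n (set_mset M). fact (count M' i) :: 'a)" if "set_mset M' \<subseteq> insert n (set_mset M)" for M'
    unfolding fact_mset_def using that by (intro prod.mono_neutral_left) (auto simp: not_in_iff)
  have "fact_mset (add_mset n M) = fact (Suc (count M n)) * (\<Prod>i\<in>set_mset M - {n}. fact (count (add_mset n M) i) :: 'a)"
    by (simp add: sup prod.insert_remove)
  also have "(\<Prod>i\<in>set_mset M - {n}. fact (count (add_mset n M) i) :: 'a) = (\<Prod>i\<in>set_mset M - {n}. fact (count M i))"
    by (intro prod.cong) auto
  finally have 1: "fact_mset (add_mset n M) = fact (Suc (count M n)) * (\<Prod>i\<in>set_mset M - {n}. fact (count M i) :: 'a)" .
  have "fact_mset M = fact (count M n) * (\<Prod>i\<in>set_mset M - {n}. fact (count M i) :: 'a)"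
    by (subst sup) (auto simp: prod.insert_remove)
  then show ?thesis unfolding 1 by (simp add: mult.assoc)
qed

text \<open>The coefficient of \<open>z^n\<close> in \<open>exp (e (t\<^sub>1 z + t\<^sub>2 z^2 + \<dots>))\<close>; it is \<open>0\<close> for negative \<open>n\<close>.\<close>

definition exp_coeff :: "'k::field_char_0 \<Rightarrow> int \<Rightarrow> 'k fps mps" where
  "exp_coeff e n = Abs_mps (\<lambda>M. if 0 \<notin># M \<and> int (sum_mset M) = n
     then fps_const (e ^ size M / fact_mset M) else 0)"

lemma mps_nth_exp_coeff: "mps_nth (exp_coeff e n) M =
    (if 0 \<notin># M \<and> int (sum_mset M) = n then fps_const (e ^ size M / fact_mset M) else 0)"
  by (simp add: exp_coeff_def)

lemma exp_coeff_neg: "n < 0 \<Longrightarrow> exp_coeff e n = 0"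
  by (rule mps_eqI) (simp add: mps_nth_exp_coeff del: of_nat_sum_mset)

lemma exp_coeff_0: "exp_coeff e 0 = 1"
proof (rule mps_eqI)
  fix M :: "nat multiset"
  have "0 \<notin># M \<and> sum_mset M = 0 \<longleftrightarrow> M = {#}" 
  proof -
    have "M \<in> times_of_weight 0 \<longleftrightarrow> M \<in> {{#}}" by (simp only: times_of_weight_0)
    then show ?thesis by (simp only: times_of_weight_def mem_Collect_eq singleton_iff)
  qed
  then have "0 \<notin># M \<and> int (sum_mset M) = 0 \<longleftrightarrow> M = {#}" by (simp only: of_nat_eq_0_iff)
  then show "mps_nth (exp_coeff e 0) M = mps_nth 1 M" by (simp only: mps_nth_exp_coeff mps_nth_one) simp
qed

lemma power_size_div_fact_mset:
  "of_nat (Suc (count M m)) * (e ^ size (add_mset m M) / fact_mset (add_mset m M)) = e * (e ^ size M / fact_mset M)"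
  by (simp add: fact_mset_add del: of_nat_Suc)

lemma pdiff_exp_coeff:
  assumes "1 \<le> m"
  shows "pdiff m (exp_coeff e n) = mps_const (fps_const e) * exp_coeff e (n - int m)"
proof (rule mps_eqI)
  fix M
  have "of_nat (Suc (count M m)) * fps_const (e ^ size (add_mset m M) / fact_mset (add_mset m M)) =
     fps_const e * fps_const (e ^ size M / fact_mset M)"
    by (simp only: fps_of_nat[symmetric] fps_const_mult power_size_div_fact_mset)
  moreover have "int (sum_mset (add_mset m M)) = n \<longleftrightarrow> int (sum_mset M) = n - int m" by auto
  moreover have "0 \<notin># add_mset m M \<longleftrightarrow> 0 \<notin># M" using assms by auto
  ultimately show "mps_nth (pdiff m (exp_coeff e n)) M = mps_nth (mps_const (fps_const e) * exp_coeff e (n - int m)) M"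
    by (simp only: mps_nth_pdiff mps_nth_const_mult mps_nth_exp_coeff) simp
qed

text \<open>This is z d/dz of the exponential. At the monomial M the factor n is distributed over
  the parts k of M, and a part removed from M accounts for the factor
  \<open>count M k\<close>.\<close>

lemma exp_coeff_newton:
  "of_nat n * exp_coeff e (int n) = mps_const (fps_const e) * (\<Sum>k=1..n. of_nat k * (var k * exp_coeff e (int n - int k)))"
proof (rule mps_eqI)
  fix M
  show "mps_nth (of_nat n * exp_coeff e (int n)) M =
    mps_nth (mps_const (fps_const e) * (\<Sum>k=1..n. of_nat k * (var k * exp_coeff e (int n - int k)))) M"
  proof (cases "M \<in> times_of_weight n")
    case True
    have "fps_const e * (of_nat k * mps_nth (var k * exp_coeff e (int n - int k)) M) =
        of_nat (k * count M k) * fps_const (e ^ size M / fact_mset M)" if k: "k \<in> {1..n}" for k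
    proof (cases "k \<in># M")
      case kM: True
      then obtain M' where M': "M = add_mset k M'" by (metis (no_types, lifting) mem_Collect_eq multi_member_split)
      have w: "0 \<notin># M'" "int (sum_mset M') = int n - int k" using True by (auto simp: M' times_of_weight_def)
      have "fps_const e * (of_nat k * fps_const (e ^ size M' / fact_mset M')) =
        of_nat (k * count M k) * fps_const (e ^ size M / fact_mset M)"
      proof -
        have "of_nat (k * count M k) * (e ^ size M / fact_mset M) =
          of_nat k * (of_nat (Suc (count M' k)) * (e ^ size (add_mset k M') / fact_mset (add_mset k M')))"
          unfolding M' by (simp only: count_add_mset of_nat_mult mult.assoc) simp
        also have "\<dots> = e * (of_nat k * (e ^ size M' / fact_mset M'))"
          by (simp only: power_size_div_fact_mset mult_ac)
        finally show ?thesis by (simp only: fps_of_nat[symmetric] fps_const_mult)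
      qed
      then show ?thesis using kM w by (simp add: mps_nth_var_mult mps_nth_exp_coeff M')
    next
      case kM: False
      then have "count M k = 0" by (simp add: not_in_iff)
      then show ?thesis using kM by (simp add: mps_nth_var_mult)
    qed
    then have "mps_nth (mps_const (fps_const e) * (\<Sum>k=1..n. of_nat k * (var k * exp_coeff e (int n - int k)))) M =
       (\<Sum>k=1..n. of_nat (k * count M k) * fps_const (e ^ size M / fact_mset M))"
      by (simp only: mps_nth_const_mult mps_nth_sum sum_distrib_left mps_nth_of_nat_mult cong: sum.cong)
    also have "\<dots> = of_nat n * fps_const (e ^ size M / fact_mset M)"
      by (simp only: sum_distrib_right[symmetric] of_nat_sum[symmetric] sum_weight_count[OF True])
    finally show ?thesis using True by (simp add: mps_nth_exp_coeff times_of_weight_def)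
  next
    case False
    have "mps_nth (var k * exp_coeff e (int n - int k)) M = 0" if "k \<in> {1..n}" for k
    proof (cases "k \<in># M")
      case True
      then obtain M' where M': "M = add_mset k M'" by (metis (no_types, lifting) mem_Collect_eq multi_member_split)
      have "\<not> (0 \<notin># M' \<and> int (sum_mset M') = int n - int k)"
        using False that by (auto simp: M' times_of_weight_def simp del: of_nat_sum_mset)
      then show ?thesis by (auto simp: mps_nth_var_mult mps_nth_exp_coeff M' simp del: of_nat_sum_mset)
    qed (simp add: mps_nth_var_mult)
    then have "mps_nth (mps_const (fps_const e) * (\<Sum>k=1..n. of_nat k * (var k * exp_coeff e (int n - int k)))) M = 0"
      by (simp add: sum.neutral)
    moreover have "mps_nth (of_nat n * exp_coeff e (int n)) M = 0"
      using False by (auto simp: mps_nth_exp_coeff times_of_weight_def simp del: of_nat_sum_mset)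
    ultimately show ?thesis by (simp only:)
  qed
qed

text \<open>Both series solve a first order linear differential equation, with opposite signs.\<close>

lemma exp_coeff_inverse:
  "(\<Sum>i\<le>n. exp_coeff (-1) (int i) * exp_coeff 1 (int (n - i))) = (if n = 0 then 1 else (0 :: 'k::field_char_0 fps mps))"
proof -
  define F :: "'k \<Rightarrow> 'k fps mps fps" where "F = (\<lambda>e. Abs_fps (\<lambda>n. exp_coeff e (int n)))"
  define P :: "'k fps mps fps" where "P = Abs_fps (\<lambda>n. of_nat (Suc n) * var (Suc n))"
  have deriv: "fps_deriv (F e) = fps_const (mps_const (fps_const e)) * (P * F e)" for e
  proof (rule fps_ext)
    fix n
    have "fps_deriv (F e) $ n = of_nat (Suc n) * exp_coeff e (int (Suc n))" by (simp add: F_def)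
    also have "\<dots> = mps_const (fps_const e) * (\<Sum>k=1..Suc n. of_nat k * (var k * exp_coeff e (int (Suc n) - int k)))"
      by (rule exp_coeff_newton)
    also have "(\<Sum>k=1..Suc n. of_nat k * (var k * exp_coeff e (int (Suc n) - int k))) =
        (\<Sum>k=0..n. of_nat (Suc k) * (var (Suc k) * exp_coeff e (int (n - k))))"
      by (rule sum.reindex_bij_witness[of _ Suc "\<lambda>k. k - 1"]) (auto simp: of_nat_diff)
    finally show "fps_deriv (F e) $ n = (fps_const (mps_const (fps_const e)) * (P * F e)) $ n"
      unfolding fps_mult_left_const_nth fps_mult_nth[of P] by (simp add: F_def P_def mult.assoc del: of_nat_Suc)
  qed
  have m1: "mps_const (fps_const (-1)) = (-1 :: 'k fps mps)" "mps_const (fps_const 1) = (1 :: 'k fps mps)"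
    by (rule mps_eqI, simp add: mps_const_def mps_nth_one flip: fps_const_neg)+
  have "fps_deriv (F (-1) * F 1) = 0"
    unfolding fps_deriv_mult deriv m1 by (simp add: algebra_simps flip: fps_const_neg)
  then have "of_nat (Suc m) * (F (-1) * F 1) $ Suc m = of_nat (Suc m) * 0" for m
    by (metis Suc_eq_plus1 fps_deriv_nth fps_zero_nth mult_zero_right)
  then have "(F (-1) * F 1) $ Suc m = 0" for m
    by (rule mps_of_nat_cancel) simp
  moreover have "(F (-1) * F 1) $ 0 = 1" by (simp add: F_def exp_coeff_0)
  ultimately have "(F (-1) * F 1) $ n = (if n = 0 then 1 else 0)" by (cases n) auto
  then show ?thesis by (simp add: fps_mult_nth F_def atLeast0AtMost)
qed

text \<open>The exponential in a variable w is multiplied by exp (w/z + (w/z)^2/2 + ...) = 1 / (1 -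
  w/z), a geometric series.\<close>

lemma shift_exp_coeff_plus: "shift 1 (exp_coeff (1 :: 'k::field_char_0) n) k = exp_coeff (1 :: 'k) (n - int k)"
proof (induction k arbitrary: n rule: less_induct)
  case (less k)
  show ?case
  proof (cases "k = 0")
    case False
    have "of_nat k * shift 1 (exp_coeff (1 :: 'k) n) k = (\<Sum>m=1..k. shift 1 (exp_coeff (1 :: 'k) (n - int m)) (k - m))"
      unfolding shift_rec mps_const_one_mult by (intro sum.cong refl) (simp only: pdiff_exp_coeff atLeastAtMost_iff mps_const_one_mult)
    also have "\<dots> = (\<Sum>m=1..k. exp_coeff (1 :: 'k) (n - int k))"
    proof (intro sum.cong refl)
      fix m assume "m \<in> {1..k}"
      then show "shift 1 (exp_coeff (1 :: 'k) (n - int m)) (k - m) = exp_coeff (1 :: 'k) (n - int k)"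
        using less.IH[of "k - m" "n - int m"] by (simp add: of_nat_diff)
    qed
    also have "\<dots> = of_nat k * exp_coeff (1 :: 'k) (n - int k)" by simp
    finally show ?thesis by (rule mps_of_nat_cancel) (use False in simp)
  qed simp
qed

text \<open>Now the exponential is multiplied by 1 - w/z, so only the powers 0 and 1 of z^-1
  survive.\<close>

lemma shift_exp_coeff_minus:
  "shift (-1) (exp_coeff (1 :: 'k::field_char_0) n) k =
     (if k = 0 then exp_coeff (1 :: 'k) n else if k = 1 then - exp_coeff (1 :: 'k) (n - 1) else 0)"
proof (induction k arbitrary: n rule: less_induct)
  case (less k)
  consider "k = 0" | "k = 1" | "k > 1" by linarith
  then show ?case
  proof cases
    case 3
    have "of_nat k * shift (-1) (exp_coeff (1 :: 'k) n) k =
      mps_const (fps_const (-1)) * (\<Sum>m=1..k. shift (-1) (exp_coeff (1 :: 'k) (n - int m)) (k - m))"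
      unfolding shift_rec
      by (intro arg_cong[where f = "(*) (mps_const (fps_const (-1)))"] sum.cong refl)
         (simp only: pdiff_exp_coeff atLeastAtMost_iff mps_const_one_mult)
    \<comment> \<open>By induction only shifts of order 0 and 1 are nonzero, and these two terms
      cancel.\<close>
    also have "(\<Sum>m=1..k. shift (-1) (exp_coeff (1 :: 'k) (n - int m)) (k - m)) =
       (\<Sum>m\<in>{k - 1, k}. shift (-1) (exp_coeff (1 :: 'k) (n - int m)) (k - m))"
    proof (intro sum.mono_neutral_right ballI)
      fix m assume "m \<in> {1..k} - {k - 1, k}"
      then have "0 < k - m" "k - m \<noteq> 1" "k - m < k" by auto
      then show "shift (-1) (exp_coeff (1 :: 'k) (n - int m)) (k - m) = 0"
        using less.IH[of "k - m" "n - int m"] by simp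
    qed (use 3 in auto)
    also have "\<dots> = shift (-1) (exp_coeff (1 :: 'k) (n - int (k - 1))) 1 + exp_coeff (1 :: 'k) (n - int k)"
      using 3 by simp
    also have "\<dots> = 0" using 3 less.IH[of 1 "n - int (k - 1)"] by (simp add: of_nat_diff)
    finally have "of_nat k * shift (-1) (exp_coeff (1 :: 'k) n) k = of_nat k * 0" by simp
    then have "shift (-1) (exp_coeff (1 :: 'k) n) k = 0" by (rule mps_of_nat_cancel) (use 3 in simp)
    then show ?thesis using 3 by simp
  next
    case 2
    have "of_nat 1 * shift (-1) (exp_coeff (1 :: 'k) n) 1 = - exp_coeff (1 :: 'k) (n - 1)"
      unfolding shift_rec by (rule mps_eqI) (simp add: pdiff_exp_coeff flip: fps_const_neg)
    then show ?thesis using 2 by simp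
  qed simp
qed

section \<open>Schur functions of the times\<close>

definition time_matrix :: "nat \<Rightarrow> nat \<Rightarrow> 'k::field_char_0 fps mps" where
  "time_matrix r s = exp_coeff 1 (int r - int s)"

text \<open>The Schur polynomial of \<open>pt A\<close> in the times, given directly by the
  Jacobi--Trudi minor with \<open>exp_coeff 1\<close> in place of the complete homogeneous
  functions.\<close>

definition time_schur :: "nat set \<Rightarrow> 'k::field_char_0 fps mps" where
  "time_schur A = minor time_matrix A {..<card A}"

lemma time_matrix_zero: "r < s \<Longrightarrow> time_matrix r s = 0"
  by (simp add: time_matrix_def exp_coeff_neg)

lemma mps_nth_sg_mult [simp]: "mps_nth (sg A r * f) M = sg A r * mps_nth f M"
proof -
  have "mps_nth ((-1) ^ n * f) M = (-1) ^ n * mps_nth f M" for n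
    by (induction n) (simp_all add: mult.assoc)
  then show ?thesis by (simp add: sg_def)
qed

text \<open>The weight is kept abstract: it is \<open>sum_mset\<close> for the times and
  \<open>size\<close> for the variables x.\<close>

lemma minor_homogeneous:
  fixes H :: "nat \<Rightarrow> nat \<Rightarrow> 'a::comm_ring_1 mps" and wt :: "nat multiset \<Rightarrow> nat"
  assumes wt: "wt {#} = 0" "\<And>P Q. wt (P + Q) = wt P + wt Q"
    and H: "\<And>r s M. mps_nth (H r s) M \<noteq> 0 \<Longrightarrow> wt M + s = r"
    and "finite A" "finite B" "mps_nth (minor H A B) M \<noteq> 0"
  shows "wt M + \<Sum>B = \<Sum>A"
  using assms(4-)
proof (induction A arbitrary: B M rule: finite_linorder_max_induct)
  case empty
  then show ?case using wt(1) by (auto simp: mps_nth_one split: if_splits)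
next
  case (insert m S)
  have "mps_nth (minor H (insert m S) B) M = (\<Sum>s\<in>B. sg B s * mps_nth (H m s * minor H S (B - {s})) M)"
    using insert.hyps by (simp add: minor_insert_top mult.assoc)
  then obtain s where s: "s \<in> B" "mps_nth (H m s * minor H S (B - {s})) M \<noteq> 0"
    using insert.prems(2) by (metis (no_types, lifting) mult_zero_right sum.neutral)
  then obtain p where p: "p \<in> mset_splits M" "mps_nth (H m s) (fst p) * mps_nth (minor H S (B - {s})) (snd p) \<noteq> 0"
    unfolding mps_nth_mult case_prod_unfold by (meson sum.not_neutral_contains_not_neutral)
  have 1: "mps_nth (H m s) (fst p) \<noteq> 0" "mps_nth (minor H S (B - {s})) (snd p) \<noteq> 0" using p(2) by auto
  have "wt (fst p) + s = m" by (rule H[OF 1(1)])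
  moreover have "wt (snd p) + \<Sum>(B - {s}) = \<Sum>S" using insert.prems(1) 1(2) by (intro insert.IH) auto
  moreover have "wt M = wt (fst p) + wt (snd p)" using p(1) wt(2) by (auto simp: mset_splits_def)
  moreover have "\<Sum>B = s + \<Sum>(B - {s})" using sum.remove[OF insert.prems(1) s(1), of "\<lambda>x. x"] by simp
  moreover have "\<Sum>(insert m S) = m + \<Sum>S" using insert.hyps by (subst sum.insert) auto
  ultimately show ?case by simp
qed

lemma time_schur_homogeneous:
  assumes "finite A" "mps_nth (time_schur A) M \<noteq> 0"
  shows "sum_mset M = psize (pt A)"
proof -
  have "sum_mset M + \<Sum>{..<card A} = \<Sum>A"
  proof (rule minor_homogeneous[of sum_mset time_matrix])
    fix r s M assume "mps_nth (time_matrix r s :: 'a fps mps) M \<noteq> 0"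
    then have "int (sum_mset M) = int r - int s"
      by (simp only: time_matrix_def mps_nth_exp_coeff split: if_splits) simp_all
    then show "sum_mset M + s = r" by linarith
  qed (use assms in \<open>auto simp: time_schur_def\<close>)
  then show ?thesis using psize_pt[OF assms(1)] by simp
qed

lemma minor_Suc_image:
  assumes H: "\<And>r s. H (Suc r) (Suc s) = H r s" and "finite A" "finite B"
  shows "minor H (Suc ` A) (Suc ` B) = minor H A B"
  using assms(2,3)
proof (induction A arbitrary: B rule: finite_linorder_max_induct)
  case empty
  then show ?case by simp
next
  case (insert m S)
  have sg: "sg (Suc ` B) (Suc s) = (sg B s :: 'a)" for s
  proof -
    have "{a \<in> Suc ` B. Suc s < a} = Suc ` {a \<in> B. s < a}" by auto
    then show ?thesis by (simp add: sg_def card_image)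
  qed
  have "minor H (Suc ` insert m S) (Suc ` B) = (\<Sum>s\<in>Suc ` B. sg (Suc ` B) s * H (Suc m) s * minor H (Suc ` S) (Suc ` B - {s}))"
    using insert.hyps by (simp add: minor_insert_top)
  also have "\<dots> = (\<Sum>s\<in>B. sg B s * H m s * minor H S (B - {s}))"
  proof -
    have "Suc ` B - {Suc s} = Suc ` (B - {s})" for s by auto
    then show ?thesis using insert by (simp add: sum.reindex sg H)
  qed
  also have "\<dots> = minor H (insert m S) B" using insert.hyps by (simp add: minor_insert_top)
  finally show ?case .
qed

text \<open>Row 0 has its only nonzero entry, a 1, in column 0. The signs of this row and column are
  (-1)^card A and (-1)^card B, which cancel.\<close>

lemma minor_insert_0:
  assumes H: "\<And>r s. H (Suc r) (Suc s) = H r s" "H 0 0 = 1" "\<And>s. H 0 (Suc s) = 0"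
    and "finite A" "finite B" "card A = card B"
  shows "minor H (insert 0 (Suc ` A)) (insert 0 (Suc ` B)) = (minor H A B :: 'a::comm_ring_1)"
proof -
  have sg0: "sg (Suc ` C) 0 = ((-1) ^ card C :: 'a)" for C
  proof -
    have "{a \<in> Suc ` C. 0 < a} = Suc ` C" by auto
    then show ?thesis by (simp add: sg_def card_image)
  qed
  let ?A = "insert 0 (Suc ` A)" and ?B = "insert 0 (Suc ` B)"
  have "minor H ?A ?B = sg ?A 0 * (\<Sum>s\<in>?B. sg ?B s * H 0 s * minor H (?A - {0}) (?B - {s}))"
    using assms(4,5) by (intro minor_remove_row) auto
  also have "(\<Sum>s\<in>?B. sg ?B s * H 0 s * minor H (?A - {0}) (?B - {s})) =
      sg ?B 0 * H 0 0 * minor H (?A - {0}) (?B - {0})"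
  proof -
    have "(\<Sum>s\<in>?B. sg ?B s * H 0 s * minor H (?A - {0}) (?B - {s})) =
       (\<Sum>s\<in>{0}. sg ?B s * H 0 s * minor H (?A - {0}) (?B - {s}))"
      by (rule sum.mono_neutral_right) (use assms(5) H(3) in auto)
    then show ?thesis by simp
  qed
  also have "?A - {0} = Suc ` A" by auto
  also have "?B - {0} = Suc ` B" by auto
  also have "minor H (Suc ` A) (Suc ` B) = minor H A B" by (rule minor_Suc_image) (use assms(4,5) H(1) in auto)
  finally show ?thesis
    using H(2) assms(6) by (simp add: sg0 flip: power_add mult.assoc)
qed

lemma time_schur_shift:
  assumes "finite A"
  shows "time_schur ({..<k} \<union> (\<lambda>a. a + k) ` A) = (time_schur A :: 'k::field_char_0 fps mps)"
proof (induction k)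
  case (Suc k)
  let ?A = "{..<k} \<union> (\<lambda>a. a + k) ` A"
  have "{..<Suc k} = insert 0 (Suc ` {..<k})" by (rule lessThan_Suc_eq_insert_0)
  then have eq: "{..<Suc k} \<union> (\<lambda>a. a + Suc k) ` A = insert 0 (Suc ` ?A)"
    by (simp add: image_Un image_image)
  have card: "card (insert 0 (Suc ` ?A)) = Suc (card ?A)" using assms by (simp add: card_image)
  have "{..<Suc (card ?A)} = insert 0 (Suc ` {..<card ?A})" by (rule lessThan_Suc_eq_insert_0)
  moreover have "minor time_matrix (insert 0 (Suc ` ?A)) (insert 0 (Suc ` {..<card ?A})) =
      (minor time_matrix ?A {..<card ?A} :: 'k fps mps)"
    using assms by (intro minor_insert_0) (auto simp: time_matrix_def exp_coeff_0 exp_coeff_neg)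
  ultimately show ?case unfolding eq time_schur_def card using Suc.IH by (simp only: time_schur_def)
qed simp

lemma time_schur_pset:
  assumes "psize \<mu> \<le> N"
  shows "time_schur (pset N \<mu>) = time_schur (pset (psize \<mu>) \<mu>)"
proof -
  have "pset (N - psize \<mu> + psize \<mu>) \<mu> = {..<N - psize \<mu>} \<union> (\<lambda>a. a + (N - psize \<mu>)) ` pset (psize \<mu>) \<mu>"
    by (rule pset_shift) (rule psize_bounds(1)[OF order_refl])
  then show ?thesis using time_schur_shift[of "pset (psize \<mu>) \<mu>" "N - psize \<mu>"] assms by simp
qed

text \<open>The formal sum of c \<mu> s_\<mu>(t). As s_\<mu>(t) is homogeneous of weight |\<mu>|,
  the restriction loses nothing and makes the sum finite; |\<mu>| particles suffice to encode
  \<mu>.\<close>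

definition kp_series :: "(partition \<Rightarrow> 'k::field_char_0 fps) \<Rightarrow> 'k fps mps" where
  "kp_series c = Abs_mps (\<lambda>M. \<Sum>\<mu> | psize \<mu> = sum_mset M. c \<mu> * mps_nth (time_schur (pset (psize \<mu>) \<mu>)) M)"

text \<open>A finite combination of minors of one common size W, as the vertex operator lemmas
  require; by \<open>kp_series_window\<close> it agrees with \<open>kp_series\<close> at low
  weight.\<close>

definition window_series :: "nat \<Rightarrow> nat \<Rightarrow> (partition \<Rightarrow> 'k::field_char_0 fps) \<Rightarrow> 'k fps mps" where
  "window_series W L c = (\<Sum>C\<in>Pow {..<L}. mps_const (on_sets W c C) * time_schur C)"

lemma kp_series_window:
  assumes "sum_mset P \<le> D" "D \<le> W" "W + D \<le> L"
  shows "mps_nth (kp_series c) P = mps_nth (window_series W L c) P"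
proof -
  have "mps_nth (window_series W L c) P =
     (\<Sum>\<mu> | part \<mu> W = 0 \<and> part \<mu> 0 + W \<le> L. on_sets W c (pset W \<mu>) * mps_nth (time_schur (pset W \<mu>)) P)"
    unfolding window_series_def mps_nth_sum mps_nth_const_mult
    by (rule sum_Pow_pset) (simp add: on_sets_def)
  also have "\<dots> = (\<Sum>\<mu> | psize \<mu> = sum_mset P. c \<mu> * mps_nth (time_schur (pset (psize \<mu>) \<mu>)) P)"
  proof (rule sum.mono_neutral_cong_right[OF finite_bounded_partitions])
    show "{\<mu>. psize \<mu> = sum_mset P} \<subseteq> {\<mu>. part \<mu> W = 0 \<and> part \<mu> 0 + W \<le> L}"
    proof
      fix \<mu> assume "\<mu> \<in> {\<mu>. psize \<mu> = sum_mset P}"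
      then have "psize \<mu> \<le> D" using assms by simp
      then have "part \<mu> D = 0" "part \<mu> 0 \<le> D" using psize_bounds by auto
      then show "\<mu> \<in> {\<mu>. part \<mu> W = 0 \<and> part \<mu> 0 + W \<le> L}"
        using part_zero_mono[of \<mu> D W] assms by simp
    qed
    show "\<forall>\<mu>\<in>{\<mu>. part \<mu> W = 0 \<and> part \<mu> 0 + W \<le> L} - {\<mu>. psize \<mu> = sum_mset P}.
       on_sets W c (pset W \<mu>) * mps_nth (time_schur (pset W \<mu>)) P = 0"
    proof
      fix \<mu> assume "\<mu> \<in> {\<mu>. part \<mu> W = 0 \<and> part \<mu> 0 + W \<le> L} - {\<mu>. psize \<mu> = sum_mset P}"
      then have "pt (pset W \<mu>) = \<mu>" "psize \<mu> \<noteq> sum_mset P" by (auto simp: pt_pset)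
      then have "mps_nth (time_schur (pset W \<mu>) :: 'a fps mps) P = 0"
        using time_schur_homogeneous[of "pset W \<mu>" P, where ?'a = 'a] by auto
      then show "on_sets W c (pset W \<mu>) * mps_nth (time_schur (pset W \<mu>)) P = 0" by simp
    qed
    fix \<mu> assume "\<mu> \<in> {\<mu>. psize \<mu> = sum_mset P}"
    then have "psize \<mu> \<le> W" using assms by simp
    then show "on_sets W c (pset W \<mu>) * mps_nth (time_schur (pset W \<mu>)) P =
       c \<mu> * mps_nth (time_schur (pset (psize \<mu>) \<mu>)) P"
      using psize_bounds(1)[of \<mu> W] by (simp add: on_sets_def pt_pset time_schur_pset[OF \<open>psize \<mu> \<le> W\<close>])
  qed
  finally show ?thesis by (simp add: kp_series_def)
qed

section \<open>Shifted Schur functions\<close>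

lemma minor_zero_column:
  assumes "finite A" "finite B" "b \<in> B" "\<And>r. r \<in> A \<Longrightarrow> H r b = 0"
  shows "minor H A B = 0"
proof -
  have "0 = (\<Sum>r\<in>A. sg A r * H r b * minor H (A - {r}) (B - {b}))" using assms(4) by simp
  also have "\<dots> = sg (B - {b}) b * minor H A (insert b (B - {b}))"
    using minor_col[of A "B - {b}" H b] assms(1,2) by simp
  finally have "sg B b * (sg B b * minor H A B) = sg B b * 0" using assms(3) by (simp add: insert_absorb)
  then show ?thesis by simp
qed

lemma minor_unitriangular:
  assumes "\<And>r. H r r = 1" "\<And>r s. r < s \<Longrightarrow> H r s = 0"
  shows "minor H {..<n} {..<n} = 1"
proof (induction n)
  case (Suc n)
  have "minor H {..<Suc n} {..<Suc n} = (\<Sum>s<Suc n. sg {..<Suc n} s * H n s * minor H {..<n} ({..<Suc n} - {s}))"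
    unfolding lessThan_Suc[of n] by (subst minor_insert_top) auto
  also have "\<dots> = (\<Sum>s\<in>{n}. sg {..<Suc n} s * H n s * minor H {..<n} ({..<Suc n} - {s}))"
  proof (rule sum.mono_neutral_right)
    show "\<forall>s\<in>{..<Suc n} - {n}. sg {..<Suc n} s * H n s * minor H {..<n} ({..<Suc n} - {s}) = 0"
    proof
      fix s assume "s \<in> {..<Suc n} - {n}"
      then have "minor H {..<n} ({..<Suc n} - {s}) = 0"
        by (intro minor_zero_column[of _ _ n]) (auto intro: assms(2))
      then show "sg {..<Suc n} s * H n s * minor H {..<n} ({..<Suc n} - {s}) = 0" by simp
    qed
  qed auto
  also have "\<dots> = 1"
  proof -
    have "{..<Suc n} - {n} = {..<n}" by auto
    moreover have "sg {..<Suc n} n = (1 :: 'a)" by (rule sg_top) auto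
    ultimately show ?thesis using Suc.IH assms(1) by simp
  qed
  finally show ?case .
qed simp

text \<open>The matrix by which the shift t \<mapsto> t - [z^-1] multiplies the time matrix from the
  right, with \<open>fps_X\<close> for z^-1; it represents the factor 1 - w/z.\<close>

definition bidiagonal :: "nat \<Rightarrow> nat \<Rightarrow> 'a::comm_ring_1 fps" where
  "bidiagonal t s = (if t = s then 1 else if t = Suc s then - fps_X else 0)"

text \<open>Deleting row j forces the diagonal entry in the columns below j and the entry - z^-1 in
  the N - j columns from j on.\<close>

lemma minor_bidiagonal:
  "j \<le> N \<Longrightarrow> minor bidiagonal ({..N} - {j}) {..<N} = (- fps_X :: 'a::comm_ring_1 fps) ^ (N - j)"
proof (induction N)
  case 0
  then have "{..0} - {j} = {}" by auto
  then show ?case by simp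
next
  case (Suc N)
  show ?case
  proof (cases "j = Suc N")
    case True
    then have "{..Suc N} - {j} = {..<Suc N}" by auto
    moreover have "minor bidiagonal {..<Suc N} {..<Suc N} = (1 :: 'a fps)"
      by (rule minor_unitriangular) (auto simp: bidiagonal_def)
    ultimately show ?thesis using True by simp
  next
    case False
    then have j: "j \<le> N" using Suc.prems by simp
    then have e: "{..Suc N} - {j} = insert (Suc N) ({..N} - {j})" by auto
    have "minor bidiagonal ({..Suc N} - {j}) {..<Suc N} =
      (\<Sum>s<Suc N. sg {..<Suc N} s * bidiagonal (Suc N) s * minor bidiagonal ({..N} - {j}) ({..<Suc N} - {s}) :: 'a fps)"
      unfolding e by (subst minor_insert_top) auto
    also have "\<dots> = (\<Sum>s\<in>{N}. sg {..<Suc N} s * bidiagonal (Suc N) s * minor bidiagonal ({..N} - {j}) ({..<Suc N} - {s}))"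
      by (rule sum.mono_neutral_right) (auto simp: bidiagonal_def)
    also have "\<dots> = - fps_X * minor bidiagonal ({..N} - {j}) {..<N}"
    proof -
      have "{..<Suc N} - {N} = {..<N}" by auto
      moreover have "sg {..<Suc N} N = (1 :: 'a fps)" by (rule sg_top) auto
      ultimately show ?thesis by (simp add: bidiagonal_def)
    qed
    also have "\<dots> = (- fps_X) ^ (Suc N - j)" using Suc.IH[OF j] j by (simp add: Suc_diff_le)
    finally show ?thesis .
  qed
qed

lemma minor_bidiagonal_zero:
  assumes "finite C" "\<not> C \<subseteq> {..N}"
  shows "minor bidiagonal C {..<N} = (0 :: 'a::comm_ring_1 fps)"
proof -
  obtain r where r: "r \<in> C" "N < r" using assms(2) by (meson atMost_iff not_le subsetI)
  have "(\<Sum>s<N. sg {..<N} s * bidiagonal r s * minor bidiagonal (C - {r}) ({..<N} - {s})) = (0 :: 'a fps)"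
    using r by (intro sum.neutral) (auto simp: bidiagonal_def)
  then show ?thesis using minor_remove_row[OF assms(1) _ r(1), of "{..<N}" "bidiagonal :: nat \<Rightarrow> nat \<Rightarrow> 'a fps"] by simp
qed

lemma fps_const_minor:
  assumes "finite A" "finite B"
  shows "minor (\<lambda>r s. fps_const (H r s)) A B = fps_const (minor H A B)"
  using hom_minor[of UNIV fps_const A B H] assms by simp

lemma fps_neg_X_power_nth: "(fps_const a * (- fps_X) ^ n) $ k = (if k = n then (-1) ^ n * a else (0 :: 'a::comm_ring_1))"
proof -
  have "(- fps_X) ^ n = (fps_const ((-1) ^ n) * fps_X ^ n :: 'a fps)"
  proof -
    have "(-1) ^ n = (fps_const ((-1) ^ n) :: 'a fps)"
      by (induction n) (simp_all flip: fps_const_mult fps_const_neg)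
    then show ?thesis by (metis power_minus)
  qed
  then show ?thesis by (simp add: fps_mult_left_const_nth fps_X_power_nth mult.commute)
qed

text \<open>In the Cauchy--Binet sum a column set C contributes only if it has N elements and lies
  in {..N}. So it misses one column j, and the bidiagonal minor has the power N - j of z^-1.\<close>

lemma shift_minus_time_schur:
  fixes A :: "nat set"
  assumes A: "finite A" "card A = N"
  shows "shift (-1) (time_schur A :: 'k::field_char_0 fps mps) k =
    (if k \<le> N then (-1) ^ k * minor time_matrix A ({..N} - {N - k}) else 0)"
proof -
  let ?T = "time_matrix :: nat \<Rightarrow> nat \<Rightarrow> 'k fps mps"
  define L where "L = Suc (Max (insert N A))"
  have L: "a < L" if "a \<in> insert N A" for a
    unfolding L_def less_Suc_eq_le using that A by (intro Max_ge) auto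
  have entry: "shift_series (-1) (?T r s) = (\<Sum>t\<in>{..<L}. fps_const (?T r t) * bidiagonal t s)"
    if "r \<in> A" "s < N" for r s
  proof -
    have s: "s < L" "Suc s < L" using L[of N] that by auto
    have "(\<Sum>t\<in>{..<L}. fps_const (?T r t) * bidiagonal t s) =
       (\<Sum>t\<in>{s, Suc s}. fps_const (?T r t) * bidiagonal t s)"
      using s by (intro sum.mono_neutral_right) (auto simp: bidiagonal_def)
    also have "\<dots> = fps_const (?T r s) - fps_const (?T r (Suc s)) * fps_X" by (simp add: bidiagonal_def)
    also have "\<dots> = shift_series (-1) (?T r s)"
    proof (rule fps_ext)
      fix k
      have e: "exp_coeff (1 :: 'k) (int r - (1 + int s)) = exp_coeff 1 (int r - int s - 1)" by (rule arg_cong) simp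
      show "(fps_const (?T r s) - fps_const (?T r (Suc s)) * fps_X) $ k = shift_series (-1) (?T r s) $ k"
        using e by (cases k) (auto simp: time_matrix_def shift_exp_coeff_minus fps_X_nth fps_mult_left_const_nth)
    qed
    finally show ?thesis ..
  qed
  have "shift_series (-1) (time_schur A) = minor (\<lambda>r s. shift_series (-1) (?T r s)) A {..<N}"
    unfolding time_schur_def using A by (simp add: shift_series_minor)
  also have "\<dots> = minor (\<lambda>r s. \<Sum>t\<in>{..<L}. fps_const (?T r t) * bidiagonal t s) A {..<N}"
    using A entry by (intro minor_cong) auto
  also have "\<dots> = (\<Sum>C\<in>Pow {..<L}. fps_const (minor ?T A C) * minor bidiagonal C {..<N})"
    using A finite_subset[OF _ finite_lessThan[of L]]
    by (subst cauchy_binet) (auto intro!: sum.cong simp: fps_const_minor)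
  also have "\<dots> = (\<Sum>C\<in>(\<lambda>j. {..N} - {j}) ` {..N}. fps_const (minor ?T A C) * minor bidiagonal C {..<N})"
  proof (rule sum.mono_neutral_right)
    show "(\<lambda>j. {..N} - {j}) ` {..N} \<subseteq> Pow {..<L}" using L[of N] by auto
    show "\<forall>C\<in>Pow {..<L} - (\<lambda>j. {..N} - {j}) ` {..N}. fps_const (minor ?T A C) * minor bidiagonal C {..<N} = 0"
    proof
      fix C assume C: "C \<in> Pow {..<L} - (\<lambda>j. {..N} - {j}) ` {..N}"
      then have fin: "finite C" using finite_subset by blast
      show "fps_const (minor ?T A C) * minor bidiagonal C {..<N} = 0"
      proof (cases "card C = N \<and> C \<subseteq> {..N}")
        case True
        then have "card ({..N} - C) = 1" using fin by (simp add: card_Diff_subset)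
        then obtain j where j: "{..N} - C = {j}" by (rule card_1_singletonE)
        then have "C = {..N} - {j}" "j \<le> N" using True by auto
        then show ?thesis using C by auto
      next
        case False
        then consider "card A \<noteq> card C" | "\<not> C \<subseteq> {..N}" using A by auto
        then show ?thesis
          by cases (simp_all add: minor_card[OF A(1) fin] minor_bidiagonal_zero[OF fin])
      qed
    qed
  qed simp
  also have "\<dots> = (\<Sum>j\<le>N. fps_const (minor ?T A ({..N} - {j})) * (- fps_X) ^ (N - j))"
  proof -
    have "inj_on (\<lambda>j. {..N} - {j}) {..N}" by (auto simp: inj_on_def)
    then show ?thesis by (simp add: sum.reindex minor_bidiagonal)
  qed
  finally have "shift (-1) (time_schur A) k = (\<Sum>j\<le>N. fps_const (minor ?T A ({..N} - {j})) * (- fps_X) ^ (N - j)) $ k"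
    by (metis shift_series_nth)
  also have "\<dots> = (\<Sum>j\<le>N. if k = N - j then (-1) ^ (N - j) * minor ?T A ({..N} - {j}) else 0)"
    by (simp only: fps_sum_nth fps_neg_X_power_nth)
  also have "\<dots> = (if k \<le> N then (-1) ^ k * minor ?T A ({..N} - {N - k}) else 0)"
  proof (cases "k \<le> N")
    case True
    have "(\<Sum>j\<le>N. if k = N - j then (-1) ^ (N - j) * minor ?T A ({..N} - {j}) else 0) =
      (\<Sum>j\<le>N. if j = N - k then (-1) ^ k * minor ?T A ({..N} - {N - k}) else 0)"
      using True by (intro sum.cong) auto
    then show ?thesis using True by simp
  qed (auto intro!: sum.neutral)
  finally show ?thesis .
qed

text \<open>The right factor for the shift t \<mapsto> t + [z^-1], inverse to
  \<open>bidiagonal\<close>; it represents 1 / (1 - w/z).\<close>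

definition geometric :: "nat \<Rightarrow> nat \<Rightarrow> 'a::comm_ring_1 fps" where
  "geometric t s = (if s \<le> t then fps_X ^ (t - s) else 0)"

lemma geometric_row: "s \<le> m' \<Longrightarrow> m' \<le> m \<Longrightarrow> geometric m s = fps_X ^ (m - m') * geometric m' s"
  by (simp add: geometric_def flip: power_add)

text \<open>On the columns {..n}, row n + k is z^-k times row n, which leaves a unitriangular
  minor.\<close>

lemma minor_geometric:
  "minor geometric (insert (n + k) {..<n}) {..<Suc n} = (fps_X ^ k :: 'a::comm_ring_1 fps)"
proof -
  have top: "minor geometric (insert m {..<n}) {..<Suc n} =
     (\<Sum>s<Suc n. sg {..<Suc n} s * geometric m s * minor geometric {..<n} ({..<Suc n} - {s}) :: 'a fps)" if "n \<le> m" for m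
    by (rule minor_insert_top) (use that in auto)
  have "minor geometric (insert (n + k) {..<n}) {..<Suc n} =
     (\<Sum>s<Suc n. fps_X ^ k * (sg {..<Suc n} s * geometric n s * minor geometric {..<n} ({..<Suc n} - {s}) :: 'a fps))"
    unfolding top[OF le_add1] by (intro sum.cong refl) (simp add: geometric_row[of _ n "n + k"])
  also have "\<dots> = fps_X ^ k * minor geometric {..<Suc n} {..<Suc n}"
    unfolding sum_distrib_left[symmetric] using top[of n] by (simp add: lessThan_Suc)
  also have "minor geometric {..<Suc n} {..<Suc n} = (1 :: 'a fps)"
    by (rule minor_unitriangular) (auto simp: geometric_def)
  finally show ?thesis by simp
qed

text \<open>Any other row set contains two rows m' < m that are at least n. These are proportional
  on the columns {..n}, so the minor vanishes.\<close>

lemma minor_geometric_zero: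
  assumes "finite C" "card C = Suc n" "\<And>k. C \<noteq> insert (n + k) {..<n}"
  shows "minor geometric C {..<Suc n} = (0 :: 'a::comm_ring_1 fps)"
proof -
  define m where "m = Max C"
  let ?S = "C - {m}"
  have "C \<noteq> {}" using assms(2) by auto
  then have m: "m \<in> C" "\<And>x. x \<in> ?S \<Longrightarrow> x < m"
    using assms(1) by (auto simp: m_def) (metis Max_ge le_neq_implies_less)
  then have C: "C = insert m ?S" by auto
  have cS: "card ?S = n" using m(1) assms(1,2) by simp
  have "\<not> ?S \<subseteq> {..<n}"
  proof
    assume "?S \<subseteq> {..<n}"
    then have S: "?S = {..<n}" using cS by (intro card_subset_eq) auto
    then have "n \<le> m" using m(2)[of m] by (metis DiffD2 insertI1 lessThan_iff not_less)
    then have "C = insert (n + (m - n)) {..<n}" using C S by simp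
    then show False using assms(3) by blast
  qed
  then obtain m' where m': "m' \<in> ?S" "n \<le> m'" by (meson lessThan_iff not_le subsetI)
  have mm: "m' < m" using m(2) m' by blast
  have "minor geometric (insert m ?S) {..<Suc n} =
     (\<Sum>s<Suc n. sg {..<Suc n} s * geometric m s * minor geometric ?S ({..<Suc n} - {s}) :: 'a fps)"
    using assms(1) m(2) by (intro minor_insert_top) auto
  also have "\<dots> = (\<Sum>s<Suc n. fps_X ^ (m - m') * (sg {..<Suc n} s * geometric m' s * minor geometric ?S ({..<Suc n} - {s})))"
    using m' mm by (intro sum.cong refl) (simp add: geometric_row[of _ m' m])
  also have "\<dots> = fps_X ^ (m - m') * (\<Sum>s<Suc n. sg {..<Suc n} s * geometric m' s * minor geometric ?S ({..<Suc n} - {s}))"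
    by (simp only: sum_distrib_left)
  also have "(\<Sum>s<Suc n. sg {..<Suc n} s * geometric m' s * minor geometric ?S ({..<Suc n} - {s})) = (0 :: 'a fps)"
    using minor_row[of ?S "{..<Suc n}" "geometric :: nat \<Rightarrow> nat \<Rightarrow> 'a fps" m'] assms(1) m' by simp
  finally show ?thesis using C by simp
qed

text \<open>By Cauchy--Binet, the only surviving column sets are {..<n} with one further element n +
  k, and their geometric minor is z^-k.\<close>

lemma shift_plus_time_schur:
  fixes A :: "nat set"
  assumes A: "finite A" "card A = Suc n"
  shows "shift 1 (time_schur A :: 'k::field_char_0 fps mps) k = minor time_matrix A (insert (n + k) {..<n})"
proof -
  let ?T = "time_matrix :: nat \<Rightarrow> nat \<Rightarrow> 'k fps mps"
  define L where "L = Suc (Max (insert n A))"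
  have L: "a < L" if "a \<in> insert n A" for a
    unfolding L_def less_Suc_eq_le using that A by (intro Max_ge) auto
  have entry: "shift_series 1 (?T r s) = (\<Sum>t\<in>{..<L}. fps_const (?T r t) * geometric t s)"
    if "r \<in> A" for r s
  proof (rule fps_ext)
    fix k
    have "(\<Sum>t\<in>{..<L}. fps_const (?T r t) * geometric t s) $ k = (\<Sum>t\<in>{..<L}. if t = s + k then ?T r t else 0)"
      unfolding fps_sum_nth
      by (intro sum.cong refl) (auto simp: geometric_def fps_mult_left_const_nth fps_X_power_nth)
    also have "\<dots> = ?T r (s + k)" using L[of r] that by (simp add: time_matrix_zero)
    also have "\<dots> = shift 1 (?T r s) k" by (simp add: time_matrix_def shift_exp_coeff_plus algebra_simps)
    finally show "shift_series 1 (?T r s) $ k = (\<Sum>t\<in>{..<L}. fps_const (?T r t) * geometric t s) $ k" by simp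
  qed
  have "shift_series 1 (time_schur A) = minor (\<lambda>r s. shift_series 1 (?T r s)) A {..<Suc n}"
    unfolding time_schur_def using A by (simp add: shift_series_minor)
  also have "\<dots> = minor (\<lambda>r s. \<Sum>t\<in>{..<L}. fps_const (?T r t) * geometric t s) A {..<Suc n}"
    using A entry by (intro minor_cong) auto
  also have "\<dots> = (\<Sum>C\<in>Pow {..<L}. fps_const (minor ?T A C) * minor geometric C {..<Suc n})"
    using A finite_subset[OF _ finite_lessThan[of L]]
    by (subst cauchy_binet) (auto intro!: sum.cong simp: fps_const_minor)
  also have "\<dots> = (\<Sum>C\<in>(\<lambda>k. insert (n + k) {..<n}) ` {..<L - n}. fps_const (minor ?T A C) * minor geometric C {..<Suc n})"
  proof (rule sum.mono_neutral_right)
    show "(\<lambda>k. insert (n + k) {..<n}) ` {..<L - n} \<subseteq> Pow {..<L}" using L[of n] by auto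
    show "\<forall>C\<in>Pow {..<L} - (\<lambda>k. insert (n + k) {..<n}) ` {..<L - n}. fps_const (minor ?T A C) * minor geometric C {..<Suc n} = 0"
    proof
      fix C assume C: "C \<in> Pow {..<L} - (\<lambda>k. insert (n + k) {..<n}) ` {..<L - n}"
      then have fin: "finite C" using finite_subset by blast
      have ne: "C \<noteq> insert (n + k) {..<n}" for k
      proof
        assume e: "C = insert (n + k) {..<n}"
        then have "k \<in> {..<L - n}" using C by auto
        then show False using C e by blast
      qed
      show "fps_const (minor ?T A C) * minor geometric C {..<Suc n} = 0"
      proof (cases "card C = Suc n")
        case True
        then show ?thesis by (simp add: minor_geometric_zero[OF fin True ne])
      next
        case False
        then show ?thesis using minor_card[of A C ?T] A fin by simp
      qed
    qed
  qed simp
  also have "\<dots> = (\<Sum>k<L - n. fps_const (minor ?T A (insert (n + k) {..<n})) * fps_X ^ k)"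
  proof -
    have "inj_on (\<lambda>k. insert (n + k) {..<n}) {..<L - n}"
    proof (rule inj_onI)
      fix x y assume "insert (n + x) {..<n} = insert (n + y) {..<n}"
      then have "n + x \<in> insert (n + y) {..<n}" by blast
      then show "x = y" by simp
    qed
    then show ?thesis by (simp add: sum.reindex minor_geometric)
  qed
  finally have "shift 1 (time_schur A) k = (\<Sum>k<L - n. fps_const (minor ?T A (insert (n + k) {..<n})) * fps_X ^ k) $ k"
    by (metis shift_series_nth)
  also have "\<dots> = (\<Sum>j<L - n. if j = k then minor ?T A (insert (n + j) {..<n}) else 0)"
    unfolding fps_sum_nth by (intro sum.cong refl) (auto simp: fps_mult_left_const_nth fps_X_power_nth)
  also have "\<dots> = minor ?T A (insert (n + k) {..<n})"
  proof (cases "k < L - n")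
    \<comment> \<open>No row of A reaches the column n + k, so the right-hand side vanishes as
      well.\<close>
    case False
    have "minor ?T A (insert (n + k) {..<n}) = 0"
    proof (rule minor_zero_column[of _ _ "n + k"])
      fix r assume "r \<in> A"
      then show "?T r (n + k) = 0" using L[of r] False by (simp add: time_matrix_zero)
    qed (use A in auto)
    then show ?thesis using False by simp
  qed simp
  finally show ?thesis .
qed

section \<open>The Hirota bilinear identity\<close>

text \<open>
  The left-hand side is the coefficient of \<open>z^(r - W)\<close> in
  \<open>exp (t\<^sub>1 z + t\<^sub>2 z^2 + \<dots>) s\<^sub>A(t - [z^-1])\<close>.
\<close>

lemma vertex_creation:
  assumes A: "finite A" "card A = W" and J: "W \<le> J"
  shows "(\<Sum>j\<le>J. exp_coeff 1 (int r - int W + int j) * shift (-1) (time_schur A) j) =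
    (if r \<in> A then 0 else sg A r * time_schur (insert r A) :: 'k::field_char_0 fps mps)"
proof -
  let ?T = "time_matrix :: nat \<Rightarrow> nat \<Rightarrow> 'k fps mps"
  have "(\<Sum>j\<le>J. exp_coeff 1 (int r - int W + int j) * shift (-1) (time_schur A) j) =
     (\<Sum>j\<le>W. exp_coeff 1 (int r - int W + int j) * ((-1) ^ j * minor ?T A ({..W} - {W - j})))"
    using J by (intro sum.mono_neutral_cong_right) (auto simp: shift_minus_time_schur[OF A])
  also have "\<dots> = (\<Sum>s\<le>W. sg {..W} s * ?T r s * minor ?T A ({..W} - {s}))"
  proof (rule sum.reindex_bij_witness[of _ "\<lambda>s. W - s" "\<lambda>j. W - j"])
    fix j assume j: "j \<in> {..W}"
    have "{x \<in> {..W}. W - j < x} = {W - j<..W}" by auto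
    then have "sg {..W} (W - j) = ((-1) ^ j :: 'k fps mps)" using j by (simp add: sg_def)
    then show "sg {..W} (W - j) * ?T r (W - j) * minor ?T A ({..W} - {W - j}) =
       exp_coeff 1 (int r - int W + int j) * ((-1) ^ j * minor ?T A ({..W} - {W - j}))"
    proof -
      have "int r - int (W - j) = int r - int W + int j" using j by (simp add: of_nat_diff)
      then show ?thesis using \<open>sg {..W} (W - j) = (-1) ^ j\<close> by (simp only: time_matrix_def mult_ac)
    qed
  qed auto
  also have "\<dots> = (if r \<in> A then 0 else sg A r * minor ?T (insert r A) {..W})"
    using A by (intro minor_row) auto
  also have "\<dots> = (if r \<in> A then 0 else sg A r * time_schur (insert r A))"
    using A by (simp add: time_schur_def lessThan_Suc_atMost)
  finally show ?thesis .
qed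

text \<open>The Toeplitz matrices of the two exponentials are inverse to each other: the terms
  vanish unless r' \<le> s \<le> r, and there \<open>exp_coeff_inverse\<close> applies.\<close>

lemma exp_coeff_convolution:
  assumes "r \<le> T"
  shows "(\<Sum>s\<le>T. exp_coeff (-1) (int s - int r') * exp_coeff 1 (int r - int s)) =
    (if r = r' then 1 else (0 :: 'k::field_char_0 fps mps))"
proof -
  have "(\<Sum>s\<le>T. exp_coeff (-1) (int s - int r') * exp_coeff 1 (int r - int s)) =
    (\<Sum>s\<in>{r'..r}. exp_coeff (-1) (int s - int r') * exp_coeff 1 (int r - int s) :: 'k fps mps)"
    using assms by (intro sum.mono_neutral_right) (auto simp: exp_coeff_neg not_le)
  also have "\<dots> = (if r = r' then 1 else 0)"
  proof (cases "r' \<le> r")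
    case True
    have "(\<Sum>s\<in>{r'..r}. exp_coeff (-1) (int s - int r') * exp_coeff 1 (int r - int s)) =
      (\<Sum>i\<le>r - r'. exp_coeff (-1) (int i) * exp_coeff 1 (int (r - r' - i)) :: 'k fps mps)"
      by (rule sum.reindex_bij_witness[of _ "\<lambda>i. r' + i" "\<lambda>s. s - r'"]) (use True in \<open>auto simp: of_nat_diff algebra_simps\<close>)
    also have "\<dots> = (if r - r' = 0 then 1 else 0)" by (rule exp_coeff_inverse)
    finally show ?thesis using True by auto
  qed auto
  finally show ?thesis .
qed

text \<open>
  The left-hand side is the coefficient of \<open>z^(n - r')\<close> in
  \<open>exp (- t\<^sub>1 z - t\<^sub>2 z^2 - \<dots>) s\<^sub>A(t + [z^-1])\<close>.
\<close>

lemma vertex_annihilation: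
  assumes A: "finite A" "card A = Suc n" and J: "\<And>a. a \<in> A \<Longrightarrow> a \<le> J"
  shows "(\<Sum>k\<le>J. exp_coeff (-1) (int n + int k - int r') * shift 1 (time_schur A) k) =
    (if r' \<in> A then sg A r' * time_schur (A - {r'}) else 0 :: 'k::field_char_0 fps mps)"
proof -
  let ?T = "time_matrix :: nat \<Rightarrow> nat \<Rightarrow> 'k fps mps"
  \<comment> \<open>A column expansion with the column s adjoined to {..<n}. For s < n this column
    is repeated and F vanishes, so the sum over s may start at 0, as
    \<open>exp_coeff_convolution\<close> needs.\<close>
  define F where "F = (\<lambda>s. \<Sum>r\<in>A. sg A r * ?T r s * minor ?T (A - {r}) {..<n})"
  have F: "F s = (if s < n then 0 else minor ?T A (insert s {..<n}))" for s
  proof -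
    have "sg {..<n} s = (1 :: 'k fps mps)" if "\<not> s < n" using that by (intro sg_top) auto
    then show ?thesis using minor_col[of A "{..<n}" ?T s] A by (simp add: F_def)
  qed
  have "(\<Sum>k\<le>J. exp_coeff (-1) (int n + int k - int r') * shift 1 (time_schur A) k) =
    (\<Sum>k\<le>J. exp_coeff (-1) (int (n + k) - int r') * F (n + k))"
    by (simp add: shift_plus_time_schur[OF A] F)
  also have "\<dots> = (\<Sum>s\<in>{n..n + J}. exp_coeff (-1) (int s - int r') * F s)"
    by (rule sum.reindex_bij_witness[of _ "\<lambda>s. s - n" "\<lambda>k. n + k"]) auto
  also have "\<dots> = (\<Sum>s\<le>n + J. exp_coeff (-1) (int s - int r') * F s)"
    by (intro sum.mono_neutral_left) (auto simp: F)
  also have "\<dots> = (\<Sum>r\<in>A. sg A r * minor ?T (A - {r}) {..<n} *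
      (\<Sum>s\<le>n + J. exp_coeff (-1) (int s - int r') * exp_coeff 1 (int r - int s)))"
    unfolding F_def sum_distrib_left by (subst sum.swap) (simp add: time_matrix_def mult_ac)
  also have "\<dots> = (\<Sum>r\<in>A. if r = r' then sg A r' * minor ?T (A - {r'}) {..<n} else 0)"
    using J by (intro sum.cong refl) (auto simp: exp_coeff_convolution trans_le_add2)
  also have "\<dots> = (if r' \<in> A then sg A r' * time_schur (A - {r'}) else 0)"
    using A by (simp add: time_schur_def)
  finally show ?thesis .
qed

lemma hirota_exp_coeff_eq:
  "hirota_exp_coeff A B = (1 / fact_mset A) * ((-1) ^ size B / fact_mset B)"
proof -
  have "(\<Prod>n\<in>set_mset A. 1 / fact (count A n)) = (1 / fact_mset A :: 'a)"
    by (simp add: fact_mset_def prod_dividef)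
  moreover have "(\<Prod>n\<in>set_mset B. (-1) ^ count B n / fact (count B n)) = ((-1) ^ size B / fact_mset B :: 'a)"
    by (simp add: fact_mset_def prod_dividef size_multiset_overloaded_eq flip: power_sum)
  ultimately show ?thesis by (simp add: hirota_exp_coeff_def)
qed

text \<open>
  The coefficient of \<open>z^-1\<close> of the product is split over the powers \<open>z^(r - W)\<close> and
  \<open>z^(W - 1 - r)\<close> of its \<open>t\<close>- and \<open>t'\<close>-dependent factors; \<open>W\<close> is large enough to make \<open>r\<close> nonnegative.
\<close>

lemma hirota_sum_eq:
  fixes f g :: "'k::field_char_0 fps mps"
  assumes M: "0 \<notin># M" "0 \<notin># K" and W: "sum_mset M + sum_mset K + 1 \<le> W" and L: "2 * W < L"
  shows "(\<Sum>(A, A') \<in> mset_splits M. \<Sum>(B, B') \<in> mset_splits K.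
        \<Sum>(j, k) | j + k = sum_mset A + sum_mset B + 1.
          fps_const (hirota_exp_coeff A B) * mps_nth (shift (-1) f j) A' * mps_nth (shift 1 g k) B') =
    (\<Sum>r<L. mps_nth (\<Sum>j\<le>L. exp_coeff 1 (int r - int W + int j) * shift (-1) f j) M *
       mps_nth (\<Sum>k\<le>L. exp_coeff (-1) (int (W - 1) + int k - int r) * shift 1 g k) K)"
proof -
  define a where "a = (\<lambda>A. fps_const (1 / fact_mset A) :: 'k fps)"
  define b where "b = (\<lambda>B. fps_const ((-1) ^ size B / fact_mset B) :: 'k fps)"
  define F where "F = (\<lambda>A A' j. a A * mps_nth (shift (-1) f j) A')"
  define G where "G = (\<lambda>B B' k. b B * mps_nth (shift 1 g k) B')"
  have 1: "mps_nth (\<Sum>j\<le>L. exp_coeff 1 (int r - int W + int j) * shift (-1) f j) M =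
    (\<Sum>(A, A') \<in> mset_splits M. \<Sum>j\<le>L. if r + j = sum_mset A + W then F A A' j else 0)" for r
  proof -
    have "mps_nth (\<Sum>j\<le>L. exp_coeff 1 (int r - int W + int j) * shift (-1) f j) M =
      (\<Sum>(A, A') \<in> mset_splits M. \<Sum>j\<le>L. mps_nth (exp_coeff 1 (int r - int W + int j)) A * mps_nth (shift (-1) f j) A')"
      unfolding mps_nth_sum mps_nth_mult case_prod_unfold by (rule sum.swap)
    also have "\<dots> = (\<Sum>(A, A') \<in> mset_splits M. \<Sum>j\<le>L. if r + j = sum_mset A + W then F A A' j else 0)"
    proof (intro sum.cong refl, clarify, intro sum.cong refl)
      fix A A' j assume "(A, A') \<in> mset_splits M"
      then have "0 \<notin># A" using M by (auto simp: mset_splits_def)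
      moreover have "int (sum_mset A) = int r - int W + int j \<longleftrightarrow> r + j = sum_mset A + W" by linarith
      ultimately show "mps_nth (exp_coeff 1 (int r - int W + int j)) A * mps_nth (shift (-1) f j) A' =
         (if r + j = sum_mset A + W then F A A' j else 0)"
        by (simp add: mps_nth_exp_coeff F_def a_def del: of_nat_sum_mset)
    qed
    finally show ?thesis .
  qed
  have 2: "mps_nth (\<Sum>k\<le>L. exp_coeff (-1) (int (W - 1) + int k - int r) * shift 1 g k) K =
    (\<Sum>(B, B') \<in> mset_splits K. \<Sum>k\<le>L. if W + k = sum_mset B + r + 1 then G B B' k else 0)" for r
  proof -
    have "mps_nth (\<Sum>k\<le>L. exp_coeff (-1) (int (W - 1) + int k - int r) * shift 1 g k) K =
      (\<Sum>(B, B') \<in> mset_splits K. \<Sum>k\<le>L. mps_nth (exp_coeff (-1) (int (W - 1) + int k - int r)) B * mps_nth (shift 1 g k) B')"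
      unfolding mps_nth_sum mps_nth_mult case_prod_unfold by (rule sum.swap)
    also have "\<dots> = (\<Sum>(B, B') \<in> mset_splits K. \<Sum>k\<le>L. if W + k = sum_mset B + r + 1 then G B B' k else 0)"
    proof (intro sum.cong refl, clarify, intro sum.cong refl)
      fix B B' k assume "(B, B') \<in> mset_splits K"
      then have "0 \<notin># B" using M by (auto simp: mset_splits_def)
      moreover have "int (sum_mset B) = int (W - 1) + int k - int r \<longleftrightarrow> W + k = sum_mset B + r + 1" using W by linarith
      ultimately show "mps_nth (exp_coeff (-1) (int (W - 1) + int k - int r)) B * mps_nth (shift 1 g k) B' =
         (if W + k = sum_mset B + r + 1 then G B B' k else 0)"
        by (simp add: mps_nth_exp_coeff G_def b_def del: of_nat_sum_mset)
    qed
    finally show ?thesis .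
  qed
  have inner: "(\<Sum>r<L. (\<Sum>j\<le>L. if r + j = sum_mset A + W then F A A' j else 0) *
       (\<Sum>k\<le>L. if W + k = sum_mset B + r + 1 then G B B' k else 0)) =
     (\<Sum>(j, k) | j + k = sum_mset A + sum_mset B + 1. F A A' j * G B B' k)"
    if AB: "(A, A') \<in> mset_splits M" "(B, B') \<in> mset_splits K" for A A' B B'
  proof -
    have le: "sum_mset A \<le> sum_mset M" "sum_mset B \<le> sum_mset K" using AB by (auto simp: mset_splits_def)
    have "(\<Sum>r<L. (\<Sum>j\<le>L. if r + j = sum_mset A + W then F A A' j else 0) *
       (\<Sum>k\<le>L. if W + k = sum_mset B + r + 1 then G B B' k else 0)) =
      (\<Sum>(r, j, k)\<in>{..<L} \<times> {..L} \<times> {..L}. if r + j = sum_mset A + W \<and> W + k = sum_mset B + r + 1 then F A A' j * G B B' k else 0)"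
      by (simp add: sum_product sum.cartesian_product case_prod_unfold) (intro sum.cong, auto)
    also have "\<dots> = (\<Sum>(r, j, k)\<in>{(r, j, k). r < L \<and> j \<le> L \<and> k \<le> L \<and> r + j = sum_mset A + W \<and> W + k = sum_mset B + r + 1}.
        F A A' j * G B B' k)"
      by (rule sum.mono_neutral_cong_right) (auto split: if_splits)
    also have "\<dots> = (\<Sum>(j, k) | j + k = sum_mset A + sum_mset B + 1. F A A' j * G B B' k)"
      by (rule sum.reindex_bij_witness[of _ "\<lambda>(j, k). (sum_mset A + W - j, j, k)" "\<lambda>(r, j, k). (j, k)"])
         (use le W L in auto)
    finally show ?thesis .
  qed
  have "(\<Sum>r<L. mps_nth (\<Sum>j\<le>L. exp_coeff 1 (int r - int W + int j) * shift (-1) f j) M *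
       mps_nth (\<Sum>k\<le>L. exp_coeff (-1) (int (W - 1) + int k - int r) * shift 1 g k) K) =
    (\<Sum>r<L. \<Sum>(A, A') \<in> mset_splits M. \<Sum>(B, B') \<in> mset_splits K.
       (\<Sum>j\<le>L. if r + j = sum_mset A + W then F A A' j else 0) * (\<Sum>k\<le>L. if W + k = sum_mset B + r + 1 then G B B' k else 0))"
    unfolding 1 2 by (simp only: sum_product case_prod_unfold)
  also have "\<dots> = (\<Sum>(A, A') \<in> mset_splits M. \<Sum>(B, B') \<in> mset_splits K. \<Sum>r<L.
       (\<Sum>j\<le>L. if r + j = sum_mset A + W then F A A' j else 0) * (\<Sum>k\<le>L. if W + k = sum_mset B + r + 1 then G B B' k else 0))"
    unfolding case_prod_unfold by (subst sum.swap, intro sum.cong refl, rule sum.swap)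
  also have "\<dots> = (\<Sum>(A, A') \<in> mset_splits M. \<Sum>(B, B') \<in> mset_splits K.
      \<Sum>(j, k) | j + k = sum_mset A + sum_mset B + 1. F A A' j * G B B' k)"
    by (intro sum.cong refl, clarify, intro sum.cong refl, clarify) (rule inner)
  also have "\<dots> = (\<Sum>(A, A') \<in> mset_splits M. \<Sum>(B, B') \<in> mset_splits K.
        \<Sum>(j, k) | j + k = sum_mset A + sum_mset B + 1.
          fps_const (hirota_exp_coeff A B) * mps_nth (shift (-1) f j) A' * mps_nth (shift 1 g k) B')"
    unfolding F_def G_def a_def b_def hirota_exp_coeff_eq fps_const_mult[symmetric] case_prod_unfold
    by (simp only: mult_ac)
  finally show ?thesis ..
qed

theorem kp_tau_function_kp_series:
  fixes c :: "partition \<Rightarrow> 'k::field_char_0 fps"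
  assumes c: "plucker_part c"
  shows "kp_tau_function (kp_series c)"
  unfolding kp_tau_function_def
proof (intro allI impI)
  fix M K :: "nat multiset" assume MK: "0 \<notin># M" "0 \<notin># K"
  \<comment> \<open>A term with A' and j involves the series at weight |A'| + j, and the condition
    on j and k bounds this by |M| + |K| + 1.\<close>
  define W where "W = sum_mset M + sum_mset K + 1"
  \<comment> \<open>Room for W particles and for partitions of size at most W.\<close>
  define L where "L = Suc (2 * W)"
  define n where "n = W - 1"
  have n: "W = Suc n" by (simp add: n_def W_def)
  let ?U = "Pow {..<L}"
  let ?v = "on_sets W c"
  let ?\<tau> = "window_series W L c"
  have shift_eq: "tau_shift e (kp_series c) j P = mps_nth (shift e ?\<tau> j) P" if "sum_mset P + j \<le> W" for e j P
  proof -
    have "mps_nth (kp_series c) (P + G) = mps_nth ?\<tau> (P + G)" if "G \<in> times_of_weight j" for G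
      using that \<open>sum_mset P + j \<le> W\<close> by (intro kp_series_window[of _ W]) (auto simp: times_of_weight_def L_def)
    then show ?thesis unfolding mps_nth_shift tau_shift_eq by (intro sum.cong) auto
  qed
  have lin: "shift e ?\<tau> j = (\<Sum>C\<in>?U. mps_const (?v C) * shift e (time_schur C) j)" for e j
  proof -
    have "shift e (\<Sum>C\<in>X. mps_const (?v C) * time_schur C) j = (\<Sum>C\<in>X. mps_const (?v C) * shift e (time_schur C) j)" if "finite X" for X
      using that
    proof (induction X rule: finite_induct)
      case empty
      show ?case by (rule mps_eqI) (simp add: mps_nth_shift)
    qed (simp add: shift_add shift_const_mult)
    then show ?thesis by (simp add: window_series_def)
  qed
  have fin: "finite C" if "C \<in> ?U" for C using that finite_subset by blast
  have create: "mps_nth (\<Sum>j\<le>L. exp_coeff 1 (int r - int W + int j) * shift (-1) ?\<tau> j) M =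
     (\<Sum>C\<in>?U. ?v C * (if r \<in> C then 0 else sg C r * mps_nth (time_schur (insert r C)) M))" for r
  proof -
    have "(\<Sum>j\<le>L. exp_coeff 1 (int r - int W + int j) * shift (-1) ?\<tau> j) =
      (\<Sum>C\<in>?U. mps_const (?v C) * (\<Sum>j\<le>L. exp_coeff 1 (int r - int W + int j) * shift (-1) (time_schur C) j))"
      unfolding lin sum_distrib_left by (subst sum.swap) (simp only: mult_ac)
    then have "mps_nth (\<Sum>j\<le>L. exp_coeff 1 (int r - int W + int j) * shift (-1) ?\<tau> j) M =
      (\<Sum>C\<in>?U. ?v C * mps_nth (\<Sum>j\<le>L. exp_coeff 1 (int r - int W + int j) * shift (-1) (time_schur C) j) M)"
      by (simp only: mps_nth_sum mps_nth_const_mult)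
    also have "\<dots> = (\<Sum>C\<in>?U. ?v C * (if r \<in> C then 0 else sg C r * mps_nth (time_schur (insert r C)) M))"
    proof (intro sum.cong refl)
      fix C assume C: "C \<in> ?U"
      show "?v C * mps_nth (\<Sum>j\<le>L. exp_coeff 1 (int r - int W + int j) * shift (-1) (time_schur C) j) M =
        ?v C * (if r \<in> C then 0 else sg C r * mps_nth (time_schur (insert r C)) M)"
      proof (cases "card C = W")
        case True
        then show ?thesis using vertex_creation[OF fin[OF C] True, of L r, where ?'k = 'k] by (simp add: L_def)
      qed (simp add: on_sets_def)
    qed
    finally show ?thesis .
  qed
  have annihilate: "mps_nth (\<Sum>k\<le>L. exp_coeff (-1) (int (W - 1) + int k - int r) * shift 1 ?\<tau> k) K =
     (\<Sum>C\<in>?U. ?v C * (if r \<in> C then sg C r * mps_nth (time_schur (C - {r})) K else 0))" for r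
  proof -
    have "(\<Sum>k\<le>L. exp_coeff (-1) (int (W - 1) + int k - int r) * shift 1 ?\<tau> k) =
      (\<Sum>C\<in>?U. mps_const (?v C) * (\<Sum>k\<le>L. exp_coeff (-1) (int (W - 1) + int k - int r) * shift 1 (time_schur C) k))"
      unfolding lin sum_distrib_left by (subst sum.swap) (simp only: mult_ac)
    then have "mps_nth (\<Sum>k\<le>L. exp_coeff (-1) (int (W - 1) + int k - int r) * shift 1 ?\<tau> k) K =
      (\<Sum>C\<in>?U. ?v C * mps_nth (\<Sum>k\<le>L. exp_coeff (-1) (int (W - 1) + int k - int r) * shift 1 (time_schur C) k) K)"
      by (simp only: mps_nth_sum mps_nth_const_mult)
    also have "\<dots> = (\<Sum>C\<in>?U. ?v C * (if r \<in> C then sg C r * mps_nth (time_schur (C - {r})) K else 0))"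
    proof (intro sum.cong refl)
      fix C assume C: "C \<in> ?U"
      show "?v C * mps_nth (\<Sum>k\<le>L. exp_coeff (-1) (int (W - 1) + int k - int r) * shift 1 (time_schur C) k) K =
        ?v C * (if r \<in> C then sg C r * mps_nth (time_schur (C - {r})) K else 0)"
      proof (cases "card C = W")
        case True
        then have cC: "card C = Suc n" using n by simp
        have "a \<le> L" if "a \<in> C" for a using that C by auto
        from vertex_annihilation[OF fin[OF C] cC this, of r, where ?'k = 'k]
        show ?thesis by (simp add: n_def)
      qed (simp add: on_sets_def)
    qed
    finally show ?thesis .
  qed
  have "(\<Sum>(A, A') \<in> mset_splits M. \<Sum>(B, B') \<in> mset_splits K.
        \<Sum>(j, k) | j + k = sum_mset A + sum_mset B + 1.
          fps_const (hirota_exp_coeff A B) * tau_shift (-1) (kp_series c) j A' * tau_shift 1 (kp_series c) k B') =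
    (\<Sum>(A, A') \<in> mset_splits M. \<Sum>(B, B') \<in> mset_splits K.
        \<Sum>(j, k) | j + k = sum_mset A + sum_mset B + 1.
          fps_const (hirota_exp_coeff A B) * mps_nth (shift (-1) ?\<tau> j) A' * mps_nth (shift 1 ?\<tau> k) B')"
  proof (intro sum.cong refl, clarify, intro sum.cong refl, clarify, intro sum.cong refl, clarify)
    fix A A' B B' j k
    assume "(A, A') \<in> mset_splits M" "(B, B') \<in> mset_splits K" and jk: "j + k = sum_mset A + sum_mset B + 1"
    then have "sum_mset M = sum_mset A + sum_mset A'" "sum_mset K = sum_mset B + sum_mset B'"
      by (auto simp: mset_splits_def)
    then have "sum_mset A' + j \<le> W" "sum_mset B' + k \<le> W" using jk by (simp_all add: W_def)
    then show "fps_const (hirota_exp_coeff A B) * tau_shift (-1) (kp_series c) j A' * tau_shift 1 (kp_series c) k B' =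
      fps_const (hirota_exp_coeff A B) * mps_nth (shift (-1) ?\<tau> j) A' * mps_nth (shift 1 ?\<tau> k) B'"
      by (simp only: shift_eq)
  qed
  also have "\<dots> = (\<Sum>r<L. mps_nth (\<Sum>j\<le>L. exp_coeff 1 (int r - int W + int j) * shift (-1) ?\<tau> j) M *
       mps_nth (\<Sum>k\<le>L. exp_coeff (-1) (int (W - 1) + int k - int r) * shift 1 ?\<tau> k) K)"
    by (rule hirota_sum_eq[OF MK]) (simp_all add: W_def L_def)
  also have "\<dots> = (\<Sum>r<L. \<Sum>C\<in>?U. \<Sum>C'\<in>?U.
      (?v C * (if r \<in> C then 0 else sg C r * mps_nth (time_schur (insert r C)) M)) *
      (?v C' * (if r \<in> C' then sg C' r * mps_nth (time_schur (C' - {r})) K else 0)))"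
    unfolding create annihilate by (simp only: sum_product)
  also have "\<dots> = (\<Sum>(r, C, C')\<in>{(r, C, C'). C \<in> ?U \<and> C' \<in> ?U \<and> r \<in> C' \<and> r \<notin> C}.
      (?v C * (sg C r * mps_nth (time_schur (insert r C)) M)) *
      (?v C' * (sg C' r * mps_nth (time_schur (C' - {r})) K)))"
    unfolding sum.cartesian_product by (rule sum.mono_neutral_cong_right) (auto split: if_splits)
  \<comment> \<open>With S = \<open>insert r C\<close> and S' = \<open>C' - {r}\<close>, the product
    of the two Schur polynomials no longer depends on r, and the sum over r becomes a Pluecker
    relation.\<close>
  also have "\<dots> = (\<Sum>(S, S', r)\<in>Sigma ?U (\<lambda>S. Sigma ?U (\<lambda>S'. S - S')).
      mps_nth (time_schur S) M * mps_nth (time_schur S') K * (sg S r * sg S' r * ?v (S - {r}) * ?v (insert r S')))"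
    by (rule sum.reindex_bij_witness[of _ "\<lambda>(S, S', r). (r, S - {r}, insert r S')" "\<lambda>(r, C, C'). (insert r C, C' - {r}, r)"])
       (auto simp: insert_absorb mult_ac)
  also have "\<dots> = (\<Sum>S\<in>?U. \<Sum>S'\<in>?U. mps_nth (time_schur S) M * mps_nth (time_schur S') K *
      (\<Sum>r\<in>S - S'. sg S r * sg S' r * ?v (S - {r}) * ?v (insert r S')))"
  proof -
    have f1: "finite (S - S')" if "S \<in> ?U" for S S' using fin[OF that] by simp
    then have f2: "finite (Sigma ?U (\<lambda>S'. S - S'))" if "S \<in> ?U" for S using that by (intro finite_SigmaI) auto
    show ?thesis by (simp add: sum.Sigma f1 f2 sum_distrib_left)
  qed
  also have "\<dots> = 0"
  proof -
    have "plucker L ?v" using c unfolding plucker_part_iff by blast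
    then show ?thesis by (simp add: plucker_def)
  qed
  finally show "(\<Sum>(A, A') \<in> mset_splits M. \<Sum>(B, B') \<in> mset_splits K.
        \<Sum>(j, k) | j + k = sum_mset A + sum_mset B + 1.
          fps_const (hirota_exp_coeff A B) * tau_shift (-1) (kp_series c) j A' * tau_shift 1 (kp_series c) k B') = 0" .
qed

section \<open>The Miwa substitution\<close>

definition power_sum_monomial :: "nat multiset \<Rightarrow> 'k::field_char_0 fps mps" where
  "power_sum_monomial M = (\<Prod>n\<in>#M. mps_const (fps_const (1 / of_nat n)) * power_sum n)"

lemma mps_nth_miwa:
  "mps_nth (miwa_substitution f) N =
     (\<Sum>M\<in>times_of_weight (size N). mps_nth f M * mps_nth (power_sum_monomial M) N)"
  by (simp add: miwa_substitution_def times_of_weight_def power_sum_monomial_def)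

lemma power_sum_monomial_homogeneous:
  "mps_nth (power_sum_monomial M :: 'a::field_char_0 fps mps) N \<noteq> 0 \<Longrightarrow> sum_mset M = size N"
proof (induction M arbitrary: N)
  case empty
  then show ?case by (auto simp: power_sum_monomial_def mps_nth_one split: if_splits)
next
  case (add n M)
  have "mps_nth (power_sum_monomial (add_mset n M)) N =
     fps_const (1 / of_nat n) * mps_nth (power_sum n * power_sum_monomial M :: 'a fps mps) N"
    by (simp add: power_sum_monomial_def mult.assoc)
  then have "mps_nth (power_sum n * power_sum_monomial M :: 'a fps mps) N \<noteq> 0" using add.prems by auto
  then obtain p where p: "p \<in> mset_splits N"
    "mps_nth (power_sum n) (fst p) * mps_nth (power_sum_monomial M :: 'a fps mps) (snd p) \<noteq> 0"
    unfolding mps_nth_mult case_prod_unfold by (meson sum.not_neutral_contains_not_neutral)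
  have "mps_nth (power_sum n :: 'a fps mps) (fst p) \<noteq> 0" "mps_nth (power_sum_monomial M :: 'a fps mps) (snd p) \<noteq> 0"
    using p(2) by auto
  then have "size (fst p) = n" "sum_mset M = size (snd p)"
    using add.IH by (auto simp: power_sum_def split: if_splits)
  then show ?case using p(1) by (auto simp: mset_splits_def)
qed

lemma miwa_add: "miwa_substitution (f + g) = miwa_substitution f + miwa_substitution g"
  by (rule mps_eqI) (simp add: mps_nth_miwa distrib_right sum.distrib)

lemma miwa_const_mult: "miwa_substitution (mps_const a * f) = mps_const a * miwa_substitution f"
  by (rule mps_eqI) (simp add: mps_nth_miwa sum_distrib_left mult.assoc)

lemma miwa_of_nat_mult: "miwa_substitution (of_nat n * f) = of_nat n * miwa_substitution f"
  by (simp only: of_nat_mps miwa_const_mult)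

lemma miwa_single:
  assumes "0 \<notin># K" "\<And>M. mps_nth f M = (if M = K then 1 else 0)"
  shows "miwa_substitution f = power_sum_monomial K"
proof (rule mps_eqI)
  fix N
  have "mps_nth (miwa_substitution f) N =
      (\<Sum>M\<in>times_of_weight (size N). if M = K then mps_nth (power_sum_monomial K) N else 0)"
    unfolding mps_nth_miwa assms(2) by (intro sum.cong) auto
  also have "\<dots> = (if K \<in> times_of_weight (size N) then mps_nth (power_sum_monomial K) N else 0)"
    by (simp add: finite_times_of_weight)
  also have "\<dots> = mps_nth (power_sum_monomial K) N"
    using power_sum_monomial_homogeneous[of K N, where ?'a = 'a] assms(1) by (auto simp: times_of_weight_def)
  finally show "mps_nth (miwa_substitution f) N = mps_nth (power_sum_monomial K) N" .
qed

lemma miwa_one: "miwa_substitution 1 = 1"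
  using miwa_single[of "{#}" 1] by (simp add: mps_nth_one power_sum_monomial_def)

lemma miwa_var: "1 \<le> k \<Longrightarrow> miwa_substitution (var k) = mps_const (fps_const (1 / of_nat k)) * power_sum k"
  using miwa_single[of "{#k#}" "var k"] by (simp add: var_def power_sum_monomial_def)

lemma miwa_mult: "miwa_substitution (f * g) = miwa_substitution f * miwa_substitution g"
proof (rule mps_eqI)
  fix N :: "nat multiset"
  let ?P = power_sum_monomial
  \<comment> \<open>All pairs arising from splits of monomials of weight \<open>size N\<close>. For
    fixed N1 and N2, homogeneity leaves only those of weights \<open>size N1\<close> and
    \<open>size N2\<close>.\<close>
  define X where "X = {(P, Q). P + Q \<in> times_of_weight (size N)}"
  have X: "X = snd ` Sigma (times_of_weight (size N)) mset_splits" by (force simp: X_def mset_splits_def)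
  have finX: "finite X" unfolding X by (intro finite_imageI finite_SigmaI finite_times_of_weight finite_mset_splits)
  have "mps_nth (miwa_substitution (f * g)) N =
     (\<Sum>M\<in>times_of_weight (size N). \<Sum>(P, Q)\<in>mset_splits M. mps_nth f P * mps_nth g Q * mps_nth (?P P * ?P Q) N)"
    unfolding mps_nth_miwa mps_nth_mult[of f g] sum_distrib_right
    by (intro sum.cong refl) (auto simp: mset_splits_def power_sum_monomial_def)
  also have "\<dots> = (\<Sum>(P, Q)\<in>X. mps_nth f P * mps_nth g Q * mps_nth (?P P * ?P Q) N)"
    unfolding sum.Sigma[OF finite_times_of_weight ballI[OF finite_mset_splits]]
    by (rule sum.reindex_bij_witness[of _ "\<lambda>(P, Q). (P + Q, P, Q)" snd]) (auto simp: X_def mset_splits_def)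
  also have "\<dots> = (\<Sum>(N1, N2)\<in>mset_splits N. \<Sum>(P, Q)\<in>X.
      mps_nth f P * mps_nth g Q * (mps_nth (?P P) N1 * mps_nth (?P Q) N2))"
    unfolding mps_nth_mult[of "?P _"] sum_distrib_left case_prod_unfold by (rule sum.swap)
  also have "\<dots> = (\<Sum>(N1, N2)\<in>mset_splits N. mps_nth (miwa_substitution f) N1 * mps_nth (miwa_substitution g) N2)"
  proof (rule sum.cong[OF refl], simp only: split_paired_all case_prod_conv)
    fix N1 N2 assume N: "(N1, N2) \<in> mset_splits N"
    have "(\<Sum>(P, Q)\<in>X. mps_nth f P * mps_nth g Q * (mps_nth (?P P) N1 * mps_nth (?P Q) N2)) =
      (\<Sum>(P, Q)\<in>times_of_weight (size N1) \<times> times_of_weight (size N2).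
        mps_nth f P * mps_nth g Q * (mps_nth (?P P) N1 * mps_nth (?P Q) N2))"
    proof (rule sum.mono_neutral_right[OF finX])
      show "times_of_weight (size N1) \<times> times_of_weight (size N2) \<subseteq> X"
        using N by (auto simp: X_def times_of_weight_def mset_splits_def)
      show "\<forall>p\<in>X - times_of_weight (size N1) \<times> times_of_weight (size N2).
         (case p of (P, Q) \<Rightarrow> mps_nth f P * mps_nth g Q * (mps_nth (?P P) N1 * mps_nth (?P Q) N2)) = 0"
      proof
        fix p assume p: "p \<in> X - times_of_weight (size N1) \<times> times_of_weight (size N2)"
        obtain P Q where PQ: "p = (P, Q)" by (cases p)
        have "\<not> (sum_mset P = size N1 \<and> sum_mset Q = size N2)" 
          using p by (auto simp: PQ X_def times_of_weight_def)
        then have "mps_nth (?P P :: 'a fps mps) N1 = 0 \<or> mps_nth (?P Q :: 'a fps mps) N2 = 0"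
          using power_sum_monomial_homogeneous by blast
        then show "(case p of (P, Q) \<Rightarrow> mps_nth f P * mps_nth g Q * (mps_nth (?P P) N1 * mps_nth (?P Q) N2)) = 0"
          by (auto simp: PQ)
      qed
    qed
    also have "\<dots> = mps_nth (miwa_substitution f) N1 * mps_nth (miwa_substitution g) N2"
      unfolding mps_nth_miwa sum_product sum.cartesian_product by (intro sum.cong) (auto simp: mult_ac)
    finally show "(\<Sum>(P, Q)\<in>X. mps_nth f P * mps_nth g Q * (mps_nth (?P P) N1 * mps_nth (?P Q) N2)) =
      mps_nth (miwa_substitution f) N1 * mps_nth (miwa_substitution g) N2" .
  qed
  finally show "mps_nth (miwa_substitution (f * g)) N = mps_nth (miwa_substitution f * miwa_substitution g) N"
    unfolding mps_nth_mult[of "miwa_substitution f"] .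
qed

text \<open>The factor from p_k must be x_i^k for a variable of multiplicity at least k in N, and
  the cofactor then has degree n - k precisely when N has degree n.\<close>

lemma mps_nth_power_sum_mult_complete_hom:
  assumes "1 \<le> k" "k \<le> n"
  shows "mps_nth (power_sum k * complete_hom (n - k)) N =
    (if size N = n then of_nat (card {i \<in> set_mset N. k \<le> count N i}) else (0 :: 'a::comm_ring_1))"
proof -
  let ?I = "{i \<in> set_mset N. k \<le> count N i}"
  let ?j = "\<lambda>i. (replicate_mset k i, N - replicate_mset k i)"
  have sub: "replicate_mset k i \<subseteq># N \<longleftrightarrow> k \<le> count N i" for i
    by (simp add: count_le_replicate_mset_subset_eq)
  have "mps_nth (power_sum k * complete_hom (n - k)) N =
     (\<Sum>p\<in>mset_splits N. (if \<exists>i. fst p = replicate_mset k i then 1 else 0) * (if size (snd p) = n - k then 1 else (0 :: 'a)))"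
    by (simp add: mps_nth_mult power_sum_def complete_hom_def case_prod_unfold)
  also have "\<dots> = (\<Sum>p\<in>?j ` ?I. if size N = n then 1 else 0)"
  proof (rule sum.mono_neutral_cong_right)
    show "?j ` ?I \<subseteq> mset_splits N" using sub by (auto simp: mset_splits_def)
    show "\<forall>p\<in>mset_splits N - ?j ` ?I. (if \<exists>i. fst p = replicate_mset k i then 1 else 0) *
       (if size (snd p) = n - k then 1 else (0 :: 'a)) = 0"
    proof
      fix p assume p: "p \<in> mset_splits N - ?j ` ?I"
      have "fst p \<noteq> replicate_mset k i" for i
      proof
        assume e: "fst p = replicate_mset k i"
        then have N: "N = replicate_mset k i + snd p" using p by (auto simp: mset_splits_def)
        then have "k \<le> count N i" by simp
        moreover from this have "i \<in># N" using assms(1) by (metis count_greater_zero_iff less_le_trans zero_less_one)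
        ultimately have "?j i \<in> ?j ` ?I" by blast
        moreover have "p = ?j i" using e N by (simp add: prod_eq_iff)
        ultimately show False using p by blast
      qed
      then show "(if \<exists>i. fst p = replicate_mset k i then 1 else 0) *
       (if size (snd p) = n - k then 1 else (0 :: 'a)) = 0" by simp
    qed
    fix p assume "p \<in> ?j ` ?I"
    then obtain i where i: "k \<le> count N i" "p = ?j i" by auto
    then have "size (snd p) + k = size N" using sub[of i] size_Diff_submset[of "replicate_mset k i" N] size_mset_mono[of "replicate_mset k i" N] by simp
    then have "size (snd p) = n - k \<longleftrightarrow> size N = n" using assms by auto
    then show "(if \<exists>i. fst p = replicate_mset k i then 1 else 0) * (if size (snd p) = n - k then 1 else 0) =
       (if size N = n then 1 else (0 :: 'a))" using i by auto
  qed simp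
  also have "\<dots> = (if size N = n then of_nat (card ?I) else 0)"
  proof -
    have "inj_on ?j ?I"
    proof (rule inj_onI)
      fix x y assume "?j x = ?j y"
      then have "count (replicate_mset k x) x = count (replicate_mset k y) x" by simp
      then show "x = y" using assms(1) by (simp split: if_splits)
    qed
    then show ?thesis by (simp add: card_image)
  qed
  finally show ?thesis .
qed

text \<open>For N of degree n, summing over k the number of variables of multiplicity at least k
  counts each variable as often as it occurs, n times in all.\<close>

lemma complete_hom_newton:
  "of_nat n * complete_hom n = (\<Sum>k=1..n. power_sum k * complete_hom (n - k) :: 'a::comm_ring_1 mps)"
proof (rule mps_eqI)
  fix N
  have "mps_nth (\<Sum>k=1..n. power_sum k * complete_hom (n - k) :: 'a mps) N =
     (\<Sum>k=1..n. if size N = n then of_nat (card {i \<in> set_mset N. k \<le> count N i}) else 0)"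
    by (simp add: mps_nth_power_sum_mult_complete_hom)
  also have "\<dots> = (if size N = n then of_nat n else 0)"
  proof (cases "size N = n")
    case True
    have "(\<Sum>k=1..n. card {i \<in> set_mset N. k \<le> count N i}) = (\<Sum>k=1..n. \<Sum>i\<in>set_mset N. if k \<le> count N i then 1 else 0)"
      by (simp add: sum.If_cases Int_def)
    also have "\<dots> = (\<Sum>i\<in>set_mset N. \<Sum>k=1..n. if k \<le> count N i then 1 else 0)" by (rule sum.swap)
    also have "\<dots> = (\<Sum>i\<in>set_mset N. count N i)"
    proof (intro sum.cong refl)
      fix i
      have "count N i \<le> n" using True count_le_size[of N i] by simp
      then have "{1..n} \<inter> {k. k \<le> count N i} = {1..count N i}" by auto
      then show "(\<Sum>k=1..n. if k \<le> count N i then 1 else 0) = count N i" by (simp add: sum.If_cases)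
    qed
    also have "\<dots> = n" using True by (simp add: size_multiset_overloaded_eq)
    finally show ?thesis using True by (simp flip: of_nat_sum)
  qed simp
  finally show "mps_nth (of_nat n * complete_hom n :: 'a mps) N = mps_nth (\<Sum>k=1..n. power_sum k * complete_hom (n - k)) N"
    by (simp add: complete_hom_def)
qed

lemma miwa_sum: "miwa_substitution (sum f A) = (\<Sum>x\<in>A. miwa_substitution (f x) :: 'k::field_char_0 fps mps)"
proof -
  have "miwa_substitution 0 = (0 :: 'k fps mps)" by (rule mps_eqI) (simp add: mps_nth_miwa)
  then show ?thesis by (induction A rule: infinite_finite_induct) (simp_all add: miwa_add)
qed

text \<open>As t_k goes to p_k / k, the substitution turns \<open>exp_coeff_newton\<close> into
  \<open>complete_hom_newton\<close>; both recursions have the same initial value 1.\<close>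

lemma miwa_exp_coeff: "miwa_substitution (exp_coeff 1 (int n)) = (complete_hom n :: 'k::field_char_0 fps mps)"
proof (induction n rule: less_induct)
  case (less n)
  show ?case
  proof (cases "n = 0")
    case True
    then show ?thesis by (simp add: exp_coeff_0 complete_hom_0 miwa_one)
  next
    case False
    have "of_nat n * miwa_substitution (exp_coeff (1 :: 'k) (int n)) = miwa_substitution (of_nat n * exp_coeff 1 (int n))"
      by (rule miwa_of_nat_mult[symmetric])
    also have "\<dots> = (\<Sum>k=1..n. miwa_substitution (of_nat k * (var k * exp_coeff 1 (int n - int k))))"
      by (simp only: exp_coeff_newton mps_const_one_mult miwa_sum)
    also have "\<dots> = (\<Sum>k=1..n. power_sum k * complete_hom (n - k))"
    proof (intro sum.cong refl)
      fix k assume k: "k \<in> {1..n}"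
      have lt: "n - k < n" and eq: "int n - int k = int (n - k)" using k by auto
      have me: "miwa_substitution (exp_coeff (1 :: 'k) (int n - int k)) = complete_hom (n - k)"
        unfolding eq by (rule less.IH[OF lt])
      have mv: "miwa_substitution (var k) = (mps_const (fps_const (1 / of_nat k)) * power_sum k :: 'k fps mps)"
        using k by (intro miwa_var) simp
      have "miwa_substitution (of_nat k * (var k * exp_coeff (1 :: 'k) (int n - int k))) =
        of_nat k * (mps_const (fps_const (1 / of_nat k)) * power_sum k * complete_hom (n - k))"
        unfolding miwa_of_nat_mult by (simp only: miwa_mult mv me)
      also have "\<dots> = power_sum k * complete_hom (n - k)"
      proof (rule mps_eqI)
        fix N
        have "of_nat k * fps_const (1 / of_nat k) = (1 :: 'k fps)"
          using k by (simp add: fps_of_nat[symmetric] del: fps_of_nat)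
        then show "mps_nth (of_nat k * (mps_const (fps_const (1 / of_nat k)) * power_sum k * complete_hom (n - k))) N =
          mps_nth (power_sum k * complete_hom (n - k) :: 'k fps mps) N"
          by (simp only: mps_nth_of_nat_mult mult.assoc mps_nth_const_mult) (simp only: mult.assoc[symmetric] mult_1_left)
      qed
      finally show "miwa_substitution (of_nat k * (var k * exp_coeff (1 :: 'k) (int n - int k))) = power_sum k * complete_hom (n - k)" .
    qed
    also have "\<dots> = of_nat n * complete_hom n" by (rule complete_hom_newton[symmetric])
    finally show ?thesis by (rule mps_of_nat_cancel) (use False in simp)
  qed
qed

lemma schur_eq_minor:
  assumes "part \<mu> N = 0"
  shows "schur \<mu> = minor schur_matrix (pset N \<mu>) {..<N}"
proof -
  have "schur \<mu> = skew_schur (pt (pset N \<mu>)) (pt {..<N})" using assms by (simp add: schur_def pt_pset)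
  also have "\<dots> = minor schur_matrix (pset N \<mu>) {..<N}" by (rule skew_schur_eq_minor) auto
  finally show ?thesis .
qed

lemma miwa_time_schur:
  assumes "part \<mu> N = 0"
  shows "miwa_substitution (time_schur (pset N \<mu>)) = (schur \<mu> :: 'k::field_char_0 fps mps)"
proof -
  have "miwa_substitution (time_schur (pset N \<mu>)) =
     minor (\<lambda>r s. miwa_substitution (time_matrix r s :: 'k fps mps)) (pset N \<mu>) {..<N}"
    using hom_minor[of UNIV miwa_substitution "pset N \<mu>" "{..<N}" "time_matrix :: nat \<Rightarrow> nat \<Rightarrow> 'k fps mps"]
    by (simp add: time_schur_def miwa_one miwa_add miwa_mult)
  also have "\<dots> = minor schur_matrix (pset N \<mu>) {..<N}"
  proof (rule minor_cong)
    fix r s :: nat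
    show "miwa_substitution (time_matrix r s :: 'k fps mps) = schur_matrix r s"
    proof (cases "s \<le> r")
      case True
      then have "int r - int s = int (r - s)" by simp
      then show ?thesis using True by (simp only: time_matrix_def miwa_exp_coeff schur_matrix_def if_True)
    next
      case False
      have "miwa_substitution 0 = (0 :: 'k fps mps)" by (rule mps_eqI) (simp add: mps_nth_miwa)
      then show ?thesis using False by (simp add: time_matrix_zero schur_matrix_def)
    qed
  qed auto
  finally show ?thesis using schur_eq_minor[OF assms, where ?'a = "'k fps"] by simp
qed

lemma schur_homogeneous:
  assumes "mps_nth (schur \<mu> :: 'a::comm_ring_1 mps) M \<noteq> 0"
  shows "psize \<mu> = size M"
proof -
  define N where "N = psize \<mu>"
  have N: "part \<mu> N = 0" using psize_bounds(1) by (simp add: N_def)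
  have "size M + \<Sum>{..<N} = \<Sum>(pset N \<mu>)"
  proof (rule minor_homogeneous[of size schur_matrix])
    fix r s M assume "mps_nth (schur_matrix r s :: 'a mps) M \<noteq> 0"
    then show "size M + s = r" by (auto simp: schur_matrix_def complete_hom_def split: if_splits)
  qed (use assms schur_eq_minor[OF N, where ?'a = 'a] in auto)
  then show ?thesis using sum_pset_psize[OF N] by simp
qed

lemma miwa_kp_series:
  "miwa_substitution (kp_series c) = Abs_mps (\<lambda>N. Sum_any (\<lambda>\<mu>. c \<mu> * mps_nth (schur \<mu>) N))"
proof (rule mps_eqI)
  fix N
  have "mps_nth (miwa_substitution (kp_series c)) N = (\<Sum>M\<in>times_of_weight (size N).
     \<Sum>\<mu> | psize \<mu> = size N. c \<mu> * (mps_nth (time_schur (pset (psize \<mu>) \<mu>)) M * mps_nth (power_sum_monomial M) N))"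
    unfolding mps_nth_miwa
    by (intro sum.cong refl) (auto simp: kp_series_def times_of_weight_def sum_distrib_right mult.assoc)
  also have "\<dots> = (\<Sum>\<mu> | psize \<mu> = size N. c \<mu> * mps_nth (miwa_substitution (time_schur (pset (psize \<mu>) \<mu>))) N)"
    unfolding mps_nth_miwa sum_distrib_left by (rule sum.swap)
  also have "\<dots> = (\<Sum>\<mu> | psize \<mu> = size N. c \<mu> * mps_nth (schur \<mu>) N)"
    using psize_bounds(1) by (simp add: miwa_time_schur)
  also have "\<dots> = Sum_any (\<lambda>\<mu>. c \<mu> * mps_nth (schur \<mu>) N)"
    using schur_homogeneous by (intro Sum_any.expand_superset[symmetric]) fastforce+
  finally show "mps_nth (miwa_substitution (kp_series c)) N =
     mps_nth (Abs_mps (\<lambda>N. Sum_any (\<lambda>\<mu>. c \<mu> * mps_nth (schur \<mu>) N))) N" by simp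
qed

theorem theorem3p1:
  fixes u :: "'k::field_char_0" and \<phi> :: "'k mps \<Rightarrow> 'k" and a :: int
  assumes "u \<noteq> 0"
    and "\<And>n::nat. n \<ge> 1 \<Longrightarrow> u ^ n \<noteq> 1"
    and "qrho_specialization u \<phi>"
  shows "(\<exists>R :: nat \<Rightarrow> nat \<Rightarrow> 'k fps. open_V u \<phi> a = bogoliubov_vacuum R) \<and>
         (\<exists>\<tau> :: 'k fps mps. open_Z u \<phi> a = miwa_substitution \<tau> \<and> kp_tau_function \<tau>)"
proof -
  let ?c = "open_coeff u \<phi> a"
  have c: "plucker_part ?c" by (rule plucker_part_open_coeff) (use assms in auto)
  have "open_V u \<phi> a = state ?c" by (simp add: fun_eq_iff open_V_def state_def)
  also have "\<dots> = bogoliubov_vacuum (hook_coeff ?c)"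
    using bogoliubov_state[OF c open_coeff_empty[OF assms(3)]] by simp
  finally have "open_V u \<phi> a = bogoliubov_vacuum (hook_coeff ?c)" .
  moreover have "open_Z u \<phi> a = miwa_substitution (kp_series ?c)"
    unfolding open_Z_def miwa_kp_series ..
  ultimately show ?thesis using kp_tau_function_kp_series[OF c] by blast
qed

end
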